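(* Let $t\in\mathbb{N}$ and let $\mathscr D$ be a graph class of structurally bounded expansion such that no member of $\mathscr D$ contains $K_{t,t}$ as an induced subgraph. Then $\mathscr D$ has bounded subchromatic number.
   Context: Graphs are finite, simple, undirected. A (first-order) transduction $\mathsf T$ consists of a finite set $C$ of unary predicates and a symmetric first-order formula $\varphi(x,y)$ over graphs expanded by the predicates of $C$. A graph $H$ is transducible from $G$ via $\mathsf T$ if $H$ is obtained by: choosing arbitrary interpretations of the predicates of $C$ as vertex subsets of $G$ (obtaining $G^+$); forming the graph $H^+$ on $V(G)$ in which $u,v$ are adjacent iff $G^+\models\varphi(u,v)$; and taking an arbitrary induced subgraph of $H^+$. A class $\mathscr D$ is transducible from $\mathscr C$ if there is a transduction $\mathsf T$ such that every member of $\mathscr D$ is transducible via $\mathsf T$ from some member of $\mathscr C$. A graph $H$ is a depth-$d$ minor of $G$ if one can assign to each $u\in V(H)$ a connected subgraph $\eta(u)$ of $G$ of radius at most $d$, pairwise vertex-disjoint, with an edge of $G$ between $\eta(u)$ and $\eta(v)$ for each edge $uv$ of $H$; a class has bounded expansion if for each $d$ the maximum average degree of depth-$d$ minors of its members is bounded. $\mathscr D$ has structurally bounded expansion if it is transducible from some class of bounded expansion. A cluster graph is a graph whose every component is a clique; a subcoloring of $G$ is a map $\lambda\colon V(G)\to C$ with $G[\lambda^{-1}(i)]$ a cluster graph for each $i$; the subchromatic number is the minimum number of colors of a subcoloring; a class has bounded subchromatic number if some constant bounds it for all members. *)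

theory Defs
  imports Complex_Main
begin

record 'a graph =
  verts :: "'a set"
  adj :: "'a \<Rightarrow> 'a \<Rightarrow> bool"

definition simple_graph :: "'a graph \<Rightarrow> bool" where
  "simple_graph G \<longleftrightarrow> finite (verts G)
     \<and> (\<forall>u v. adj G u v \<longrightarrow> u \<in> verts G \<and> v \<in> verts G)
     \<and> (\<forall>u v. adj G u v \<longrightarrow> adj G v u)
     \<and> (\<forall>u. \<not> adj G u u)"

definition graph_class :: "'a graph set \<Rightarrow> bool" where
  "graph_class \<C> \<longleftrightarrow> (\<forall>G\<in>\<C>. simple_graph G)"

definition subgraph :: "'a graph \<Rightarrow> 'a graph \<Rightarrow> bool" where
  "subgraph S G \<longleftrightarrow> simple_graph S \<and> verts S \<subseteq> verts G
     \<and> (\<forall>u v. adj S u v \<longrightarrow> adj G u v)"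

definition induced :: "'a graph \<Rightarrow> 'a set \<Rightarrow> 'a graph" where
  "induced G S = \<lparr>verts = S, adj = (\<lambda>u v. u \<in> S \<and> v \<in> S \<and> adj G u v)\<rparr>"

definition isomorphic :: "'a graph \<Rightarrow> 'b graph \<Rightarrow> bool" where
  "isomorphic G H \<longleftrightarrow> (\<exists>f. bij_betw f (verts G) (verts H)
     \<and> (\<forall>u\<in>verts G. \<forall>v\<in>verts G. adj G u v \<longleftrightarrow> adj H (f u) (f v)))"

definition contains_induced :: "'a graph \<Rightarrow> 'b graph \<Rightarrow> bool" where
  "contains_induced G H \<longleftrightarrow> (\<exists>S\<subseteq>verts G. isomorphic H (induced G S))"

definition complete_bipartite :: "nat \<Rightarrow> nat \<Rightarrow> (nat + nat) graph" where
  "complete_bipartite s t =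
     \<lparr>verts = {..<s} <+> {..<t},
      adj = (\<lambda>x y. \<exists>i<s. \<exists>j<t. x = Inl i \<and> y = Inr j \<or> x = Inr j \<and> y = Inl i)\<rparr>"


section \<open>First-order transductions\<close>

text \<open>Variables and unary predicates are both named by natural numbers.\<close>

datatype fo =
    FEq nat nat
  | FAdj nat nat
  | FPred nat nat  \<comment> \<open>predicate name, then variable\<close>
  | FNot fo
  | FAnd fo fo
  | FEx nat fo

fun free_vars :: "fo \<Rightarrow> nat set" where
  "free_vars (FEq x y) = {x, y}"
| "free_vars (FAdj x y) = {x, y}"
| "free_vars (FPred p x) = {x}"
| "free_vars (FNot \<phi>) = free_vars \<phi>"
| "free_vars (FAnd \<phi> \<psi>) = free_vars \<phi> \<union> free_vars \<psi>"
| "free_vars (FEx x \<phi>) = free_vars \<phi> - {x}"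

fun pred_names :: "fo \<Rightarrow> nat set" where
  "pred_names (FEq x y) = {}"
| "pred_names (FAdj x y) = {}"
| "pred_names (FPred p x) = {p}"
| "pred_names (FNot \<phi>) = pred_names \<phi>"
| "pred_names (FAnd \<phi> \<psi>) = pred_names \<phi> \<union> pred_names \<psi>"
| "pred_names (FEx x \<phi>) = pred_names \<phi>"

fun sat :: "'a graph \<Rightarrow> (nat \<Rightarrow> 'a set) \<Rightarrow> (nat \<Rightarrow> 'a) \<Rightarrow> fo \<Rightarrow> bool" where
  "sat G I s (FEq x y) \<longleftrightarrow> s x = s y"
| "sat G I s (FAdj x y) \<longleftrightarrow> adj G (s x) (s y)"
| "sat G I s (FPred p x) \<longleftrightarrow> s x \<in> I p"
| "sat G I s (FNot \<phi>) \<longleftrightarrow> \<not> sat G I s \<phi>"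
| "sat G I s (FAnd \<phi> \<psi>) \<longleftrightarrow> sat G I s \<phi> \<and> sat G I s \<psi>"
| "sat G I s (FEx x \<phi>) \<longleftrightarrow> (\<exists>a\<in>verts G. sat G I (s(x := a)) \<phi>)"

text \<open>In a formula \<open>\<phi>(x,y)\<close> the variable \<open>x\<close> is \<open>0\<close> and \<open>y\<close> is \<open>1\<close>.\<close>

definition sat2 :: "'a graph \<Rightarrow> (nat \<Rightarrow> 'a set) \<Rightarrow> fo \<Rightarrow> 'a \<Rightarrow> 'a \<Rightarrow> bool" where
  "sat2 G I \<phi> u v \<longleftrightarrow> sat G I (\<lambda>n. if n = 0 then u else v) \<phi>"

record transduction =
  preds :: "nat set"
  formula :: fo

definition expansion_of :: "nat set \<Rightarrow> 'a graph \<Rightarrow> (nat \<Rightarrow> 'a set) \<Rightarrow> bool" where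
  "expansion_of C G I \<longleftrightarrow> (\<forall>p\<in>C. I p \<subseteq> verts G)"

text \<open>Symmetry is semantic. Testing it on graphs with vertices in \<open>nat\<close> is no restriction,
  since every finite graph is isomorphic to one of these.\<close>

definition symmetric_formula :: "nat set \<Rightarrow> fo \<Rightarrow> bool" where
  "symmetric_formula C \<phi> \<longleftrightarrow>
     (\<forall>(G :: nat graph) I. simple_graph G \<longrightarrow> expansion_of C G I \<longrightarrow>
        (\<forall>u\<in>verts G. \<forall>v\<in>verts G. sat2 G I \<phi> u v \<longleftrightarrow> sat2 G I \<phi> v u))"

definition is_transduction :: "transduction \<Rightarrow> bool" where
  "is_transduction T \<longleftrightarrow> finite (preds T)
     \<and> pred_names (formula T) \<subseteq> preds T
     \<and> free_vars (formula T) \<subseteq> {0, 1}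
     \<and> symmetric_formula (preds T) (formula T)"

text \<open>Graphs have no loops, so \<open>\<phi>(u,u)\<close> is ignored.\<close>

definition interpreted :: "fo \<Rightarrow> 'a graph \<Rightarrow> (nat \<Rightarrow> 'a set) \<Rightarrow> 'a graph" where
  "interpreted \<phi> G I =
     \<lparr>verts = verts G,
      adj = (\<lambda>u v. u \<in> verts G \<and> v \<in> verts G \<and> u \<noteq> v \<and> sat2 G I \<phi> u v)\<rparr>"

definition transducible :: "transduction \<Rightarrow> 'a graph \<Rightarrow> 'b graph \<Rightarrow> bool" where
  "transducible T G H \<longleftrightarrow>
     (\<exists>I. expansion_of (preds T) G I \<and> contains_induced (interpreted (formula T) G I) H)"

definition class_transducible :: "'a graph set \<Rightarrow> 'b graph set \<Rightarrow> bool" where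
  "class_transducible \<C> \<D> \<longleftrightarrow>
     (\<exists>T. is_transduction T \<and> (\<forall>H\<in>\<D>. \<exists>G\<in>\<C>. transducible T G H))"


section \<open>Bounded expansion\<close>

definition connected_graph :: "'a graph \<Rightarrow> bool" where
  "connected_graph G \<longleftrightarrow> verts G \<noteq> {} \<and> (\<forall>u\<in>verts G. \<forall>v\<in>verts G. (adj G)\<^sup>*\<^sup>* u v)"

text \<open>Distance, eccentricity and radius are meaningful for finite connected graphs only.\<close>

definition graph_dist :: "'a graph \<Rightarrow> 'a \<Rightarrow> 'a \<Rightarrow> nat" where
  "graph_dist G u v = (LEAST k. (adj G ^^ k) u v)"

definition eccentricity :: "'a graph \<Rightarrow> 'a \<Rightarrow> nat" where
  "eccentricity G u = Max (graph_dist G u ` verts G)"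

definition radius :: "'a graph \<Rightarrow> nat" where
  "radius G = Min (eccentricity G ` verts G)"

definition depth_minor :: "nat \<Rightarrow> 'b graph \<Rightarrow> 'a graph \<Rightarrow> bool" where
  "depth_minor d H G \<longleftrightarrow> simple_graph H \<and>
     (\<exists>\<eta> :: 'b \<Rightarrow> 'a graph.
        (\<forall>u\<in>verts H. subgraph (\<eta> u) G \<and> connected_graph (\<eta> u) \<and> radius (\<eta> u) \<le> d)
      \<and> (\<forall>u\<in>verts H. \<forall>v\<in>verts H. u \<noteq> v \<longrightarrow> verts (\<eta> u) \<inter> verts (\<eta> v) = {})
      \<and> (\<forall>u v. adj H u v \<longrightarrow> (\<exists>a\<in>verts (\<eta> u). \<exists>b\<in>verts (\<eta> v). adj G a b)))"

definition degree :: "'a graph \<Rightarrow> 'a \<Rightarrow> nat" where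
  "degree G u = card {v. adj G u v}"

definition average_degree :: "'a graph \<Rightarrow> real" where
  "average_degree G = (\<Sum>u\<in>verts G. real (degree G u)) / real (card (verts G))"

text \<open>Minors of finite graphs are finite, so it suffices to consider minors with vertices
  in \<open>nat\<close>. The same applies to the source class of a transduction below.\<close>

definition bounded_expansion :: "'a graph set \<Rightarrow> bool" where
  "bounded_expansion \<C> \<longleftrightarrow>
     (\<forall>d. \<exists>c. \<forall>G\<in>\<C>. \<forall>H :: nat graph. depth_minor d H G \<longrightarrow> average_degree H \<le> c)"

definition structurally_bounded_expansion :: "'a graph set \<Rightarrow> bool" where
  "structurally_bounded_expansion \<D> \<longleftrightarrow>
     (\<exists>\<C> :: nat graph set. graph_class \<C> \<and> bounded_expansion \<C> \<and> class_transducible \<C> \<D>)"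


section \<open>Subcolorings\<close>

definition components :: "'a graph \<Rightarrow> 'a set set" where
  "components G = (\<lambda>u. {v \<in> verts G. (adj G)\<^sup>*\<^sup>* u v}) ` verts G"

definition clique :: "'a graph \<Rightarrow> 'a set \<Rightarrow> bool" where
  "clique G X \<longleftrightarrow> (\<forall>u\<in>X. \<forall>v\<in>X. u \<noteq> v \<longrightarrow> adj G u v)"

definition cluster_graph :: "'a graph \<Rightarrow> bool" where
  "cluster_graph G \<longleftrightarrow> (\<forall>X\<in>components G. clique G X)"

definition subcoloring :: "'a graph \<Rightarrow> 'c set \<Rightarrow> ('a \<Rightarrow> 'c) \<Rightarrow> bool" where
  "subcoloring G C c \<longleftrightarrow> c ` verts G \<subseteq> C
     \<and> (\<forall>i\<in>C. cluster_graph (induced G {v \<in> verts G. c v = i}))"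

definition subchromatic_number :: "'a graph \<Rightarrow> nat" where
  "subchromatic_number G = (LEAST k. \<exists>c :: 'a \<Rightarrow> nat. subcoloring G {..<k} c)"

text \<open>The minimum is attained: an injective coloring is a subcoloring.\<close>

lemma subchromatic_number_attained:
  assumes "simple_graph G"
  shows "\<exists>c :: 'a \<Rightarrow> nat. subcoloring (G :: 'a graph) {..<subchromatic_number G} c"
proof -
  have "finite (verts G)" using assms by (simp add: simple_graph_def)
  then obtain c :: "'a \<Rightarrow> nat" and n where c: "c ` verts G = {i. i < n}" "inj_on c (verts G)"
    using finite_imp_inj_to_nat_seg by blast
  have "cluster_graph (induced G {v \<in> verts G. c v = i})" for i
    using inj_onD[OF c(2)]
    by (auto simp: cluster_graph_def components_def clique_def induced_def)
  then have "subcoloring G {..<n} c"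
    using c(1) by (auto simp: subcoloring_def)
  then have "\<exists>k. \<exists>c :: 'a \<Rightarrow> nat. subcoloring G {..<k} c" by blast
  then show ?thesis unfolding subchromatic_number_def by (rule LeastI_ex)
qed

definition bounded_subchromatic_number :: "'a graph set \<Rightarrow> bool" where
  "bounded_subchromatic_number \<D> \<longleftrightarrow> (\<exists>k. \<forall>G\<in>\<D>. subchromatic_number G \<le> k)"

end

(* By sparsity, a maximal system of disjoint short links between the remaining vertices always leaves
   one of them that a bounded number of vertices separates from the others within a bounded radius.
   Ordering the vertices accordingly bounds weak reachability, and a greedy coloring along this order
   makes long paths use many colors. Hence the union of boundedly many color classes has a depth-first
   search forest of bounded height. These forests eliminate quantifiers: a labelling of the forests by
   subtree types allows a back-and-forth argument in which the type of a tuple is that of its images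
   under parent functions. So each relation phi(u,v) becomes, on the classes of a bounded partition, a
   function of the level at which u and v meet in such a forest. Each class is then a cograph of bounded
   height, and in a join without induced biclique all parts but one have small independence number,
   hence are covered by few cliques. *)

theory Submission
  imports Defs "HOL-Library.FuncSet"
begin

section \<open>Shallow minors and weak reachability\<close>

text \<open>After one quantifier has been eliminated, truth depends on terms in new functions, and
  the next round has to cope with them. This is why the forests come from depth-first search: the
  parent of a vertex is itself or a neighbour. Every function that arises is therefore
  \<open>guarded\<close>, and in any elimination forest containing a vertex and its value the two
  are comparable, so a bounded label can record the value by counting levels. The graph itself never
  changes, so its sparsity is available again in each round. Which forest is used depends on the
  colors of all terms over the given tuple and the new vertex. As this vertex is arbitrary, every
  set of at most \<open>p\<close> colors gets a forest, and all the parent functions are added. In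
  each round the number of terms determines \<open>p\<close>, the coloring for \<open>p\<close>
  gives forests of height at most 2^p, and terms times height give the threshold \<open>q\<close> at
  which multiplicities are truncated.\<close>

lemma simple_graph_finite: "simple_graph G \<Longrightarrow> finite (verts G)"
  and simple_graph_in_verts: "simple_graph G \<Longrightarrow> adj G u v \<Longrightarrow> u \<in> verts G \<and> v \<in> verts G"
  and simple_graph_sym: "simple_graph G \<Longrightarrow> adj G u v \<Longrightarrow> adj G v u"
  and simple_graph_irrefl: "simple_graph G \<Longrightarrow> \<not> adj G u u"
  by (simp_all add: simple_graph_def)

lemma simple_graphI:
  assumes "finite (verts G)" "\<And>u v. adj G u v \<Longrightarrow> u \<in> verts G \<and> v \<in> verts G"
    "\<And>u v. adj G u v \<Longrightarrow> adj G v u" "\<And>u. \<not> adj G u u"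
  shows "simple_graph G"
  unfolding simple_graph_def using assms by blast

text \<open>All vertices of the walk after the start lie in \<open>X\<close>, the start itself need
  not. Reversing a walk therefore requires the start to be in \<open>X\<close>.\<close>

primrec reach :: "('a \<Rightarrow> 'a \<Rightarrow> bool) \<Rightarrow> 'a set \<Rightarrow> nat \<Rightarrow> 'a \<Rightarrow> 'a set" where
  "reach E X 0 v = {v}"
| "reach E X (Suc n) v = reach E X n v \<union> {b \<in> X. \<exists>a\<in>reach E X n v. E a b}"

lemma reach_self: "v \<in> reach E X n v"
  by (induction n) auto

lemma reach_subset: "reach E X n v \<subseteq> insert v X"
  by (induction n) auto

lemma reach_mono: "X \<subseteq> Y \<Longrightarrow> reach E X n v \<subseteq> reach E Y n v"
  by (induction n) auto

lemma reach_mono_length: "m \<le> n \<Longrightarrow> reach E X m v \<subseteq> reach E X n v"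
  by (induction n) (auto simp: le_Suc_eq)

lemma reach_trans:
  "w \<in> reach E X m v \<Longrightarrow> u \<in> reach E X n w \<Longrightarrow> u \<in> reach E X (m + n) v"
  by (induction n arbitrary: u) auto

lemma reach_sym:
  assumes "\<And>a b. E a b \<Longrightarrow> E b a" "v \<in> X" "w \<in> reach E X n v"
  shows "v \<in> reach E X n w"
  using assms(3)
proof (induction n arbitrary: w)
  case (Suc n)
  show ?case
  proof (cases "w \<in> reach E X n v")
    case True
    then show ?thesis using Suc.IH by auto
  next
    case False
    then obtain a where a: "a \<in> reach E X n v" "E a w" using Suc.prems by auto
    have "a \<in> X" using a(1) reach_subset[of E X n v] assms(2) by auto
    then have "a \<in> reach E X (Suc 0) w" using a(2) assms(1) by auto
    from reach_trans[OF this Suc.IH[OF a(1)]] show ?thesis by simp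
  qed
qed simp

text \<open>\<open>Q\<close> collects the vertices of one walk after its start. The last conjunct
  says that the walk runs inside \<open>Q\<close>, so that \<open>Q\<close> can serve as the
  interior of a link; \<open>insert v Q\<close> covers the trivial walk.\<close>

lemma reach_finite_witness:
  assumes "y \<in> reach E X n v"
  shows "\<exists>Q\<subseteq>X. finite Q \<and> card Q \<le> n \<and> y \<in> insert v Q \<and> Q \<subseteq> reach E Q n v"
  using assms
proof (induction n arbitrary: y)
  case (Suc n)
  show ?case
  proof (cases "y \<in> reach E X n v")
    case True
    then obtain Q where "Q\<subseteq>X" "finite Q" "card Q \<le> n" "y \<in> insert v Q" "Q \<subseteq> reach E Q n v"
      using Suc.IH by blast
    then show ?thesis by (intro exI[of _ Q]) auto
  next
    case False
    then obtain a where a: "a \<in> reach E X n v" "E a y" "y \<in> X" using Suc.prems by auto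
    obtain Q where Q: "Q\<subseteq>X" "finite Q" "card Q \<le> n" "a \<in> insert v Q" "Q \<subseteq> reach E Q n v"
      using Suc.IH[OF a(1)] by blast
    have m: "reach E Q n v \<subseteq> reach E (insert y Q) n v" by (rule reach_mono) auto
    have "a \<in> reach E (insert y Q) n v" using Q(4,5) m reach_self[of v] by auto
    then have "insert y Q \<subseteq> reach E (insert y Q) (Suc n) v" using a(2) Q(5) m by auto
    moreover have "card (insert y Q) \<le> Suc n" using Q(2,3) by (simp add: card_insert_if)
    moreover have "insert y Q \<subseteq> X" "finite (insert y Q)" using Q(1,2) a(3) by auto
    ultimately show ?thesis by blast
  qed
qed auto

text \<open>Cut the walk before its first visit to \<open>w\<close>: the part up to there avoids
  \<open>w\<close> and so stays in \<open>Y\<close>.\<close>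

lemma reach_enter:
  assumes "w \<in> reach E (insert w Y) n v" "w \<noteq> v"
  shows "\<exists>y\<in>reach E Y n v. E y w"
proof -
  have "x \<in> reach E Y n v \<or> (\<exists>y\<in>reach E Y n v. E y w)" if "x \<in> reach E (insert w Y) n v" for x
    using that by (induction n arbitrary: x) auto
  from this[OF assms(1)] show ?thesis
  proof
    assume "w \<in> reach E Y n v"
    then show ?thesis using assms(2) by (induction n) auto
  qed
qed

lemma reach_relpowp:
  assumes "w \<in> reach E X n v" "v \<in> X"
  shows "\<exists>k\<le>n. ((\<lambda>a b. a \<in> X \<and> b \<in> X \<and> E a b) ^^ k) v w"
  using assms
proof (induction n arbitrary: w)
  case (Suc n)
  show ?case
  proof (cases "w \<in> reach E X n v")
    case True
    then show ?thesis using Suc.IH assms(2) le_SucI by blast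
  next
    case False
    then obtain a where a: "a \<in> reach E X n v" "E a w" "w \<in> X" using Suc.prems by auto
    then obtain k where k: "k \<le> n" "((\<lambda>a b. a \<in> X \<and> b \<in> X \<and> E a b) ^^ k) v a"
      using Suc.IH assms(2) by blast
    have "a \<in> X" using a(1) reach_subset[of E X n v] assms(2) by auto
    then have "((\<lambda>a b. a \<in> X \<and> b \<in> X \<and> E a b) ^^ Suc k) v w"
      using k a by (auto intro: relpowp_Suc_I)
    then show ?thesis using k(1) by (intro exI[of _ "Suc k"]) auto
  qed
qed auto

section \<open>Shallow minors from sets with a center\<close>

lemma induced_radius_le:
  assumes G: "simple_graph G" and B: "B \<subseteq> verts G" "c \<in> B" "B \<subseteq> reach (adj G) B d c"
  shows "subgraph (induced G B) G" "connected_graph (induced G B)" "radius (induced G B) \<le> d"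
proof -
  have fin: "finite B" using simple_graph_finite[OF G] B(1) finite_subset by blast
  have "simple_graph (induced G B)"
    by (rule simple_graphI)
      (use fin simple_graph_sym[OF G] simple_graph_irrefl[OF G] in \<open>auto simp: induced_def\<close>)
  then show "subgraph (induced G B) G"
    using B(1) by (auto simp: subgraph_def induced_def)
  let ?A = "\<lambda>a b. a \<in> B \<and> b \<in> B \<and> adj G a b"
  have pw: "\<exists>k\<le>d. (?A ^^ k) c w" if "w \<in> B" for w
    using reach_relpowp[of w "adj G" B d c] that B by auto
  have c_to: "?A\<^sup>*\<^sup>* c w" if "w \<in> B" for w using pw[OF that] relpowp_imp_rtranclp by fast
  have "symp ?A" using simple_graph_sym[OF G] by (auto intro: sympI)
  then have to_c: "?A\<^sup>*\<^sup>* w c" if "w \<in> B" for w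
    using c_to[OF that] symp_rtranclp[of ?A] by (auto dest: sympD)
  show "connected_graph (induced G B)"
    unfolding connected_graph_def induced_def
    using B(2) rtranclp_trans[OF to_c c_to] by auto
  have gd: "graph_dist (induced G B) c w \<le> d" if "w \<in> B" for w
  proof -
    obtain k where "k \<le> d" "(?A ^^ k) c w" using pw[OF \<open>w \<in> B\<close>] by blast
    then show ?thesis unfolding graph_dist_def induced_def
      by (auto intro: order_trans[OF Least_le])
  qed
  have "eccentricity (induced G B) c \<le> d"
    unfolding eccentricity_def
  proof (rule Max.boundedI)
    show "finite (graph_dist (induced G B) c ` verts (induced G B))"
      "graph_dist (induced G B) c ` verts (induced G B) \<noteq> {}"
      using fin B(2) by (auto simp: induced_def)
  qed (use gd in \<open>auto simp: induced_def\<close>)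
  moreover have "radius (induced G B) \<le> eccentricity (induced G B) c"
    unfolding radius_def using fin B(2) by (intro Min_le) (auto simp: induced_def)
  ultimately show "radius (induced G B) \<le> d" by simp
qed

lemma depth_minorI:
  assumes "simple_graph G" "simple_graph H"
    and "\<And>u. u \<in> verts H \<Longrightarrow> B u \<subseteq> verts G \<and> c u \<in> B u \<and> B u \<subseteq> reach (adj G) (B u) d (c u)"
    and "\<And>u v. u \<in> verts H \<Longrightarrow> v \<in> verts H \<Longrightarrow> u \<noteq> v \<Longrightarrow> B u \<inter> B v = {}"
    and "\<And>u v. adj H u v \<Longrightarrow> \<exists>a\<in>B u. \<exists>b\<in>B v. adj G a b"
  shows "depth_minor d H G"
  unfolding depth_minor_def
proof (intro conjI exI[of _ "\<lambda>u. induced G (B u)"] ballI allI impI)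
  fix u assume "u \<in> verts H"
  then show "subgraph (induced G (B u)) G" "connected_graph (induced G (B u))"
    "radius (induced G (B u)) \<le> d"
    using induced_radius_le[OF assms(1), of "B u" "c u" d] assms(3) by auto
qed (use assms in \<open>auto simp: induced_def\<close>)

text \<open>\<open>Q (s, s')\<close> is the interior of a short connection from \<open>s\<close> to \<open>s'\<close>; as a branch set it is
  attached to \<open>s\<close>.\<close>

definition link_system ::
  "'a graph \<Rightarrow> 'a set \<Rightarrow> nat \<Rightarrow> ('a \<times> 'a) set \<Rightarrow> ('a \<times> 'a \<Rightarrow> 'a set) \<Rightarrow> bool" where
  "link_system G S m E Q \<longleftrightarrow> E \<subseteq> S \<times> S \<and>
     (\<forall>(s, s')\<in>E. s \<noteq> s' \<and> Q (s, s') \<subseteq> verts G - S \<and> card (Q (s, s')) \<le> m \<and>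
        Q (s, s') \<subseteq> reach (adj G) (insert s (Q (s, s'))) m s \<and>
        (\<exists>y\<in>insert s (Q (s, s')). adj G y s')) \<and>
     (\<forall>e\<in>E. \<forall>e'\<in>E. e \<noteq> e' \<longrightarrow> Q e \<inter> Q e' = {})"

lemma link_system_insert:
  assumes L: "link_system G S m E Q" and vw: "v \<in> S" "w \<in> S" "v \<noteq> w" "(v, w) \<notin> E"
    and R: "R \<subseteq> verts G - S" "R \<inter> (\<Union>e\<in>E. Q e) = {}" "card R \<le> m"
      "R \<subseteq> reach (adj G) (insert v R) m v" "\<exists>y\<in>insert v R. adj G y w"
  shows "link_system G S m (insert (v, w) E) (Q((v, w) := R))"
proof -
  have "(Q((v, w) := R)) e = Q e" if "e \<in> E" for e using that vw(4) by auto
  moreover have "R \<inter> Q e = {}" if "e \<in> E" for e using that R(2) by blast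
  ultimately show ?thesis
    using L vw(1-3) R(1,3-5) unfolding link_system_def by (auto simp: Int_commute)
qed

text \<open>The branch sets are disjoint because interiors of links avoid \<open>S\<close> and each
  other. Each is reached from its vertex of \<open>S\<close> within \<open>m\<close> steps, and the
  last edge of a link is the edge that the minor needs.\<close>

lemma link_system_minor:
  assumes G: "simple_graph G" and S: "S \<subseteq> verts G" and L: "link_system G S m E Q"
  shows "depth_minor m \<lparr>verts = S, adj = (\<lambda>s s'. (s, s') \<in> E \<or> (s', s) \<in> E)\<rparr> G"
    (is "depth_minor m ?H G")
proof (rule depth_minorI[where c = id and B = "\<lambda>s. insert s (\<Union>s'\<in>{s'. (s, s') \<in> E}. Q (s, s'))"])
  let ?B = "\<lambda>s. insert s (\<Union>s'\<in>{s'. (s, s') \<in> E}. Q (s, s'))"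
  have finS: "finite S" using simple_graph_finite[OF G] S finite_subset by blast
  have E: "E \<subseteq> S \<times> S" "\<And>s s'. (s, s') \<in> E \<Longrightarrow> s \<noteq> s'"
    "\<And>s s'. (s, s') \<in> E \<Longrightarrow> Q (s, s') \<subseteq> verts G - S"
    "\<And>s s'. (s, s') \<in> E \<Longrightarrow> Q (s, s') \<subseteq> reach (adj G) (insert s (Q (s, s'))) m s"
    "\<And>s s'. (s, s') \<in> E \<Longrightarrow> \<exists>y\<in>insert s (Q (s, s')). adj G y s'"
    "\<And>e e'. e \<in> E \<Longrightarrow> e' \<in> E \<Longrightarrow> e \<noteq> e' \<Longrightarrow> Q e \<inter> Q e' = {}"
    using L unfolding link_system_def by blast+
  show "simple_graph G" by (rule G)
  show "simple_graph ?H" by (rule simple_graphI) (use finS E(1,2) in auto)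
  show "?B u \<subseteq> verts G \<and> id u \<in> ?B u \<and> ?B u \<subseteq> reach (adj G) (?B u) m (id u)"
    if "u \<in> verts ?H" for u
  proof -
    have "Q (u, s') \<subseteq> reach (adj G) (?B u) m u" if "(u, s') \<in> E" for s'
    proof -
      have "insert u (Q (u, s')) \<subseteq> ?B u" using that by blast
      from reach_mono[OF this, of "adj G" m u] E(4)[OF that] show ?thesis by (rule subset_trans[rotated])
    qed
    moreover have "u \<in> verts G" using that S by auto
    moreover have "Q (u, s') \<subseteq> verts G" if "(u, s') \<in> E" for s' using E(3)[OF that] by blast
    ultimately show ?thesis using reach_self[of u "adj G" "?B u" m] by (simp add: UN_subset_iff)
  qed
  show "?B u \<inter> ?B v = {}" if "u \<in> verts ?H" "v \<in> verts ?H" "u \<noteq> v" for u v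
    using that E(3,6) by fastforce
  show "\<exists>a\<in>?B u. \<exists>b\<in>?B v. adj G a b" if "adj ?H u v" for u v
  proof -
    have *: "\<exists>a\<in>?B u. \<exists>b\<in>?B v. adj G a b" if "(u, v) \<in> E" for u v
      using E(5)[OF that] that by blast
    have "(u, v) \<in> E \<or> (v, u) \<in> E" using that by simp
    then show ?thesis
    proof
      assume "(v, u) \<in> E"
      from *[OF this] show ?thesis using simple_graph_sym[OF G] by blast
    qed (rule *)
  qed
qed

text \<open>At least half of the vertices have degree at most \<open>2 * c\<close>. A largest
  independent set among them dominates them, each of its vertices taking care of at most
  \<open>2 * c + 1\<close>; the half doubles this to \<open>4 * c + 2\<close>.\<close>

lemma independent_subset:
  assumes H: "simple_graph H" and n: "verts H \<noteq> {}" and c: "average_degree H \<le> real c"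
  shows "\<exists>A\<subseteq>verts H. (\<forall>u\<in>A. \<forall>v\<in>A. \<not> adj H u v) \<and> card (verts H) \<le> (4 * c + 2) * card A"
proof -
  let ?V = "verts H"
  have fin: "finite ?V" using H by (simp add: simple_graph_def)
  have pos: "card ?V > 0" using fin n by (simp add: card_gt_0_iff)
  have "(\<Sum>u\<in>?V. real (degree H u)) \<le> real c * real (card ?V)"
    using c pos by (simp add: average_degree_def divide_le_eq)
  then have sum: "(\<Sum>u\<in>?V. degree H u) \<le> c * card ?V"
    by (metis (mono_tags) of_nat_le_iff of_nat_mult of_nat_sum)
  define B where "B = {u \<in> ?V. degree H u \<le> 2 * c}"
  have "(2 * c + 1) * card (?V - B) = (\<Sum>u\<in>?V - B. 2 * c + 1)" by simp
  also have "\<dots> \<le> (\<Sum>u\<in>?V - B. degree H u)" by (rule sum_mono) (auto simp: B_def)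
  also have "\<dots> \<le> (\<Sum>u\<in>?V. degree H u)" by (rule sum_mono2) (use fin in auto)
  finally have le: "(2 * c + 1) * card (?V - B) \<le> c * card ?V" using sum by simp
  have BV: "B \<subseteq> ?V" by (auto simp: B_def)
  then have finB: "finite B" using fin finite_subset by blast
  have half: "2 * card (?V - B) \<le> card ?V"
  proof (cases "c = 0")
    case False
    have "c * (2 * card (?V - B)) \<le> (2 * c + 1) * card (?V - B)" by (simp add: algebra_simps)
    then have "c * (2 * card (?V - B)) \<le> c * card ?V" using le by linarith
    then show ?thesis using False by simp
  qed (use le in simp)
  have "card ?V = card B + card (?V - B)" using BV fin
    by (metis card_Diff_subset card_mono finB le_add_diff_inverse)
  then have B2: "card ?V \<le> 2 * card B" using half by simp
  let ?P = "\<lambda>A. A \<subseteq> B \<and> (\<forall>u\<in>A. \<forall>v\<in>A. \<not> adj H u v)"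
  have "\<exists>A. ?P A \<and> (\<forall>A'. ?P A' \<longrightarrow> card A' \<le> card A)"
    by (rule ex_has_greatest_nat[of ?P "{}" card "Suc (card B)"])
      (auto simp: less_Suc_eq_le intro: card_mono finB)
  then obtain A where A: "?P A" "\<And>A'. ?P A' \<Longrightarrow> card A' \<le> card A" by blast
  have finA: "finite A" using A(1) finB finite_subset by blast
  have "B \<subseteq> (\<Union>u\<in>A. insert u {v. adj H u v})"
  proof
    fix b assume b: "b \<in> B"
    show "b \<in> (\<Union>u\<in>A. insert u {v. adj H u v})"
    proof (rule ccontr)
      assume n: "b \<notin> (\<Union>u\<in>A. insert u {v. adj H u v})"
      then have "?P (insert b A)"
        using A(1) b simple_graph_irrefl[OF H] simple_graph_sym[OF H] by blast
      from A(2)[OF this] show False using n finA by (auto simp: card_insert_if split: if_splits)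
    qed
  qed
  moreover have fadj: "finite {v. adj H u v}" for u
    using simple_graph_in_verts[OF H] by (intro finite_subset[OF _ fin]) auto
  ultimately have "card B \<le> card (\<Union>u\<in>A. insert u {v. adj H u v})"
    using finA by (intro card_mono) auto
  also have "\<dots> \<le> (\<Sum>u\<in>A. card (insert u {v. adj H u v}))" by (rule card_UN_le[OF finA])
  also have "\<dots> \<le> (\<Sum>u\<in>A. 2 * c + 1)"
  proof (rule sum_mono)
    fix u assume "u \<in> A"
    then have "card {v. adj H u v} \<le> 2 * c" using A(1) by (auto simp: B_def degree_def)
    then show "card (insert u {v. adj H u v}) \<le> 2 * c + 1"
      using fadj by (auto simp: card_insert_if)
  qed
  finally have "card B \<le> (2 * c + 1) * card A" by (simp add: mult.commute)
  then have "card ?V \<le> (4 * c + 2) * card A" using B2 by simp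
  then show ?thesis using A(1) BV by blast
qed

text \<open>Fix a maximal system of disjoint short links between vertices of \<open>S\<close>. By sparsity it
  has few links, so it leaves a large set \<open>A\<close> of pairwise unlinked vertices. By maximality
  the balls around \<open>A\<close> outside \<open>S\<close> and the links are disjoint, hence if each of them had
  many neighbours in \<open>S\<close> and the links there would be a dense shallow minor.\<close>

lemma small_separator:
  fixes G :: "nat graph"
  assumes G: "simple_graph G" and S: "S \<subseteq> verts G" "S \<noteq> {}"
    and c1: "\<And>H :: nat graph. depth_minor (2 * r) H G \<Longrightarrow> average_degree H \<le> real c"
    and c2: "\<And>H :: nat graph. depth_minor r H G \<Longrightarrow> average_degree H \<le> real c"
  shows "\<exists>v\<in>S. \<exists>W\<subseteq>verts G. card W \<le> c * (2 * r * c + 1) * (4 * c + 2) \<and> v \<notin> W \<and>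
    reach (adj G) (verts G - W) r v \<inter> S = {v}"
proof (rule ccontr)
  assume neg: "\<not> ?thesis"
  let ?V = "verts G" and ?K = "c * (2 * r * c + 1) * (4 * c + 2)"
  note sym = simple_graph_sym[OF G]
  have finV: "finite ?V" using simple_graph_finite[OF G] .
  have finS: "finite S" using finV S finite_subset by blast
  let ?P = "\<lambda>E. \<exists>Q. link_system G S (2 * r) E Q"
  have "?P {}" by (auto simp: link_system_def)
  moreover have "\<forall>E. ?P E \<longrightarrow> card E < Suc (card (S \<times> S))"
    unfolding less_Suc_eq_le using finS by (intro allI impI card_mono) (auto simp: link_system_def)
  ultimately have "\<exists>E. ?P E \<and> (\<forall>E'. ?P E' \<longrightarrow> card E' \<le> card E)"
    by (rule ex_has_greatest_nat)
  then obtain E Q where EQ: "link_system G S (2 * r) E Q"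
    and max: "\<And>E'. ?P E' \<Longrightarrow> card E' \<le> card E" by blast
  have ES: "E \<subseteq> S \<times> S" using EQ by (simp add: link_system_def)
  have finE: "finite E" using ES finS finite_subset by blast
  define H where "H = \<lparr>verts = S, adj = (\<lambda>s s'. (s, s') \<in> E \<or> (s', s) \<in> E)\<rparr>"
  have Hm: "depth_minor (2 * r) H G" unfolding H_def by (rule link_system_minor[OF G S(1) EQ])
  have Hs: "simple_graph H" using Hm by (simp add: depth_minor_def)
  have Hav: "average_degree H \<le> real c" using c1[OF Hm] .
  have vH: "verts H = S" by (simp add: H_def)
  obtain A where A: "A \<subseteq> S" "\<And>u v. u \<in> A \<Longrightarrow> v \<in> A \<Longrightarrow> \<not> adj H u v"
    "card S \<le> (4 * c + 2) * card A"
    using independent_subset[OF Hs _ Hav] S(2) unfolding vH by blast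
  have cS: "card S > 0" using finS S(2) by (simp add: card_gt_0_iff)
  have finA: "finite A" using A(1) finS finite_subset by blast
  have cA: "card A > 0" using A(3) cS by (cases "card A") auto
  have sE: "card E \<le> c * card S"
  proof -
    have "(\<Sum>u\<in>S. real (degree H u)) \<le> real c * real (card S)"
      using Hav cS by (simp add: average_degree_def divide_le_eq vH)
    then have sum: "(\<Sum>u\<in>S. degree H u) \<le> c * card S"
      by (metis (mono_tags) of_nat_le_iff of_nat_mult of_nat_sum)
    have "E = (SIGMA s:S. {s'. (s, s') \<in> E})" using ES by auto
    then have "card E = (\<Sum>s\<in>S. card {s'. (s, s') \<in> E})"
      using finS card_SigmaI[of S "\<lambda>s. {s'. (s, s') \<in> E}"] finite_subset[OF _ finS] ES
      by (metis (no_types, lifting) SigmaD2 mem_Collect_eq subsetD subsetI)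
    also have "\<dots> \<le> (\<Sum>s\<in>S. degree H s)"
      unfolding degree_def H_def
      by (intro sum_mono card_mono) (use ES finS in \<open>auto intro: finite_subset[of _ S]\<close>)
    finally show ?thesis using sum by simp
  qed
  define W0 where "W0 = (\<Union>e\<in>E. Q e)"
  have W0: "W0 \<subseteq> ?V - S" using EQ by (auto simp: link_system_def W0_def)
  have cW0: "card W0 \<le> 2 * r * (c * card S)"
  proof -
    have "card W0 \<le> (\<Sum>e\<in>E. card (Q e))" unfolding W0_def by (rule card_UN_le[OF finE])
    also have "\<dots> \<le> (\<Sum>e\<in>E. 2 * r)"
      using EQ by (intro sum_mono) (auto simp: link_system_def)
    also have "\<dots> = 2 * r * card E" by simp
    finally show ?thesis using sE by (meson le_trans mult_le_mono2)
  qed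
  \<comment> \<open>\<open>X\<close> is what is left for walks outside \<open>S\<close> and the
    links. Hence the boundary \<open>Y v\<close> of the ball \<open>T v\<close> consists of vertices
    of \<open>S\<close> and of links.\<close>
  define X where "X = ?V - S - W0"
  define T where "T v = reach (adj G) (insert v X) r v" for v
  define Y where "Y v = {y \<in> ?V. y \<notin> insert v X \<and> (\<exists>a\<in>T v. adj G a y)}" for v
  have Tsub: "T v \<subseteq> insert v X" for v using reach_subset[of "adj G" "insert v X" r v] by (auto simp: T_def)
  have disj: "T v \<inter> T w = {}" if vw: "v \<in> A" "w \<in> A" "v \<noteq> w" for v w
  proof (rule ccontr)
    assume "T v \<inter> T w \<noteq> {}"
    then obtain x where x: "x \<in> T v" "x \<in> T w" by blast
    have "x \<in> reach (adj G) (insert w (insert v X)) r v"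
      using x(1) reach_mono[of "insert v X" "insert w (insert v X)"] unfolding T_def by blast
    moreover have "x \<in> reach (adj G) (insert w (insert v X)) r w"
      using x(2) reach_mono[of "insert w X" "insert w (insert v X)"] unfolding T_def by blast
    then have "w \<in> reach (adj G) (insert w (insert v X)) r x"
      by (rule reach_sym[of "adj G", OF sym, rotated 2]) blast+
    ultimately have "w \<in> reach (adj G) (insert w (insert v X)) (r + r) v" by (rule reach_trans)
    from reach_enter[OF this] vw obtain y where
      y: "y \<in> reach (adj G) (insert v X) (2 * r) v" "adj G y w" by (auto simp: mult_2)
    obtain R where R: "R \<subseteq> insert v X" "finite R" "card R \<le> 2 * r" "y \<in> insert v R"
      "R \<subseteq> reach (adj G) R (2 * r) v"
      using reach_finite_witness[OF y(1)] by blast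
    have vwE: "(v, w) \<notin> E" using A(2)[of v w] vw by (simp add: H_def)
    have vS: "v \<in> S" "w \<in> S" using vw A(1) by auto
    have "reach (adj G) R (2 * r) v \<subseteq> reach (adj G) (insert v (R - {v})) (2 * r) v"
      by (rule reach_mono) auto
    then have "R - {v} \<subseteq> reach (adj G) (insert v (R - {v})) (2 * r) v" using R(5) by blast
    moreover have "card (R - {v}) \<le> 2 * r" using R(2,3) by (meson card_Diff1_le le_trans)
    moreover have "R - {v} \<subseteq> ?V - S" "(R - {v}) \<inter> W0 = {}" using R(1) by (auto simp: X_def)
    moreover have "\<exists>z\<in>insert v (R - {v}). adj G z w" using y(2) R(4) by auto
    ultimately have "link_system G S (2 * r) (insert (v, w) E) (Q((v, w) := R - {v}))"
      using EQ vwE vS vw(3) unfolding W0_def by (intro link_system_insert) auto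
    then have "card (insert (v, w) E) \<le> card E" using max by blast
    then show False using finE vwE by simp
  qed
  have big: "card (Y v) > ?K" if v: "v \<in> A" for v
  proof (rule ccontr)
    assume "\<not> card (Y v) > ?K"
    then have le: "card (Y v) \<le> ?K" by simp
    \<comment> \<open>A walk avoiding \<open>Y v\<close> stays in \<open>insert v X\<close> for
      \<open>r\<close> steps: what it has reached is in \<open>T v\<close>, so a step leaving
      \<open>insert v X\<close> would end in \<open>Y v\<close>. A small \<open>Y v\<close> would
      thus be the separator that \<open>neg\<close> excludes.\<close>
    have "reach (adj G) (?V - Y v) n v \<subseteq> reach (adj G) (insert v X) n v" if "n \<le> r" for n
      using that
    proof (induction n)
      case (Suc n)
      have "b \<in> insert v X" if "b \<in> ?V - Y v" "a \<in> reach (adj G) (insert v X) n v" "adj G a b" for a b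
      proof -
        have "a \<in> T v" using that(2) Suc.prems reach_mono_length[of n r "adj G" "insert v X" v]
          unfolding T_def by auto
        then show ?thesis using that unfolding Y_def by auto
      qed
      then show ?case using Suc by auto
    qed simp
    then have "reach (adj G) (?V - Y v) r v \<inter> S \<subseteq> {v}"
      using Tsub[of v] unfolding T_def X_def by blast
    then have "reach (adj G) (?V - Y v) r v \<inter> S = {v}"
      using reach_self[of v] v A(1) by blast
    moreover have "Y v \<subseteq> ?V" "v \<notin> Y v" by (auto simp: Y_def)
    ultimately show False using neg le v A(1) by blast
  qed
  have YA: "Y v \<inter> A = {}" if v: "v \<in> A" for v
  proof (rule ccontr)
    assume "Y v \<inter> A \<noteq> {}"
    then obtain w a where w: "w \<in> A" "w \<noteq> v" "a \<in> T v" "adj G a w" by (auto simp: Y_def)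
    txt \<open>Then \<open>a\<close> witnesses a link from \<open>v\<close> to \<open>w\<close>.\<close>
    have vS: "v \<in> S" "w \<in> S" using v w A(1) by auto
    have vwE: "(v, w) \<notin> E" using A(2)[of v w] v w by (simp add: H_def)
    obtain R where R: "R \<subseteq> insert v X" "finite R" "card R \<le> r" "a \<in> insert v R"
      "R \<subseteq> reach (adj G) R r v"
      using reach_finite_witness[OF w(3)[unfolded T_def]] by blast
    have "reach (adj G) R r v \<subseteq> reach (adj G) (insert v (R - {v})) r v"
      by (rule reach_mono) auto
    also have "\<dots> \<subseteq> reach (adj G) (insert v (R - {v})) (2 * r) v"
      by (rule reach_mono_length) simp
    finally have "R - {v} \<subseteq> reach (adj G) (insert v (R - {v})) (2 * r) v" using R(5) by blast
    moreover have "card (R - {v}) \<le> 2 * r" using card_Diff1_le[of R v] R(3) by linarith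
    moreover have "R - {v} \<subseteq> ?V - S" "(R - {v}) \<inter> W0 = {}" using R(1) by (auto simp: X_def)
    moreover have "\<exists>z\<in>insert v (R - {v}). adj G z w" using w(4) R(4) by auto
    ultimately have "link_system G S (2 * r) (insert (v, w) E) (Q((v, w) := R - {v}))"
      using EQ vwE vS w(2) unfolding W0_def by (intro link_system_insert) auto
    then have "card (insert (v, w) E) \<le> card E" using max by blast
    then show False using finE vwE by simp
  qed
  have YW: "Y v \<subseteq> (W0 \<union> S) - A" if "v \<in> A" for v
    using YA[OF that] by (auto simp: Y_def X_def)
  \<comment> \<open>Contract each ball \<open>T v\<close> to \<open>v\<close> and keep the other
    vertices of \<open>W0 \<union> S\<close> as they are. The balls have radius at most
    \<open>r\<close>, so \<open>c2\<close> makes this minor sparse, although each \<open>v\<close>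
    in \<open>A\<close> is adjacent to all of \<open>Y v\<close>.\<close>
  define B where "B = \<lparr>verts = W0 \<union> S, adj = (\<lambda>u v. u \<in> A \<and> v \<in> Y u \<or> v \<in> A \<and> u \<in> Y v)\<rparr>"
  have finW: "finite (W0 \<union> S)" using W0 finS finV finite_subset[of W0 ?V] by blast
  have Bs: "simple_graph B"
    by (rule simple_graphI) (use finW YW A(1) in \<open>auto simp: B_def\<close>)
  have Bm: "depth_minor r B G"
  proof (rule depth_minorI[where c = id and B = "\<lambda>u. if u \<in> A then T u else {u}"])
    fix u assume u: "u \<in> verts B"
    have "T u \<subseteq> reach (adj G) (T u) n u" if "n = r" for n
    proof -
      have "reach (adj G) (insert u X) k u \<subseteq> reach (adj G) (T u) k u" if "k \<le> r" for k
        using that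
      proof (induction k)
        case (Suc k)
        have "reach (adj G) (insert u X) (Suc k) u \<subseteq> T u"
          unfolding T_def by (rule reach_mono_length[OF Suc.prems])
        then show ?case using Suc by auto
      qed simp
      then show ?thesis using that unfolding T_def by blast
    qed
    then show "(if u \<in> A then T u else {u}) \<subseteq> ?V \<and> id u \<in> (if u \<in> A then T u else {u}) \<and>
      (if u \<in> A then T u else {u}) \<subseteq> reach (adj G) (if u \<in> A then T u else {u}) r (id u)"
      using u Tsub[of u] A(1) S(1) W0 reach_self[of u] unfolding B_def X_def T_def by auto
  next
    fix u v assume "u \<in> verts B" "v \<in> verts B" "u \<noteq> v"
    then show "(if u \<in> A then T u else {u}) \<inter> (if v \<in> A then T v else {v}) = {}"
      using disj[of u v] Tsub[of u] Tsub[of v] unfolding B_def X_def by auto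
  next
    fix u v assume "adj B u v"
    then have "u \<in> A \<and> v \<in> Y u \<or> v \<in> A \<and> u \<in> Y v" by (simp add: B_def)
    then show "\<exists>a\<in>if u \<in> A then T u else {u}. \<exists>b\<in>if v \<in> A then T v else {v}. adj G a b"
    proof
      assume uv: "u \<in> A \<and> v \<in> Y u"
      then have "v \<notin> A" using YA by blast
      then show ?thesis using uv by (auto simp: Y_def)
    next
      assume vu: "v \<in> A \<and> u \<in> Y v"
      then have "u \<notin> A" "\<exists>b\<in>T v. adj G b u" using YA by (auto simp: Y_def)
      then show ?thesis using vu sym by force
    qed
  qed (use G Bs in auto)
  \<comment> \<open>The degree sum over \<open>A\<close> exceeds \<open>?K * card A\<close>, but it
    is at most \<open>c * card (W0 \<union> S)\<close>. Here
    \<open>card W0 \<le> 2 * r * (c * card S)\<close> and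
    \<open>card S \<le> (4 * c + 2) * card A\<close>; the product of these factors is
    \<open>?K\<close>.\<close>
  have "(?K + 1) * card A = (\<Sum>v\<in>A. ?K + 1)" by simp
  also have "\<dots> \<le> (\<Sum>v\<in>A. degree B v)"
  proof (rule sum_mono)
    fix v assume v: "v \<in> A"
    have "card (Y v) \<le> degree B v" unfolding degree_def
    proof (rule card_mono)
      show "finite {u. adj B v u}"
        using simple_graph_in_verts[OF Bs]
        by (intro finite_subset[OF _ simple_graph_finite[OF Bs]]) auto
    qed (use v in \<open>auto simp: B_def\<close>)
    then show "?K + 1 \<le> degree B v" using big[OF v] by simp
  qed
  also have "\<dots> \<le> (\<Sum>v\<in>W0 \<union> S. degree B v)" by (rule sum_mono2) (use finW A(1) in auto)
  also have "\<dots> \<le> c * card (W0 \<union> S)"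
  proof -
    have "card (W0 \<union> S) > 0" using finW S(2) by (simp add: card_gt_0_iff)
    then have "(\<Sum>u\<in>W0 \<union> S. real (degree B u)) \<le> real c * real (card (W0 \<union> S))"
      using c2[OF Bm] by (simp add: average_degree_def divide_le_eq B_def)
    then show ?thesis by (metis (mono_tags) of_nat_le_iff of_nat_mult of_nat_sum)
  qed
  also have "\<dots> \<le> c * ((2 * r * c + 1) * card S)"
  proof (rule mult_le_mono2)
    have "card (W0 \<union> S) \<le> card W0 + card S" by (rule card_Un_le)
    then show "card (W0 \<union> S) \<le> (2 * r * c + 1) * card S" using cW0 by (simp add: algebra_simps)
  qed
  also have "\<dots> \<le> c * ((2 * r * c + 1) * ((4 * c + 2) * card A))"
    by (intro mult_le_mono2 A(3))
  also have "\<dots> = ?K * card A" by (simp only: mult.assoc)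
  finally show False using cA by simp
qed

text \<open>The separated vertex gets the highest rank and is removed from \<open>S\<close> only,
  not from the graph. Walks keep running through all of \<open>V\<close>, while separation is
  demanded just from vertices of lower rank.\<close>

lemma separator_ranking:
  assumes "finite S" "S \<subseteq> V"
    and "\<And>S. S \<subseteq> V \<Longrightarrow> S \<noteq> {} \<Longrightarrow>
      \<exists>v\<in>S. \<exists>W\<subseteq>V. card W \<le> K \<and> v \<notin> W \<and> reach E (V - W) r v \<inter> S = {v}"
  shows "\<exists>\<rho> :: 'a \<Rightarrow> nat. inj_on \<rho> S \<and> \<rho> ` S \<subseteq> {..<card S} \<and>
    (\<forall>v\<in>S. \<exists>W\<subseteq>V. card W \<le> K \<and> v \<notin> W \<and>
      reach E (V - W) r v \<inter> {u\<in>S. \<rho> u \<le> \<rho> v} = {v})"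
  using assms(1,2)
proof (induction "card S" arbitrary: S)
  case 0
  then show ?case by simp
next
  case (Suc n)
  then have "S \<noteq> {}" by auto
  then obtain v W where v: "v \<in> S" "W \<subseteq> V" "card W \<le> K" "v \<notin> W"
    "reach E (V - W) r v \<inter> S = {v}"
    using assms(3)[OF \<open>S \<subseteq> V\<close>] by blast
  have n: "n = card (S - {v})" using Suc.hyps(2) v(1) Suc.prems(1) by simp
  obtain \<rho> :: "'a \<Rightarrow> nat" where \<rho>: "inj_on \<rho> (S - {v})" "\<rho> ` (S - {v}) \<subseteq> {..<n}"
    "\<forall>u\<in>S - {v}. \<exists>W\<subseteq>V. card W \<le> K \<and> u \<notin> W \<and>
      reach E (V - W) r u \<inter> {w\<in>S - {v}. \<rho> w \<le> \<rho> u} = {u}"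
    using Suc.hyps(1)[OF n] Suc.prems unfolding n[symmetric] by blast
  define \<rho>' where "\<rho>' = \<rho>(v := n)"
  have lt: "\<rho>' u < n" if "u \<in> S - {v}" for u using \<rho>(2) that by (auto simp: \<rho>'_def)
  have "inj_on \<rho>' S"
  proof (rule inj_onI)
    fix x y assume "x \<in> S" "y \<in> S" "\<rho>' x = \<rho>' y"
    then show "x = y" using \<rho>(1,2) by (force simp: \<rho>'_def inj_on_def split: if_splits)
  qed
  moreover have "\<rho>' ` S \<subseteq> {..<card S}"
    using \<rho>(2) Suc.hyps(2) by (force simp: \<rho>'_def)
  moreover have "\<exists>W\<subseteq>V. card W \<le> K \<and> u \<notin> W \<and>
      reach E (V - W) r u \<inter> {w\<in>S. \<rho>' w \<le> \<rho>' u} = {u}" if u: "u \<in> S" for u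
  proof (cases "u = v")
    case True
    have "{w\<in>S. \<rho>' w \<le> \<rho>' v} = S" using lt by (force simp: \<rho>'_def)
    then show ?thesis using v True by metis
  next
    case False
    have "{w\<in>S. \<rho>' w \<le> \<rho>' u} = {w\<in>S - {v}. \<rho> w \<le> \<rho> u}"
      using lt[of u] u False by (auto simp: \<rho>'_def)
    then show ?thesis using \<rho>(3) u False by auto
  qed
  ultimately show ?case by blast
qed

text \<open>If a walk meets \<open>W\<close> after its start, the rest of it from there is shorter
  by at least one step. The conjunct \<open>n > 0\<close> gives \<open>n - 1\<close> its intended
  meaning.\<close>

lemma reach_split:
  assumes "u \<in> reach E X n x"
  shows "u \<in> reach E (X - W) n x \<or> (\<exists>w\<in>W \<inter> X. n > 0 \<and> u \<in> reach E X (n - 1) w)"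
  using assms
proof (induction n arbitrary: u)
  case (Suc n)
  show ?case
  proof (cases "u \<in> reach E X n x")
    case True
    from Suc.IH[OF this] show ?thesis
    proof
      assume "\<exists>w\<in>W \<inter> X. n > 0 \<and> u \<in> reach E X (n - 1) w"
      then show ?thesis
        using reach_mono_length[of "n - 1" n E X] by auto
    qed auto
  next
    case False
    then obtain a where a: "a \<in> reach E X n x" "E a u" "u \<in> X" using Suc.prems by auto
    from Suc.IH[OF a(1)] show ?thesis
    proof
      assume *: "a \<in> reach E (X - W) n x"
      show ?thesis
      proof (cases "u \<in> W")
        case True
        then show ?thesis using a(3) reach_self[of u E X n] by auto
      qed (use * a in auto)
    next
      assume "\<exists>w\<in>W \<inter> X. n > 0 \<and> a \<in> reach E X (n - 1) w"
      then obtain w where w: "w \<in> W \<inter> X" "n > 0" "a \<in> reach E X (n - 1) w" by blast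
      then obtain k where "n = Suc k" by (cases n) auto
      then have "u \<in> reach E X n w" using w(3) a(2,3) by auto
      then show ?thesis using w(1) by auto
    qed
  qed
qed simp

text \<open>These are the weakly \<open>j\<close>-reachable vertices known from generalised coloring
  numbers: \<open>u\<close> is a least vertex of some walk of length at most \<open>j\<close> from
  \<open>x\<close> to \<open>u\<close>. For \<open>x\<close> in \<open>V\<close> the vertex
  \<open>x\<close> is one of them.\<close>

definition weak_reach :: "('a \<Rightarrow> 'a \<Rightarrow> bool) \<Rightarrow> 'a set \<Rightarrow> ('a \<Rightarrow> nat) \<Rightarrow> nat \<Rightarrow> 'a \<Rightarrow> 'a set" where
  "weak_reach E V \<rho> j x = {u\<in>V. \<rho> u \<le> \<rho> x \<and> u \<in> reach E {w\<in>V. \<rho> u \<le> \<rho> w} j x}"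

text \<open>A walk from \<open>x\<close> to a smaller vertex has to meet the separator of \<open>x\<close>.\<close>

lemma card_weak_reach:
  assumes V: "finite V"
    and sep: "\<And>v. v \<in> V \<Longrightarrow> \<exists>W\<subseteq>V. card W \<le> K \<and> v \<notin> W \<and>
      reach E (V - W) r v \<inter> {u\<in>V. \<rho> u \<le> \<rho> v} = {v}"
    and "j \<le> r" "x \<in> V"
  shows "card (weak_reach E V \<rho> j x) \<le> Suc K ^ j"
  using assms(3,4)
proof (induction j arbitrary: x)
  case 0
  have "weak_reach E V \<rho> 0 x \<subseteq> {x}" by (auto simp: weak_reach_def)
  then have "card (weak_reach E V \<rho> 0 x) \<le> card {x}" by (intro card_mono) auto
  then show ?case by simp
next
  case (Suc j)
  obtain W where W: "W \<subseteq> V" "card W \<le> K" "x \<notin> W"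
    "reach E (V - W) r x \<inter> {u\<in>V. \<rho> u \<le> \<rho> x} = {x}"
    using sep[OF Suc.prems(2)] by blast
  have finW: "finite W" using W(1) V finite_subset by blast
  \<comment> \<open>A vertex \<open>w\<close> of the separator on the walk satisfies
    \<open>\<rho> u \<le> \<rho> w\<close>, so \<open>u\<close> is weakly reachable from
    \<open>w\<close> with one step less. The sizes thus obey b(j + 1) \<le> 1 + K * b(j), which
    \<open>Suc K ^ j\<close> satisfies.\<close>
  have "weak_reach E V \<rho> (Suc j) x \<subseteq> insert x (\<Union>w\<in>W. weak_reach E V \<rho> j w)"
  proof
    fix u assume u: "u \<in> weak_reach E V \<rho> (Suc j) x"
    let ?X = "{w\<in>V. \<rho> u \<le> \<rho> w}"
    have u': "u \<in> V" "\<rho> u \<le> \<rho> x" "u \<in> reach E ?X (Suc j) x"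
      using u unfolding weak_reach_def by blast+
    from reach_split[OF u'(3), of W] show "u \<in> insert x (\<Union>w\<in>W. weak_reach E V \<rho> j w)"
    proof
      assume "u \<in> reach E (?X - W) (Suc j) x"
      also have "reach E (?X - W) (Suc j) x \<subseteq> reach E (V - W) (Suc j) x"
        by (rule reach_mono) auto
      also have "\<dots> \<subseteq> reach E (V - W) r x" by (rule reach_mono_length[OF Suc.prems(1)])
      finally have "u = x" using W(4) u' by blast
      then show ?thesis by simp
    next
      assume "\<exists>w\<in>W \<inter> ?X. Suc j > 0 \<and> u \<in> reach E ?X (Suc j - 1) w"
      then show ?thesis using u'(1) by (auto simp: weak_reach_def)
    qed
  qed
  moreover have finwr: "finite (weak_reach E V \<rho> j w)" for w using V by (simp add: weak_reach_def)
  ultimately have "card (weak_reach E V \<rho> (Suc j) x)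
      \<le> card (insert x (\<Union>w\<in>W. weak_reach E V \<rho> j w))"
    using finW by (intro card_mono) auto
  also have "\<dots> \<le> Suc (card (\<Union>w\<in>W. weak_reach E V \<rho> j w))" by (rule card_insert_le_m1) auto
  also have "card (\<Union>w\<in>W. weak_reach E V \<rho> j w) \<le> (\<Sum>w\<in>W. card (weak_reach E V \<rho> j w))"
    by (rule card_UN_le[OF finW])
  also have "\<dots> \<le> (\<Sum>w\<in>W. Suc K ^ j)"
    using Suc W(1) by (intro sum_mono) auto
  also have "Suc \<dots> \<le> Suc K ^ Suc j"
  proof -
    have "card W * Suc K ^ j \<le> K * Suc K ^ j" by (rule mult_le_mono1[OF W(2)])
    moreover have "Suc K ^ Suc j = Suc K ^ j + K * Suc K ^ j" by simp
    moreover have "1 \<le> Suc K ^ j" by simp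
    ultimately have "Suc (card W * Suc K ^ j) \<le> Suc K ^ Suc j" by linarith
    then show ?thesis by (simp del: power_Suc)
  qed
  finally show ?case by simp
qed

section \<open>Colorings in which long paths have many colors\<close>

lemma greedy_coloring:
  fixes \<rho> :: "'a \<Rightarrow> nat"
  assumes "finite V" "inj_on \<rho> V"
    and N: "\<And>x. x \<in> V \<Longrightarrow> N x \<subseteq> {u\<in>V. \<rho> u < \<rho> x}" "\<And>x. x \<in> V \<Longrightarrow> card (N x) < m"
  shows "\<exists>\<chi> :: 'a \<Rightarrow> nat. (\<forall>x\<in>V. \<chi> x < m \<and> (\<forall>u\<in>N x. \<chi> u \<noteq> \<chi> x))"
proof -
  have "\<exists>\<chi> :: 'a \<Rightarrow> nat. (\<forall>x\<in>V. \<rho> x < k \<longrightarrow> \<chi> x < m \<and> (\<forall>u\<in>N x. \<chi> u \<noteq> \<chi> x))" for k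
  proof (induction k)
    case (Suc k)
    then obtain \<chi> :: "'a \<Rightarrow> nat" where
      \<chi>: "\<And>x. x \<in> V \<Longrightarrow> \<rho> x < k \<Longrightarrow> \<chi> x < m \<and> (\<forall>u\<in>N x. \<chi> u \<noteq> \<chi> x)" by blast
    show ?case
    proof (cases "\<exists>x\<in>V. \<rho> x = k")
      case False
      then show ?thesis using \<chi> by (intro exI[of _ \<chi>]) (metis less_Suc_eq)
    next
      case True
      then obtain x where x: "x \<in> V" "\<rho> x = k" by blast
      have finN: "finite (N x)" using N(1)[OF x(1)] assms(1) by (auto intro: finite_subset)
      have "card (\<chi> ` N x) < card {..<m}" using N(2)[OF x(1)] card_image_le[OF finN, of \<chi>] by simp
      then obtain c where c: "c < m" "c \<notin> \<chi> ` N x"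
        by (metis card_mono finN finite_imageI lessThan_iff linorder_not_less subsetI)
      have eq: "y = x" if "y \<in> V" "\<rho> y = k" for y using assms(2) x that by (auto simp: inj_on_def)
      show ?thesis
      proof (intro exI[of _ "\<chi>(x := c)"] ballI impI)
        fix y assume y: "y \<in> V" "\<rho> y < Suc k"
        show "(\<chi>(x := c)) y < m \<and> (\<forall>u\<in>N y. (\<chi>(x := c)) u \<noteq> (\<chi>(x := c)) y)"
        proof (cases "y = x")
          case True
          then show ?thesis using c N(1)[OF x(1)] by auto
        next
          case False
          then have "\<rho> y < k" using eq y less_Suc_eq by metis
          moreover have "x \<notin> N y" using N(1)[OF y(1)] x(2) \<open>\<rho> y < k\<close> by auto
          ultimately show ?thesis using \<chi>[OF y(1)] False by auto
        qed
      qed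
    qed
  qed simp
  from this[of "Suc (Max (\<rho> ` V))"] show ?thesis using assms(1) by (simp add: less_Suc_eq_le)
qed

lemma path_reach:
  assumes "successively E (a # vs)" "b \<in> set (a # vs)"
  shows "b \<in> reach E (set (a # vs)) (length vs) a"
  using assms
proof (induction vs arbitrary: a)
  case (Cons c vs)
  show ?case
  proof (cases "b = a")
    case False
    have "c \<in> reach E (set (a # c # vs)) 1 a" using Cons.prems(1) by auto
    moreover have "b \<in> reach E (set (a # c # vs)) (length vs) c"
      using Cons.IH[of c] Cons.prems False reach_mono[of "set (c # vs)" "set (a # c # vs)"] by auto
    ultimately have "b \<in> reach E (set (a # c # vs)) (1 + length vs) a" by (rule reach_trans)
    then show ?thesis by simp
  qed (use reach_self in fast)
qed simp

text \<open>The connection runs through the first vertex of the path, whence the factor 2.\<close>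

lemma path_reach_between:
  assumes sym: "\<And>a b. E a b \<Longrightarrow> E b a" and vs: "successively E vs" "set vs \<subseteq> X"
    and "x \<in> set vs" "y \<in> set vs"
  shows "y \<in> reach E X (2 * length vs) x"
proof -
  obtain a ws where a: "vs = a # ws" using assms(4) by (cases vs) auto
  have r: "b \<in> reach E X (length vs) a" if "b \<in> set vs" for b
  proof -
    have "b \<in> reach E (set vs) (length ws) a" using path_reach[of E a ws b] vs that a by simp
    also have "\<dots> \<subseteq> reach E X (length ws) a" by (rule reach_mono[OF vs(2)])
    also have "\<dots> \<subseteq> reach E X (length vs) a" by (rule reach_mono_length) (simp add: a)
    finally show ?thesis .
  qed
  have "a \<in> reach E X (length vs) x"
    by (rule reach_sym[of E, OF sym _ r[OF assms(4)]]) (use vs a in auto)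
  from reach_trans[OF this r[OF assms(5)]] show ?thesis by (simp add: mult_2)
qed

text \<open>The least vertex of a path is weakly reachable from all its vertices, so its color is unique
  on the path. Recurse into the longer side.\<close>

lemma path_many_colors:
  assumes sym: "\<And>a b. E a b \<Longrightarrow> E b a"
    and \<chi>: "\<And>x u. x \<in> V \<Longrightarrow> u \<in> weak_reach E V \<rho> R x \<Longrightarrow> u \<noteq> x \<Longrightarrow> \<chi> u \<noteq> \<chi> x"
    and "successively E vs" "distinct vs" "set vs \<subseteq> V" "2 ^ p \<le> length vs" "2 * length vs \<le> R"
  shows "p < card (\<chi> ` set vs)"
  using assms(3-)
proof (induction p arbitrary: vs)
  case 0
  then have "vs \<noteq> []" by auto
  then show ?case by (simp add: card_gt_0_iff)
next
  case (Suc p)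
  have ne: "set vs \<noteq> {}" using Suc.prems(4) by auto
  then obtain m where m: "m \<in> set vs" "\<And>x. x \<in> set vs \<Longrightarrow> \<rho> m \<le> \<rho> x"
    using arg_min_least[of "set vs" _ \<rho>] arg_min_if_finite(1)[of "set vs" \<rho>] by auto
  obtain as bs where vs: "vs = as @ m # bs" using m(1) by (meson split_list)
  have uniq: "\<chi> m \<noteq> \<chi> x" if x: "x \<in> set vs" "x \<noteq> m" for x
  proof -
    have "m \<in> reach E {w\<in>V. \<rho> m \<le> \<rho> w} (2 * length vs) x"
      by (rule path_reach_between[of E, OF sym Suc.prems(1)]) (use m x Suc.prems(3) in auto)
    then have "m \<in> reach E {w\<in>V. \<rho> m \<le> \<rho> w} R x"
      by (rule subsetD[OF reach_mono_length[OF Suc.prems(5)]])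
    then have "m \<in> weak_reach E V \<rho> R x"
      using m x Suc.prems(3) unfolding weak_reach_def by blast
    then show ?thesis using \<chi>[of x m] x Suc.prems(3) by blast
  qed
  have "\<exists>ws. successively E ws \<and> distinct ws \<and> set ws \<subseteq> set vs - {m} \<and> 2 ^ p \<le> length ws \<and>
     length ws \<le> length vs"
  proof (cases "2 ^ p \<le> length as")
    case True
    then show ?thesis using Suc.prems(1,2) vs
      by (intro exI[of _ as]) (auto simp: successively_append_iff)
  next
    case False
    have "2 * 2 ^ p \<le> length as + length bs + 1" using Suc.prems(4) vs by simp
    then have "2 ^ p \<le> length bs" using False by linarith
    moreover have "successively E bs"
      using Suc.prems(1) vs by (cases bs) (auto simp: successively_append_iff)
    ultimately show ?thesis using Suc.prems(2) vs by (intro exI[of _ bs]) auto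
  qed
  then obtain ws where ws: "successively E ws" "distinct ws" "set ws \<subseteq> set vs - {m}"
    "2 ^ p \<le> length ws" "length ws \<le> length vs" by blast
  have "p < card (\<chi> ` set ws)" using Suc.IH[of ws] ws Suc.prems(3,5) by force
  moreover have "insert (\<chi> m) (\<chi> ` set ws) \<subseteq> \<chi> ` set vs" using ws(3) m(1) by auto
  then have "card (insert (\<chi> m) (\<chi> ` set ws)) \<le> card (\<chi> ` set vs)" by (intro card_mono) auto
  moreover have "\<chi> m \<notin> \<chi> ` set ws" using uniq ws(3) by fastforce
  ultimately show ?case by simp
qed

text \<open>A low tree-depth coloring, phrased by path lengths because these directly bound the
  height of a depth-first search tree in the union of at most \<open>p\<close> classes.\<close>

definition path_coloring :: "'a graph \<Rightarrow> nat \<Rightarrow> nat \<Rightarrow> ('a \<Rightarrow> nat) \<Rightarrow> bool" where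
  "path_coloring G p N \<chi> \<longleftrightarrow> (\<forall>v\<in>verts G. \<chi> v < N) \<and>
     (\<forall>vs. distinct vs \<longrightarrow> successively (adj G) vs \<longrightarrow> set vs \<subseteq> verts G \<longrightarrow>
        card (\<chi> ` set vs) \<le> p \<longrightarrow> length vs < 2 ^ p)"

lemma bounded_expansion_path_coloring:
  fixes \<C> :: "nat graph set"
  assumes C: "graph_class \<C>" "bounded_expansion \<C>"
  shows "\<exists>N. \<forall>G\<in>\<C>. \<exists>\<chi>. path_coloring G p N \<chi>"
proof -
  \<comment> \<open>Only paths with exactly \<open>2 ^ p\<close> vertices are examined, and
    \<open>path_many_colors\<close> needs weak reachability up to twice that number.\<close>
  define R :: nat where "R = 2 * 2 ^ p"
  obtain a where a: "\<And>G H. G \<in> \<C> \<Longrightarrow> depth_minor (2 * R) (H :: nat graph) G \<Longrightarrow> average_degree H \<le> a"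
    using C(2) unfolding bounded_expansion_def by meson
  obtain b where b: "\<And>G H. G \<in> \<C> \<Longrightarrow> depth_minor R (H :: nat graph) G \<Longrightarrow> average_degree H \<le> b"
    using C(2) unfolding bounded_expansion_def by meson
  obtain c :: nat where c: "max a b \<le> real c" using real_arch_simple by blast
  define K where "K = c * (2 * R * c + 1) * (4 * c + 2)"
  show ?thesis
  proof (intro exI[of _ "Suc (Suc K ^ R)"] ballI)
    fix G assume G: "G \<in> \<C>"
    let ?V = "verts G"
    have sG: "simple_graph G" using C(1) G by (auto simp: graph_class_def)
    note finV = simple_graph_finite[OF sG]
    have sep: "\<exists>v\<in>S. \<exists>W\<subseteq>?V. card W \<le> K \<and> v \<notin> W \<and> reach (adj G) (?V - W) R v \<inter> S = {v}"
      if "S \<subseteq> ?V" "S \<noteq> {}" for S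
      unfolding K_def
    proof (rule small_separator[OF sG that])
      fix H :: "nat graph"
      show "average_degree H \<le> real c" if "depth_minor (2 * R) H G" using a[OF G that] c by simp
      show "average_degree H \<le> real c" if "depth_minor R H G" using b[OF G that] c by simp
    qed
    obtain \<rho> :: "nat \<Rightarrow> nat" where "inj_on \<rho> ?V \<and> \<rho> ` ?V \<subseteq> {..<card ?V} \<and>
        (\<forall>v\<in>?V. \<exists>W\<subseteq>?V. card W \<le> K \<and> v \<notin> W \<and>
          reach (adj G) (?V - W) R v \<inter> {u\<in>?V. \<rho> u \<le> \<rho> v} = {v})"
      by (rule exE[OF separator_ranking[of ?V ?V K "adj G" R, OF finV subset_refl sep]])
    then have \<rho>: "inj_on \<rho> ?V"
      "\<And>v. v \<in> ?V \<Longrightarrow> \<exists>W\<subseteq>?V. card W \<le> K \<and> v \<notin> W \<and>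
        reach (adj G) (?V - W) R v \<inter> {u\<in>?V. \<rho> u \<le> \<rho> v} = {v}"
      by simp_all
    let ?N = "\<lambda>x. weak_reach (adj G) ?V \<rho> R x - {x}"
    have "\<exists>\<chi> :: nat \<Rightarrow> nat. \<forall>x\<in>?V. \<chi> x < Suc (Suc K ^ R) \<and> (\<forall>u\<in>?N x. \<chi> u \<noteq> \<chi> x)"
    proof (rule greedy_coloring[OF finV \<rho>(1)])
      fix x assume x: "x \<in> ?V"
      show "?N x \<subseteq> {u \<in> ?V. \<rho> u < \<rho> x}"
        using \<rho>(1) x by (force simp: weak_reach_def inj_on_def order_less_le)
      have "card (?N x) \<le> card (weak_reach (adj G) ?V \<rho> R x)" by (rule card_Diff1_le)
      also have "\<dots> \<le> Suc K ^ R" by (rule card_weak_reach[OF finV \<rho>(2) _ x]) auto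
      finally show "card (?N x) < Suc (Suc K ^ R)" by simp
    qed
    then obtain \<chi> :: "nat \<Rightarrow> nat" where \<chi>: "\<And>x. x \<in> ?V \<Longrightarrow> \<chi> x < Suc (Suc K ^ R)"
      "\<And>x u. x \<in> ?V \<Longrightarrow> u \<in> weak_reach (adj G) ?V \<rho> R x \<Longrightarrow> u \<noteq> x \<Longrightarrow> \<chi> u \<noteq> \<chi> x" by blast
    have "length vs < 2 ^ p" if vs: "distinct vs" "successively (adj G) vs" "set vs \<subseteq> ?V"
      "card (\<chi> ` set vs) \<le> p" for vs
    proof (rule ccontr)
      assume "\<not> length vs < 2 ^ p"
      \<comment> \<open>A longer path is cut to \<open>2 ^ p\<close> vertices so that the fixed
        \<open>R\<close> suffices; cutting adds no colors.\<close>
      then have len: "length (take (2 ^ p) vs) = 2 ^ p" by simp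
      have "successively (adj G) (take (2 ^ p) vs @ drop (2 ^ p) vs)" using vs(2) by simp
      then have "successively (adj G) (take (2 ^ p) vs)" by (simp only: successively_append_iff)
      moreover have "distinct (take (2 ^ p) vs)" "set (take (2 ^ p) vs) \<subseteq> ?V"
        using vs(1,3) set_take_subset[of "2 ^ p" vs] by auto
      ultimately have "p < card (\<chi> ` set (take (2 ^ p) vs))"
        using len by (intro path_many_colors[of "adj G", OF simple_graph_sym[OF sG] \<chi>(2)]) (auto simp: R_def)
      also have "\<dots> \<le> card (\<chi> ` set vs)"
        by (intro card_mono image_mono set_take_subset) auto
      finally show False using vs(4) by simp
    qed
    then show "\<exists>\<chi>. path_coloring G p (Suc (Suc K ^ R)) \<chi>"
      using \<chi>(1) unfolding path_coloring_def by blast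
  qed
qed

section \<open>Elimination forests\<close>

text \<open>Roots are the fixed points of \<open>\<pi>\<close>, so \<open>\<pi> ^^ L\<close> leads
  to the root from every depth up to \<open>L\<close>. The condition \<open>E v (\<pi> v)\<close> is
  what makes parent functions guarded.\<close>

definition elimination_forest :: "('a \<Rightarrow> 'a \<Rightarrow> bool) \<Rightarrow> 'a set \<Rightarrow> nat \<Rightarrow> ('a \<Rightarrow> 'a) \<Rightarrow> bool" where
  "elimination_forest E U L \<pi> \<longleftrightarrow> (\<forall>v\<in>U. \<pi> v \<in> U) \<and> (\<forall>v\<in>U. \<pi> v \<noteq> v \<longrightarrow> E v (\<pi> v)) \<and>
     (\<forall>v\<in>U. \<pi> ((\<pi> ^^ L) v) = (\<pi> ^^ L) v) \<and>
     (\<forall>u\<in>U. \<forall>v\<in>U. E u v \<longrightarrow> (\<exists>n. (\<pi> ^^ n) u = v) \<or> (\<exists>n. (\<pi> ^^ n) v = u))"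

definition linked_in :: "('a \<Rightarrow> 'a \<Rightarrow> bool) \<Rightarrow> 'a set \<Rightarrow> 'a \<Rightarrow> 'a \<Rightarrow> bool" where
  "linked_in E X = (\<lambda>a b. a \<in> X \<and> b \<in> X \<and> E a b)\<^sup>*\<^sup>*"

lemma linked_in_refl: "linked_in E X a a"
  by (simp add: linked_in_def)

lemma linked_in_edge: "a \<in> X \<Longrightarrow> b \<in> X \<Longrightarrow> E a b \<Longrightarrow> linked_in E X a b"
  by (simp add: linked_in_def r_into_rtranclp)

lemma linked_in_trans: "linked_in E X a b \<Longrightarrow> linked_in E X b c \<Longrightarrow> linked_in E X a c"
  unfolding linked_in_def by (rule rtranclp_trans)

lemma linked_in_sym:
  assumes "\<And>a b. E a b \<Longrightarrow> E b a" "linked_in E X a b"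
  shows "linked_in E X b a"
proof -
  have "symp (\<lambda>a b. a \<in> X \<and> b \<in> X \<and> E a b)" using assms(1) by (blast intro: sympI)
  then show ?thesis using assms(2) symp_rtranclp unfolding linked_in_def by (metis sympD)
qed

lemma linked_in_mono: "X \<subseteq> Y \<Longrightarrow> linked_in E X a b \<Longrightarrow> linked_in E Y a b"
  unfolding linked_in_def by (rule predicate2D[OF rtranclp_mono, rotated]) auto

lemma linked_in_eq:
  assumes "\<And>a b. E a b \<Longrightarrow> E b a" "linked_in E X v w"
  shows "linked_in E X v = linked_in E X w"
proof -
  have "linked_in E X w v" by (rule linked_in_sym) (use assms in auto)
  then show ?thesis using assms(2) linked_in_trans[of E X] by (intro ext) blast
qed

lemma linked_in_closed: "linked_in E X a b \<Longrightarrow> a \<in> X \<Longrightarrow> b \<in> X"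
  unfolding linked_in_def by (induction rule: rtranclp_induct) auto

text \<open>The height is left open here, as it comes from the coloring. The map \<open>rt\<close>
  is a parameter because the recursion has to hang each smaller tree by a vertex fixed in
  advance.\<close>

definition rooted_forest :: "('a \<Rightarrow> 'a \<Rightarrow> bool) \<Rightarrow> 'a set \<Rightarrow> ('a \<Rightarrow> 'a) \<Rightarrow> ('a \<Rightarrow> 'a) \<Rightarrow> bool" where
  "rooted_forest E X rt \<pi> \<longleftrightarrow> (\<forall>v\<in>X. \<pi> v \<in> X) \<and> (\<forall>v\<in>X. \<pi> v \<noteq> v \<longrightarrow> E v (\<pi> v)) \<and>
    (\<forall>v\<in>X. \<pi> (rt v) = rt v) \<and> (\<forall>v\<in>X. \<exists>n. (\<pi> ^^ n) v = rt v) \<and>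
    (\<forall>u\<in>X. \<forall>v\<in>X. E u v \<longrightarrow> (\<exists>n. (\<pi> ^^ n) u = v) \<or> (\<exists>n. (\<pi> ^^ n) v = u))"

lemma rooted_forestD:
  assumes "rooted_forest E X rt \<pi>"
  shows "\<And>v. v \<in> X \<Longrightarrow> \<pi> v \<in> X" "\<And>v. v \<in> X \<Longrightarrow> \<pi> v \<noteq> v \<Longrightarrow> E v (\<pi> v)"
    "\<And>v. v \<in> X \<Longrightarrow> \<pi> (rt v) = rt v" "\<And>v. v \<in> X \<Longrightarrow> \<exists>n. (\<pi> ^^ n) v = rt v"
    "\<And>u v. u \<in> X \<Longrightarrow> v \<in> X \<Longrightarrow> E u v \<Longrightarrow> (\<exists>n. (\<pi> ^^ n) u = v) \<or> (\<exists>n. (\<pi> ^^ n) v = u)"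
  using assms by (simp_all add: rooted_forest_def)

text \<open>Depth-first search trees, with one prescribed root for each component: remove all
  roots at once and recurse, each new component choosing a neighbour of its old root.\<close>

lemma dfs_forest:
  assumes sym: "\<And>a b. E a b \<Longrightarrow> E b a" and "finite X"
    and "\<And>v. v \<in> X \<Longrightarrow> linked_in E X v (rt v)"
    and "\<And>v w. v \<in> X \<Longrightarrow> linked_in E X v w \<Longrightarrow> rt v = rt w"
  shows "\<exists>\<pi>. rooted_forest E X rt \<pi>"
  using assms(2-)
proof (induction X arbitrary: rt rule: finite_psubset_induct)
  case (psubset X)
  note lk = psubset.prems(1) and rt = psubset.prems(2)
  show ?case
  proof (cases "X = {}")
    case False
    have rtX: "rt v \<in> X" if "v \<in> X" for v using linked_in_closed[OF lk[OF that] that] .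
    have rt_rt: "rt (rt v) = rt v" if "v \<in> X" for v using rt[OF that lk[OF that]] by simp
    define X' where "X' = X - rt ` X"
    have X': "X' \<subset> X" using False rtX unfolding X'_def by blast
    have X'X: "X' \<subseteq> X" using X' by blast
    define rt' where "rt' v = (SOME y. linked_in E X' v y \<and> E y (rt v))" for v
    \<comment> \<open>Follow a walk from \<open>v\<close> to its old root. It can leave
      \<open>X'\<close> only into \<open>rt v\<close>, the one root in this component of
      \<open>X\<close>, and the vertex before that step is the required neighbour.\<close>
    have rt': "linked_in E X' v (rt' v) \<and> E (rt' v) (rt v)" if v: "v \<in> X'" for v
    proof -
      have vX: "v \<in> X" using v X'X by blast
      have "linked_in E X' v z \<or> (\<exists>y. linked_in E X' v y \<and> E y (rt v))"
        if "linked_in E X v z" for z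
        using that[unfolded linked_in_def]
      proof (induction rule: rtranclp_induct)
        case base
        then show ?case by (simp add: linked_in_refl)
      next
        case (step z z')
        show ?case
        proof (cases "linked_in E X' v z")
          case True
          show ?thesis
          proof (cases "z' \<in> X'")
            case True': True
            have "z \<in> X'" using linked_in_closed[OF True v] .
            then have "linked_in E X' z z'" using True' step(2) by (intro linked_in_edge) auto
            then show ?thesis using linked_in_trans[OF True] by blast
          next
            case False
            then obtain w where w: "w \<in> X" "z' = rt w" using step(2) by (auto simp: X'_def)
            have "linked_in E X v z'"
              using step(1,2) unfolding linked_in_def by (rule rtranclp.rtrancl_into_rtrancl)
            then have "rt v = rt z'" by (rule rt[OF vX])
            also have "\<dots> = z'" using rt_rt[OF w(1)] w(2) by simp
            finally show ?thesis using True step(2) by blast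
          qed
        qed (use step.IH in blast)
      qed
      from this[OF lk[OF vX]] have "\<exists>y. linked_in E X' v y \<and> E y (rt v)"
        using linked_in_closed[of E X' v "rt v"] v vX by (auto simp: X'_def)
      then show ?thesis unfolding rt'_def by (rule someI_ex)
    qed
    have rt'c: "rt' v = rt' w" if v: "v \<in> X'" and vw: "linked_in E X' v w" for v w
    proof -
      have "linked_in E X' v = linked_in E X' w" by (rule linked_in_eq[OF sym vw])
      moreover have "rt v = rt w" using rt[of v w] v X'X linked_in_mono[OF X'X vw] by blast
      ultimately show ?thesis by (simp add: rt'_def)
    qed
    have rt'X: "rt' v \<in> X'" if "v \<in> X'" for v
      using linked_in_closed[of E X' v "rt' v"] rt'[OF that] that by blast
    obtain \<pi>' where "rooted_forest E X' rt' \<pi>'"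
      using psubset.IH[OF X' conjunct1[OF rt'] rt'c] by blast
    note \<pi>' = rooted_forestD[OF this]
    \<comment> \<open>The trees of \<open>\<pi>'\<close> are hung below the old roots by their own
      roots, so trajectories of \<open>\<pi>'\<close> are initial parts of those of
      \<open>\<pi>\<close>.\<close>
    define \<pi> where "\<pi> v = (if v \<in> rt ` X then v else if v = rt' v then rt v else \<pi>' v)" for v
    have traj: "(\<pi>' ^^ n) v \<in> X' \<and> (\<exists>m. (\<pi> ^^ m) v = (\<pi>' ^^ n) v)" if v: "v \<in> X'" for v n
    proof (induction n)
      case 0
      then show ?case using v by (auto intro: exI[of _ 0])
    next
      case (Suc n)
      let ?u = "(\<pi>' ^^ n) v"
      obtain m where m: "(\<pi> ^^ m) v = ?u" using Suc by blast
      have u: "?u \<in> X'" using Suc by blast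
      show ?case
      proof (cases "?u = rt' ?u")
        case True
        then have "\<pi>' ?u = ?u" using \<pi>'(3)[OF u] by metis
        then show ?thesis using m u by auto
      next
        case False
        then have "\<pi> ?u = \<pi>' ?u" using u by (simp add: \<pi>_def X'_def)
        then have "(\<pi> ^^ Suc m) v = (\<pi>' ^^ Suc n) v" using m by simp
        then show ?thesis using \<pi>'(1)[OF u] by (auto simp del: funpow.simps simp: funpow.simps(2)[of n \<pi>'])
      qed
    qed
    have to_rt: "\<exists>n. (\<pi> ^^ n) v = rt v" if v: "v \<in> X" for v
    proof (cases "v \<in> rt ` X")
      case True
      then have "rt v = v" using rt_rt by auto
      then show ?thesis by (intro exI[of _ 0]) simp
    next
      case False
      then have v': "v \<in> X'" using v by (simp add: X'_def)
      obtain n where "(\<pi>' ^^ n) v = rt' v" using \<pi>'(4)[OF v'] by blast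
      then obtain m where m: "(\<pi> ^^ m) v = rt' v" using traj[OF v', of n] by metis
      have "rt' (rt' v) = rt' v" using rt'c[OF v'] rt'[OF v'] by metis
      moreover have "rt' v \<notin> rt ` X" using rt'X[OF v'] by (simp add: X'_def)
      ultimately have "\<pi> (rt' v) = rt (rt' v)" by (simp add: \<pi>_def)
      also have "\<dots> = rt v"
        using rt[OF v linked_in_mono[OF X'X]] rt'[OF v'] by metis
      finally have "(\<pi> ^^ Suc m) v = rt v" using m by simp
      then show ?thesis by blast
    qed
    show ?thesis
      unfolding rooted_forest_def
    proof (intro exI[of _ \<pi>] conjI ballI impI)
      fix v assume v: "v \<in> X"
      show "\<pi> v \<in> X" using v rtX \<pi>'(1)[of v] X'X unfolding \<pi>_def X'_def by auto
      show "E v (\<pi> v)" if ne: "\<pi> v \<noteq> v"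
      proof -
        have vr: "v \<notin> rt ` X" using ne by (auto simp: \<pi>_def)
        then have v': "v \<in> X'" using v by (simp add: X'_def)
        show ?thesis
        proof (cases "v = rt' v")
          case True
          then have "E v (rt v)" using rt'[OF v'] by metis
          then show ?thesis using True vr by (simp add: \<pi>_def)
        next
          case False
          then show ?thesis using ne \<pi>'(2)[OF v'] vr by (simp add: \<pi>_def)
        qed
      qed
      show "\<pi> (rt v) = rt v" using v by (simp add: \<pi>_def)
      show "\<exists>n. (\<pi> ^^ n) v = rt v" by (rule to_rt[OF v])
      fix w assume w: "w \<in> X" and e: "E v w"
      have eq: "rt v = rt w" by (rule rt[OF v linked_in_edge[OF v w, of E, OF e]])
      consider "v \<in> rt ` X" | "w \<in> rt ` X" | "v \<in> X'" "w \<in> X'" using v w by (auto simp: X'_def)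
      then show "(\<exists>n. (\<pi> ^^ n) v = w) \<or> (\<exists>n. (\<pi> ^^ n) w = v)"
      proof cases
        case 1
        then have "rt w = v" using rt_rt eq by auto
        then show ?thesis using to_rt[OF w] by auto
      next
        case 2
        then have "rt v = w" using rt_rt eq by auto
        then show ?thesis using to_rt[OF v] by auto
      next
        case 3
        from \<pi>'(5)[OF 3 e] show ?thesis using traj[OF 3(1)] traj[OF 3(2)] by metis
      qed
    qed
  qed (simp add: rooted_forest_def)
qed

section \<open>Height of the forests\<close>

lemma funpow_fixpoint: "f x = x \<Longrightarrow> (f ^^ n) x = x"
  by (induction n) auto

lemma funpow_stable:
  assumes "f ((f ^^ m) x) = (f ^^ m) x" "m \<le> n"
  shows "(f ^^ n) x = (f ^^ m) x"
proof -
  have "(f ^^ n) x = (f ^^ ((n - m) + m)) x" using assms(2) by simp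
  also have "\<dots> = (f ^^ (n - m)) ((f ^^ m) x)" by (simp only: funpow_add comp_apply)
  also have "\<dots> = (f ^^ m) x" using assms(1) by (rule funpow_fixpoint)
  finally show ?thesis .
qed

text \<open>If two iterates agreed, the steps that lead from the later one to the fixed point could
  be taken from the earlier one and would reach it too soon.\<close>

lemma trajectory_distinct:
  assumes "\<And>k. k < n \<Longrightarrow> f ((f ^^ k) x) \<noteq> (f ^^ k) x" "f ((f ^^ n) x) = (f ^^ n) x"
  shows "distinct (map (\<lambda>i. (f ^^ i) x) [0..<Suc n])"
proof -
  have ne: "(f ^^ i) x \<noteq> (f ^^ j) x" if "i < j" "j \<le> n" for i j
  proof
    assume eq: "(f ^^ i) x = (f ^^ j) x"
    have "(f ^^ n) x = (f ^^ ((n - j) + j)) x" using that by simp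
    also have "\<dots> = (f ^^ (n - j)) ((f ^^ i) x)" by (simp only: funpow_add comp_apply eq)
    also have "\<dots> = (f ^^ ((n - j) + i)) x" by (simp only: funpow_add comp_apply)
    finally have "f ((f ^^ ((n - j) + i)) x) = (f ^^ ((n - j) + i)) x" using assms(2) by simp
    moreover have "(n - j) + i < n" using that by simp
    ultimately show False using assms(1) by blast
  qed
  have "inj_on (\<lambda>i. (f ^^ i) x) (set [0..<Suc n])"
  proof (rule inj_onI, rule ccontr)
    fix i j assume ij: "i \<in> set [0..<Suc n]" "j \<in> set [0..<Suc n]" "(f ^^ i) x = (f ^^ j) x" "i \<noteq> j"
    then show False using ne[of i j] ne[of j i] by (cases "i < j") auto
  qed
  then show ?thesis by (simp only: distinct_map distinct_upt)
qed

text \<open>As parents are neighbours, the way from a vertex to its root is a path of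
  \<open>G\<close> with colors in \<open>I\<close>, so it has fewer than \<open>2 ^ p\<close>
  vertices. Outside the chosen classes \<open>\<pi>\<close> is the identity, which keeps it guarded
  on all of \<open>G\<close>.\<close>

lemma elimination_forest_exists:
  assumes G: "simple_graph G" and \<chi>: "path_coloring G p N \<chi>" and I: "finite I" "card I \<le> p"
  shows "\<exists>\<pi>. elimination_forest (adj G) {v\<in>verts G. \<chi> v \<in> I} (2 ^ p) \<pi> \<and>
    (\<forall>v. v \<notin> {v\<in>verts G. \<chi> v \<in> I} \<longrightarrow> \<pi> v = v)"
proof -
  let ?U = "{v\<in>verts G. \<chi> v \<in> I}" and ?E = "adj G"
  define rt where "rt v = (SOME y. linked_in ?E ?U v y)" for v
  have 1: "linked_in ?E ?U v (rt v)" for v unfolding rt_def by (rule someI, rule linked_in_refl)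
  have 2: "rt v = rt w" if "linked_in ?E ?U v w" for v w
  proof -
    have "linked_in ?E ?U v = linked_in ?E ?U w"
      by (rule linked_in_eq[OF simple_graph_sym[OF G] that])
    then show ?thesis by (simp add: rt_def)
  qed
  have fin: "finite ?U" using simple_graph_finite[OF G] by simp
  have "\<exists>\<pi>. rooted_forest ?E ?U rt \<pi>"
    by (rule dfs_forest[OF simple_graph_sym[OF G] fin 1 2])
  then obtain \<pi> where "rooted_forest ?E ?U rt \<pi>" ..
  note \<pi> = rooted_forestD[OF this]
  have deep: "\<pi> ((\<pi> ^^ (2 ^ p)) v) = (\<pi> ^^ (2 ^ p)) v" if v: "v \<in> ?U" for v
  proof -
    have ex: "\<exists>n. \<pi> ((\<pi> ^^ n) v) = (\<pi> ^^ n) v" using \<pi>(3,4)[OF v] by metis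
    define n where "n = (LEAST n. \<pi> ((\<pi> ^^ n) v) = (\<pi> ^^ n) v)"
    have n: "\<pi> ((\<pi> ^^ n) v) = (\<pi> ^^ n) v" unfolding n_def by (rule LeastI_ex[OF ex])
    have less: "\<pi> ((\<pi> ^^ k) v) \<noteq> (\<pi> ^^ k) v" if "k < n" for k
      using not_less_Least[of k "\<lambda>n. \<pi> ((\<pi> ^^ n) v) = (\<pi> ^^ n) v"] that unfolding n_def by blast
    let ?vs = "map (\<lambda>i. (\<pi> ^^ i) v) [0..<Suc n]"
    have U: "(\<pi> ^^ i) v \<in> ?U" for i by (induction i) (use v \<pi>(1) in \<open>auto simp del: mem_Collect_eq\<close>)
    have "distinct ?vs" by (rule trajectory_distinct[OF less n])
    moreover have "successively ?E ?vs"
      unfolding successively_conv_nth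
    proof (intro allI impI)
      fix i assume "Suc i < length ?vs"
      then have i: "i < n" by simp
      have "?E ((\<pi> ^^ i) v) (\<pi> ((\<pi> ^^ i) v))" by (rule \<pi>(2)[OF U less[OF i]])
      then show "?E (?vs ! i) (?vs ! Suc i)"
        using i by (simp del: upt_Suc)
    qed
    moreover have "set ?vs \<subseteq> verts G" using U by auto
    moreover have "card (\<chi> ` set ?vs) \<le> p"
    proof -
      have "\<chi> ` set ?vs \<subseteq> I" using U by auto
      from card_mono[OF I(1) this] show ?thesis using I(2) by simp
    qed
    ultimately have "length ?vs < 2 ^ p" using \<chi> unfolding path_coloring_def by blast
    then have "n \<le> 2 ^ p" by simp
    from funpow_stable[of \<pi> n v, OF n this] show ?thesis using n by simp
  qed
  let ?\<pi> = "\<lambda>v. if v \<in> ?U then \<pi> v else v"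
  have pw: "(?\<pi> ^^ n) v = (\<pi> ^^ n) v \<and> (\<pi> ^^ n) v \<in> ?U" if "v \<in> ?U" for v n
    by (induction n) (use that \<pi>(1) in \<open>auto simp del: mem_Collect_eq\<close>)
  have "elimination_forest ?E ?U (2 ^ p) ?\<pi>"
    unfolding elimination_forest_def using \<pi>(1,2,5) deep pw by (simp del: mem_Collect_eq)
  then show ?thesis by (intro exI[of _ ?\<pi>]) simp
qed

section \<open>Types in labelled forests\<close>

text \<open>This lets any finite data serve as labels: they remain natural numbers with an explicit
  bound, and exactly the equality of the data is preserved.\<close>

lemma relabel:
  assumes "finite A" "card A \<le> m" "\<forall>v\<in>V. g v \<in> A"
  shows "\<exists>l :: 'a \<Rightarrow> nat. (\<forall>v\<in>V. l v < m) \<and> (\<forall>v\<in>V. \<forall>w\<in>V. l v = l w \<longleftrightarrow> g v = g w)"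
proof -
  obtain f :: "'b \<Rightarrow> nat" where f: "bij_betw f A {0..<card A}"
    using ex_bij_betw_finite_nat[OF assms(1)] by blast
  have "f (g v) < m" if "v \<in> V" for v
    using bij_betwE[OF f] assms(2) assms(3)[rule_format, OF that] by fastforce
  moreover have "f (g v) = f (g w) \<longleftrightarrow> g v = g w" if "v \<in> V" "w \<in> V" for v w
    using bij_betw_imp_inj_on[OF f] assms(3) that by (auto simp: inj_on_def)
  ultimately show ?thesis by (intro exI[of _ "f \<circ> g"]) simp
qed

text \<open>A set of pairs \<open>(x\<^sub>i, y\<^sub>i)\<close> stands for two tuples. They are similar if they have the same
  quantifier-free type with respect to terms of nesting depth at most \<open>h\<close> in the functions \<open>F\<close>.\<close>

definition partial_iso :: "('a \<Rightarrow> 'a \<Rightarrow> bool) \<Rightarrow> ('a \<Rightarrow> nat) \<Rightarrow> ('a \<times> 'a) set \<Rightarrow> bool" where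
  "partial_iso E l \<Theta> \<longleftrightarrow> (\<forall>(a, b)\<in>\<Theta>. l a = l b \<and>
     (\<forall>(a', b')\<in>\<Theta>. (a = a' \<longleftrightarrow> b = b') \<and> (E a a' \<longleftrightarrow> E b b')))"

definition spread :: "('a \<Rightarrow> 'a) set \<Rightarrow> ('a \<times> 'a) set \<Rightarrow> ('a \<times> 'a) set" where
  "spread F \<Theta> = \<Theta> \<union> (\<Union>f\<in>F. map_prod f f ` \<Theta>)"

definition similar ::
  "('a \<Rightarrow> 'a \<Rightarrow> bool) \<Rightarrow> ('a \<Rightarrow> 'a) set \<Rightarrow> ('a \<Rightarrow> nat) \<Rightarrow> nat \<Rightarrow> ('a \<times> 'a) set \<Rightarrow> bool" where
  "similar E F l h \<Theta> \<longleftrightarrow> partial_iso E l ((spread F ^^ h) \<Theta>)"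

definition guarded :: "('a \<Rightarrow> 'a \<Rightarrow> bool) \<Rightarrow> 'a set \<Rightarrow> ('a \<Rightarrow> 'a) set \<Rightarrow> bool" where
  "guarded E V F \<longleftrightarrow> (\<forall>f\<in>F. \<forall>v\<in>V. f v \<in> V \<and> (f v = v \<or> E v (f v)))"

lemma spread_mono: "F \<subseteq> F' \<Longrightarrow> \<Theta> \<subseteq> \<Theta>' \<Longrightarrow> spread F \<Theta> \<subseteq> spread F' \<Theta>'"
  unfolding spread_def by (intro Un_mono UN_mono image_mono)

lemma spread_pow_mono:
  assumes "F \<subseteq> F'" "\<Theta> \<subseteq> \<Theta>'"
  shows "(spread F ^^ h) \<Theta> \<subseteq> (spread F' ^^ h) \<Theta>'"
  by (induction h) (use assms in \<open>simp_all add: spread_mono\<close>)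

lemma spread_pow_increasing: "h \<le> h' \<Longrightarrow> (spread F ^^ h) \<Theta> \<subseteq> (spread F ^^ h') \<Theta>"
  by (induction h') (auto simp: le_Suc_eq spread_def)

lemma spread_converse: "spread F (\<Theta>\<inverse>) = (spread F \<Theta>)\<inverse>"
  by (auto simp: spread_def)

lemma spread_pow_converse: "(spread F ^^ h) (\<Theta>\<inverse>) = ((spread F ^^ h) \<Theta>)\<inverse>"
  by (induction h) (simp_all add: spread_converse)

lemma partial_iso_mono: "\<Theta> \<subseteq> \<Theta>' \<Longrightarrow> partial_iso E l \<Theta>' \<Longrightarrow> partial_iso E l \<Theta>"
  unfolding partial_iso_def by fast

lemma similar_converse: "similar E F l h \<Theta> \<Longrightarrow> similar E F l h (\<Theta>\<inverse>)"
  unfolding similar_def spread_pow_converse partial_iso_def by fastforce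

lemma similar_mono:
  assumes "similar E F' l' h' \<Theta>'" "F \<subseteq> F'" "h \<le> h'" "\<Theta> \<subseteq> \<Theta>'" "\<Theta>' \<subseteq> V \<times> V" "guarded E V F'"
    and "\<And>a b. a \<in> V \<Longrightarrow> b \<in> V \<Longrightarrow> l' a = l' b \<Longrightarrow> l a = l b"
  shows "similar E F l h \<Theta>"
proof -
  have "(spread F' ^^ h') \<Theta>' \<subseteq> V \<times> V"
  proof (induction h')
    case (Suc n)
    then show ?case using assms(6) by (auto simp: spread_def guarded_def)
  qed (use assms in simp)
  moreover have "(spread F ^^ h) \<Theta> \<subseteq> (spread F' ^^ h') \<Theta>'"
    using spread_pow_mono[OF assms(2,4), of h] spread_pow_increasing[OF assms(3), of F' \<Theta>'] by blast
  ultimately show ?thesis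
    using assms(1,7) unfolding similar_def partial_iso_def by fast
qed

lemma spread_pow_subset:
  assumes "guarded E V F" "\<Theta> \<subseteq> V \<times> V"
  shows "(spread F ^^ h) \<Theta> \<subseteq> V \<times> V"
proof (induction h)
  case (Suc n)
  then show ?case using assms(1) by (auto simp: spread_def guarded_def)
qed (use assms in simp)

lemma Domain_spread: "Domain (spread F \<Theta>) = Domain \<Theta> \<union> (\<Union>f\<in>F. f ` Domain \<Theta>)"
  by (force simp: spread_def Domain_unfold)

text \<open>The values of terms on the left do not depend on the right. So \<open>(z, z)\<close> can
  stand for \<open>(z, z')\<close> while the partner \<open>z'\<close> is still to be found.\<close>

lemma Domain_spread_cong:
  "Domain \<Theta> = Domain \<Theta>' \<Longrightarrow> Domain ((spread F ^^ h) \<Theta>) = Domain ((spread F ^^ h) \<Theta>')"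
  by (induction h) (simp_all add: Domain_spread)

lemma card_spread:
  assumes "finite F" "finite \<Theta>"
  shows "finite (spread F \<Theta>) \<and> card (spread F \<Theta>) \<le> Suc (card F) * card \<Theta>"
proof
  show "finite (spread F \<Theta>)" using assms by (simp add: spread_def)
  have "card (spread F \<Theta>) \<le> card \<Theta> + card (\<Union>f\<in>F. map_prod f f ` \<Theta>)"
    unfolding spread_def by (rule card_Un_le)
  also have "card (\<Union>f\<in>F. map_prod f f ` \<Theta>) \<le> (\<Sum>f\<in>F. card (map_prod f f ` \<Theta>))"
    by (rule card_UN_le[OF assms(1)])
  also have "\<dots> \<le> (\<Sum>f\<in>F. card \<Theta>)" by (rule sum_mono) (rule card_image_le[OF assms(2)])
  finally show "card (spread F \<Theta>) \<le> Suc (card F) * card \<Theta>" by simp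
qed

lemma card_spread_pow:
  assumes "finite F" "finite \<Theta>"
  shows "finite ((spread F ^^ h) \<Theta>) \<and> card ((spread F ^^ h) \<Theta>) \<le> Suc (card F) ^ h * card \<Theta>"
proof (induction h)
  case (Suc h)
  have "card ((spread F ^^ Suc h) \<Theta>) \<le> Suc (card F) * card ((spread F ^^ h) \<Theta>)"
    using card_spread[OF assms(1)] Suc by simp
  also have "\<dots> \<le> Suc (card F) * (Suc (card F) ^ h * card \<Theta>)" using Suc by (intro mult_le_mono2) blast
  finally have "card ((spread F ^^ Suc h) \<Theta>) \<le> Suc (card F) ^ Suc h * card \<Theta>"
    by (simp only: power_Suc mult.assoc)
  moreover have "finite ((spread F ^^ Suc h) \<Theta>)"
    using card_spread[OF assms(1), of "(spread F ^^ h) \<Theta>"] Suc by simp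
  ultimately show ?case by (rule conjI[rotated])
qed (use assms in simp)

text \<open>A type of height \<open>i + 1\<close> is one of \<open>n\<close> labels together with,
  for each type of height \<open>i\<close>, the number of children of that type, truncated to one of
  \<open>Suc q\<close> values.\<close>

fun type_bound :: "nat \<Rightarrow> nat \<Rightarrow> nat \<Rightarrow> nat" where
  "type_bound q n 0 = n"
| "type_bound q n (Suc i) = n * Suc q ^ type_bound q n i"

text \<open>Truncating multiplicities at \<open>q\<close> keeps the number of types bounded. It does no harm to a
  partial isomorphism with less than \<open>q\<close> pairs: it can still avoid the vertices already used.\<close>

locale labelled_forest =
  fixes E :: "'a \<Rightarrow> 'a \<Rightarrow> bool" and U :: "'a set" and L :: nat and \<pi> :: "'a \<Rightarrow> 'a"
    and \<mu> :: "'a \<Rightarrow> nat" and q :: nat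
  assumes finite_U: "finite U" and sym: "\<And>a b. E a b \<Longrightarrow> E b a"
    and forest: "elimination_forest E U L \<pi>"
begin

definition depth :: "'a \<Rightarrow> nat" where
  "depth v = (LEAST n. \<pi> ((\<pi> ^^ n) v) = (\<pi> ^^ n) v)"

text \<open>A type is not an object here but is represented by a vertex \<open>c\<close> that has
  it. The condition \<open>d \<noteq> a\<close> keeps a root, a fixed point of \<open>\<pi>\<close>,
  from counting as its own child.\<close>

primrec alike :: "nat \<Rightarrow> 'a \<Rightarrow> 'a \<Rightarrow> bool" where
  "alike 0 a b \<longleftrightarrow> \<mu> a = \<mu> b"
| "alike (Suc i) a b \<longleftrightarrow> \<mu> a = \<mu> b \<and>
     (\<forall>c\<in>U. min q (card {d\<in>U. \<pi> d = a \<and> d \<noteq> a \<and> alike i c d}) =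
             min q (card {d\<in>U. \<pi> d = b \<and> d \<noteq> b \<and> alike i c d}))"

text \<open>Below a vertex \<open>a\<close> there are at most \<open>L - depth a\<close> further
  levels, so \<open>alike\<close> with this index compares whole subtrees, up to truncation.\<close>

definition tree_iso :: "('a \<times> 'a) set \<Rightarrow> bool" where
  "tree_iso \<Theta> \<longleftrightarrow> finite \<Theta> \<and> \<Theta> \<subseteq> U \<times> U \<and> (\<forall>(a, b)\<in>\<Theta>. \<forall>(a', b')\<in>\<Theta>. a = a' \<longleftrightarrow> b = b') \<and>
     (\<forall>(a, b)\<in>\<Theta>. (\<pi> a, \<pi> b) \<in> \<Theta> \<and> depth a = depth b \<and> alike (L - depth a) a b)"

lemma parent_in: "v \<in> U \<Longrightarrow> \<pi> v \<in> U"
  using forest by (simp add: elimination_forest_def)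

lemma ancestor_in: "v \<in> U \<Longrightarrow> (\<pi> ^^ n) v \<in> U"
  by (induction n) (simp_all add: parent_in)

lemma top_fixed: "v \<in> U \<Longrightarrow> \<pi> ((\<pi> ^^ L) v) = (\<pi> ^^ L) v"
  using forest by (simp add: elimination_forest_def)

lemma depth_le: "v \<in> U \<Longrightarrow> depth v \<le> L"
  unfolding depth_def by (rule Least_le) (rule top_fixed)

lemma depth_fixed: "v \<in> U \<Longrightarrow> \<pi> ((\<pi> ^^ depth v) v) = (\<pi> ^^ depth v) v"
  unfolding depth_def by (rule LeastI[of _ L]) (rule top_fixed)

lemma depth_root: "\<pi> v = v \<Longrightarrow> depth v = 0"
  unfolding depth_def by (rule Least_equality) auto

lemma depth_0: "v \<in> U \<Longrightarrow> depth v = 0 \<Longrightarrow> \<pi> v = v"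
  using depth_fixed[of v] by simp

lemma depth_parent:
  assumes "v \<in> U" "\<pi> v \<noteq> v"
  shows "depth v = Suc (depth (\<pi> v))"
proof -
  have "depth v = Suc (LEAST n. \<pi> ((\<pi> ^^ Suc n) v) = (\<pi> ^^ Suc n) v)"
    unfolding depth_def
    by (rule Least_Suc[of _ L]) (use top_fixed[OF assms(1)] assms(2) in auto)
  then show ?thesis unfolding depth_def by (simp add: funpow_swap1)
qed

lemma comparable:
  assumes "u \<in> U" "v \<in> U" "E u v"
  shows "\<exists>i\<le>L. (\<pi> ^^ i) u = v \<or> (\<pi> ^^ i) v = u"
proof -
  have *: "\<exists>i\<le>L. (\<pi> ^^ i) u = (\<pi> ^^ n) u" if "u \<in> U" for u n
  proof (cases "n \<le> L")
    case False
    then have "(\<pi> ^^ n) u = (\<pi> ^^ L) u" using funpow_stable[of \<pi> L u n] top_fixed[OF that] by simp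
    then show ?thesis by auto
  qed auto
  have "(\<exists>n. (\<pi> ^^ n) u = v) \<or> (\<exists>n. (\<pi> ^^ n) v = u)"
    using forest assms by (simp add: elimination_forest_def)
  then show ?thesis using *[OF assms(1)] *[OF assms(2)] by metis
qed

lemma alike_label:
  assumes "\<And>v. v \<in> U \<Longrightarrow> \<mu> v < n"
  shows "\<exists>l :: 'a \<Rightarrow> nat. (\<forall>v\<in>U. l v < type_bound q n i) \<and>
    (\<forall>a\<in>U. \<forall>b\<in>U. l a = l b \<longleftrightarrow> alike i a b)"
proof (induction i)
  case 0
  then show ?case using assms by (intro exI[of _ \<mu>]) simp
next
  case (Suc i)
  let ?m = "type_bound q n i"
  obtain l :: "'a \<Rightarrow> nat" where l: "\<And>v. v \<in> U \<Longrightarrow> l v < ?m"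
    "\<And>a b. a \<in> U \<Longrightarrow> b \<in> U \<Longrightarrow> l a = l b \<longleftrightarrow> alike i a b" using Suc by blast
  let ?c = "\<lambda>a t. min q (card {d\<in>U. \<pi> d = a \<and> d \<noteq> a \<and> l d = t})"
  let ?g = "\<lambda>a. (\<mu> a, \<lambda>t\<in>{..<?m}. ?c a t)"
  let ?A = "{..<n} \<times> ({..<?m} \<rightarrow>\<^sub>E {..q})"
  have "finite ?A" "card ?A \<le> type_bound q n (Suc i)"
    by (auto simp: card_cartesian_product card_PiE intro: finite_PiE)
  moreover have "\<forall>v\<in>U. ?g v \<in> ?A" using assms by auto
  ultimately have "\<exists>l' :: 'a \<Rightarrow> nat. (\<forall>v\<in>U. l' v < type_bound q n (Suc i)) \<and>
      (\<forall>v\<in>U. \<forall>w\<in>U. l' v = l' w \<longleftrightarrow> ?g v = ?g w)"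
    by (rule relabel)
  then obtain l' :: "'a \<Rightarrow> nat" where l': "\<forall>v\<in>U. l' v < type_bound q n (Suc i)"
    "\<forall>v\<in>U. \<forall>w\<in>U. l' v = l' w \<longleftrightarrow> ?g v = ?g w"
    by (elim exE conjE)
  have eq: "{d\<in>U. \<pi> d = a \<and> d \<noteq> a \<and> alike i c d} = {d\<in>U. \<pi> d = a \<and> d \<noteq> a \<and> l d = l c}"
    if "c \<in> U" for a c using l(2)[OF that] by auto metis+
  have "?g a = ?g b \<longleftrightarrow> alike (Suc i) a b" for a b
  proof
    assume g: "?g a = ?g b"
    then have g2: "(\<lambda>t\<in>{..<?m}. ?c a t) = (\<lambda>t\<in>{..<?m}. ?c b t)" by (simp only: prod.inject)
    have "?c a (l c) = ?c b (l c)" if "c \<in> U" for c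
      using fun_cong[OF g2, of "l c"] l(1)[OF that] by simp
    then show "alike (Suc i) a b" using g by (simp add: eq)
  next
    assume al: "alike (Suc i) a b"
    have "?c a t = ?c b t" for t
    proof (cases "\<exists>c\<in>U. l c = t")
      case True
      then show ?thesis using al by (auto simp: eq)
    next
      case False
      then have "{d\<in>U. \<pi> d = x \<and> d \<noteq> x \<and> l d = t} = {}" for x by auto
      then show ?thesis by (simp only:)
    qed
    then show "?g a = ?g b" using al by auto
  qed
  then show ?case using l' by (intro exI[of _ l']) simp
qed

lemma alike_refl: "alike i a a"
  by (induction i) auto

lemma alike_sym: "alike i a b \<Longrightarrow> alike i b a"
  by (cases i) auto

lemma alike_trans: "alike i a b \<Longrightarrow> alike i b c \<Longrightarrow> alike i a c"
  by (cases i) auto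

lemma alike_mu: "alike i a b \<Longrightarrow> \<mu> a = \<mu> b"
  by (cases i) auto

text \<open>If all of \<open>D'\<close> were used, \<open>\<Theta>\<close> would match it
  injectively into \<open>D\<close> without \<open>y\<close>. Then \<open>card D'\<close> is below
  both \<open>card D\<close> and \<open>q\<close>, and the truncated cardinalities would
  differ.\<close>

lemma spare_partner:
  assumes \<Theta>: "finite \<Theta>" "card \<Theta> < q" "\<forall>(a, b)\<in>\<Theta>. \<forall>(a', b')\<in>\<Theta>. a = a' \<longleftrightarrow> b = b'"
    and D: "\<And>d d'. (d, d') \<in> \<Theta> \<Longrightarrow> d' \<in> D' \<Longrightarrow> d \<in> D" "finite D" "min q (card D) = min q (card D')"
    and y: "y \<in> D" "y \<notin> Domain \<Theta>"
  shows "\<exists>y'\<in>D'. y' \<notin> Range \<Theta>"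
proof (rule ccontr)
  assume "\<not> ?thesis"
  then have R: "D' \<subseteq> Range \<Theta>" by blast
  let ?T = "{p\<in>\<Theta>. fst p \<in> D}"
  have "D' \<subseteq> snd ` ?T" using R D(1) by force
  then have "card D' \<le> card ?T"
    using card_mono[of "snd ` ?T" D'] card_image_le[of ?T snd] \<Theta>(1) by force
  also have T: "card ?T = card (fst ` ?T)"
    using \<Theta>(3) by (intro card_image[symmetric] inj_onI) force
  also have "\<dots> \<le> card (D - {y})"
    using y(2) D(2) by (intro card_mono) (auto simp: Domain_unfold)
  also have "\<dots> < card D" using y(1) D(2) by (metis card_Diff1_less)
  finally have "card D' < card D" .
  moreover have "card D' \<le> card \<Theta>"
    using \<open>card D' \<le> card ?T\<close> card_mono[of \<Theta> ?T] \<Theta>(1) by force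
  ultimately show False using D(3) \<Theta>(2) by linarith
qed

section \<open>Extending tree isomorphisms\<close>

lemma tree_isoD:
  assumes "tree_iso \<Theta>" "(a, b) \<in> \<Theta>"
  shows "a \<in> U" "b \<in> U" "(\<pi> a, \<pi> b) \<in> \<Theta>" "depth a = depth b" "alike (L - depth a) a b"
    "(a', b') \<in> \<Theta> \<Longrightarrow> a = a' \<longleftrightarrow> b = b'"
  using assms unfolding tree_iso_def by fast+

lemma tree_iso_ancestor: "tree_iso \<Theta> \<Longrightarrow> (a, b) \<in> \<Theta> \<Longrightarrow> ((\<pi> ^^ n) a, (\<pi> ^^ n) b) \<in> \<Theta>"
  by (induction n) (auto intro: tree_isoD)

lemma tree_iso_insert:
  assumes "tree_iso \<Theta>" "y \<in> U" "y' \<in> U" "y \<notin> Domain \<Theta>" "y' \<notin> Range \<Theta>"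
    and "(\<pi> y, \<pi> y') \<in> insert (y, y') \<Theta>" "depth y = depth y'" "alike (L - depth y) y y'"
  shows "tree_iso (insert (y, y') \<Theta>)"
  using assms unfolding tree_iso_def by (auto simp: Domain_iff Range_iff)

text \<open>For a root \<open>y\<close> the candidates on both sides are the roots of its type.
  Otherwise they are children of \<open>\<pi> y\<close> and of its partner, and since these two are
  alike, their truncated numbers of children of the type of \<open>y\<close> agree.\<close>

lemma tree_iso_extend1:
  assumes iso: "tree_iso \<Theta>" and "card \<Theta> < q" and y: "y \<in> U" "y \<notin> Domain \<Theta>"
    and par: "\<pi> y = y \<or> \<pi> y \<in> Domain \<Theta>"
  shows "\<exists>y'. tree_iso (insert (y, y') \<Theta>)"
proof -
  have \<Theta>: "finite \<Theta>" "\<forall>(a, b)\<in>\<Theta>. \<forall>(a', b')\<in>\<Theta>. a = a' \<longleftrightarrow> b = b'"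
    using iso unfolding tree_iso_def by blast+
  show ?thesis
  proof (cases "\<pi> y = y")
    case True
    let ?D = "{d\<in>U. \<pi> d = d \<and> alike L y d}"
    have "d \<in> ?D" if "(d, d') \<in> \<Theta>" "d' \<in> ?D" for d d'
    proof -
      have dd: "depth d = 0" using tree_isoD(4)[OF iso that(1)] depth_root[of d'] that(2) by simp
      have "\<pi> d = d" by (rule depth_0[OF tree_isoD(1)[OF iso that(1)] dd])
      moreover have "alike L d d'" using tree_isoD(5)[OF iso that(1)] dd by simp
      ultimately show ?thesis
        using that alike_trans alike_sym tree_isoD(1)[OF iso that(1)] by blast
    qed
    then obtain y' where y': "y' \<in> ?D" "y' \<notin> Range \<Theta>"
      using spare_partner[OF \<Theta>(1) assms(2) \<Theta>(2), of ?D ?D y] y True finite_U alike_refl by auto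
    have "depth y = 0" "depth y' = 0" using True y' by (auto intro: depth_root)
    then have "tree_iso (insert (y, y') \<Theta>)"
      using y y' True by (intro tree_iso_insert[OF iso]) auto
    then show ?thesis ..
  next
    case False
    then obtain b where b: "(\<pi> y, b) \<in> \<Theta>" using par by blast
    let ?a = "\<pi> y" and ?i = "L - depth y"
    have dy: "depth y = Suc (depth ?a)" by (rule depth_parent[OF y(1) False])
    then have i: "L - depth ?a = Suc ?i" using depth_le[OF y(1)] by simp
    let ?D = "\<lambda>a. {d\<in>U. \<pi> d = a \<and> d \<noteq> a \<and> alike ?i y d}"
    have "alike (Suc ?i) ?a b" using tree_isoD(5)[OF iso b] i by simp
    then have card: "min q (card (?D ?a)) = min q (card (?D b))" using y(1) by simp
    have "d \<in> ?D ?a" if dd: "(d, d') \<in> \<Theta>" "d' \<in> ?D b" for d d'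
    proof -
      have "\<pi> d = ?a"
        using tree_isoD(6)[OF iso tree_isoD(3)[OF iso dd(1)] b] dd(2) by auto
      moreover have "d \<noteq> ?a" using tree_isoD(6)[OF iso dd(1) b] dd(2) by auto
      moreover have "depth d = depth y"
        using depth_parent[OF tree_isoD(1)[OF iso dd(1)]] calculation dy by metis
      then have "alike ?i d d'" using tree_isoD(5)[OF iso dd(1)] by simp
      ultimately show ?thesis
        using dd alike_trans alike_sym tree_isoD(1)[OF iso dd(1)] by blast
    qed
    then obtain y' where y': "y' \<in> ?D b" "y' \<notin> Range \<Theta>"
      using spare_partner[OF \<Theta>(1) assms(2) \<Theta>(2), of "?D b" "?D ?a" y] card y False finite_U alike_refl
      by auto
    have "depth y' = Suc (depth b)" using depth_parent[of y'] y' by auto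
    then have "depth y = depth y'" using dy tree_isoD(4)[OF iso b] by simp
    then have "tree_iso (insert (y, y') \<Theta>)"
      using y y' b by (intro tree_iso_insert[OF iso]) auto
    then show ?thesis ..
  qed
qed

text \<open>The ancestors of \<open>y\<close> are matched from the root downwards, which costs at
  most \<open>L + 1\<close> pairs.\<close>

lemma tree_iso_extend:
  assumes "tree_iso \<Theta>" "card \<Theta> + L + 1 \<le> q" "y \<in> U"
  shows "\<exists>\<Theta>'. \<Theta> \<subseteq> \<Theta>' \<and> tree_iso \<Theta>' \<and> card \<Theta>' \<le> card \<Theta> + L + 1 \<and> y \<in> Domain \<Theta>'"
proof -
  have "\<exists>\<Theta>'. \<Theta> \<subseteq> \<Theta>' \<and> tree_iso \<Theta>' \<and> card \<Theta>' \<le> card \<Theta> + n + 1 \<and> y \<in> Domain \<Theta>'"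
    if "y \<in> U" "depth y = n" for y n
    using that
  proof (induction n arbitrary: y)
    case 0
    show ?case
    proof (cases "y \<in> Domain \<Theta>")
      case False
      obtain y' where "tree_iso (insert (y, y') \<Theta>)"
        using tree_iso_extend1[OF assms(1) _ 0(1) False] depth_0[OF 0] assms(2) by auto
      then show ?thesis using card_insert_le_m1[of _ \<Theta> "(y, y')"]
        by (intro exI[of _ "insert (y, y') \<Theta>"]) (auto simp: card_insert_if tree_iso_def)
    qed (use assms(1) in auto)
  next
    case (Suc n)
    have ne: "\<pi> y \<noteq> y" using depth_root Suc.prems(2) by force
    then have d: "depth (\<pi> y) = n" using depth_parent[OF Suc.prems(1)] Suc.prems(2) by simp
    obtain \<Theta>' where \<Theta>': "\<Theta> \<subseteq> \<Theta>'" "tree_iso \<Theta>'" "card \<Theta>' \<le> card \<Theta> + n + 1" "\<pi> y \<in> Domain \<Theta>'"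
      using Suc.IH[OF parent_in[OF Suc.prems(1)] d] by blast
    show ?case
    proof (cases "y \<in> Domain \<Theta>'")
      case True
      then show ?thesis using \<Theta>' by (intro exI[of _ \<Theta>']) auto
    next
      case False
      have "card \<Theta>' < q"
        using \<Theta>'(3) assms(2) depth_le[OF Suc.prems(1)] Suc.prems(2) by simp
      then obtain y' where "tree_iso (insert (y, y') \<Theta>')"
        using tree_iso_extend1[OF \<Theta>'(2) _ Suc.prems(1) False] \<Theta>'(4) by auto
      then show ?thesis using \<Theta>'
        by (intro exI[of _ "insert (y, y') \<Theta>'"]) (auto simp: card_insert_if tree_iso_def)
    qed
  qed
  from this[OF assms(3) refl] show ?thesis using depth_le[OF assms(3)] by (meson add_le_mono le_refl le_trans)
qed

lemma tree_iso_extend_set: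
  assumes "finite Y" "Y \<subseteq> U" "tree_iso \<Theta>" "card \<Theta> + card Y * (L + 1) \<le> q"
  shows "\<exists>\<Theta>'. \<Theta> \<subseteq> \<Theta>' \<and> tree_iso \<Theta>' \<and> card \<Theta>' \<le> card \<Theta> + card Y * (L + 1) \<and> Y \<subseteq> Domain \<Theta>'"
  using assms(1,2,4)
proof (induction Y rule: finite_induct)
  case empty
  then show ?case using assms(3) by auto
next
  case (insert y Y)
  then obtain \<Theta>' where \<Theta>': "\<Theta> \<subseteq> \<Theta>'" "tree_iso \<Theta>'" "card \<Theta>' \<le> card \<Theta> + card Y * (L + 1)"
    "Y \<subseteq> Domain \<Theta>'" by auto
  have "card \<Theta>' + L + 1 \<le> q" using \<Theta>'(3) insert by simp
  then obtain \<Theta>'' where "\<Theta>' \<subseteq> \<Theta>''" "tree_iso \<Theta>''" "card \<Theta>'' \<le> card \<Theta>' + L + 1" "y \<in> Domain \<Theta>''"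
    using tree_iso_extend[OF \<Theta>'(2), of y] insert.prems(1) by auto
  moreover from this have "Domain \<Theta>' \<subseteq> Domain \<Theta>''" by (intro Domain_mono)
  ultimately show ?case using \<Theta>' insert(1,2) by (intro exI[of _ \<Theta>'']) auto
qed

end

text \<open>The labels \<open>\<mu>\<close> describe \<open>E\<close> and the guarded functions relative to the forest, which is
  possible since their values are comparable to their arguments.\<close>

locale encoding_forest = labelled_forest +
  fixes F :: "('a \<Rightarrow> 'a) set" and l :: "'a \<Rightarrow> nat" and V :: "'a set"
  assumes UV: "U \<subseteq> V" and guarded: "guarded E V F"
    and encode_label: "\<And>a b. a \<in> U \<Longrightarrow> b \<in> U \<Longrightarrow> \<mu> a = \<mu> b \<Longrightarrow> l a = l b"
    and encode_edge: "\<And>a b i. a \<in> U \<Longrightarrow> b \<in> U \<Longrightarrow> \<mu> a = \<mu> b \<Longrightarrow> i \<le> L \<Longrightarrow>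
      E a ((\<pi> ^^ i) a) \<longleftrightarrow> E b ((\<pi> ^^ i) b)"
    and encode_up: "\<And>a b i f. a \<in> U \<Longrightarrow> b \<in> U \<Longrightarrow> \<mu> a = \<mu> b \<Longrightarrow> i \<le> L \<Longrightarrow> f \<in> F \<Longrightarrow>
      f a = (\<pi> ^^ i) a \<longleftrightarrow> f b = (\<pi> ^^ i) b"
    and encode_down: "\<And>a b i f. a \<in> U \<Longrightarrow> b \<in> U \<Longrightarrow> \<mu> a = \<mu> b \<Longrightarrow> i \<le> L \<Longrightarrow> f \<in> F \<Longrightarrow>
      f ((\<pi> ^^ i) a) = a \<longleftrightarrow> f ((\<pi> ^^ i) b) = b"
begin

lemma tree_iso_converse:
  assumes iso: "tree_iso \<Theta>"
  shows "tree_iso (\<Theta>\<inverse>)"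
proof -
  have "\<forall>(b, a)\<in>\<Theta>\<inverse>. (\<pi> b, \<pi> a) \<in> \<Theta>\<inverse> \<and> depth b = depth a \<and> alike (L - depth b) b a"
  proof (rule ballI)
    fix e assume e: "e \<in> \<Theta>\<inverse>"
    obtain a b where ab: "e = (b, a)" "(a, b) \<in> \<Theta>" using e by (cases e) auto
    then show "case e of (b, a) \<Rightarrow> (\<pi> b, \<pi> a) \<in> \<Theta>\<inverse> \<and> depth b = depth a \<and> alike (L - depth b) b a"
      using tree_isoD(3-5)[OF iso ab(2)] alike_sym by auto
  qed
  moreover have "finite (\<Theta>\<inverse>)" "\<Theta>\<inverse> \<subseteq> U \<times> U" using iso unfolding tree_iso_def by auto
  moreover have "\<forall>(b, a)\<in>\<Theta>\<inverse>. \<forall>(b', a')\<in>\<Theta>\<inverse>. b = b' \<longleftrightarrow> a = a'"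
    using tree_isoD(6)[OF iso] by auto
  ultimately show ?thesis unfolding tree_iso_def by blast
qed

lemma tree_iso_edge:
  assumes iso: "tree_iso \<Theta>" and ab: "(a, b) \<in> \<Theta>" "(a', b') \<in> \<Theta>" and e: "E a a'"
  shows "E b b'"
proof -
  have U: "a \<in> U" "b \<in> U" "a' \<in> U" "b' \<in> U" using tree_isoD(1,2)[OF iso] ab by auto
  obtain i where i: "i \<le> L" "(\<pi> ^^ i) a = a' \<or> (\<pi> ^^ i) a' = a" using comparable[OF U(1,3) e] by blast
  from i(2) show ?thesis
  proof
    assume "(\<pi> ^^ i) a = a'"
    moreover from this have "(\<pi> ^^ i) b = b'"
      using tree_isoD(6)[OF iso tree_iso_ancestor[OF iso ab(1), of i] ab(2)] by simp
    ultimately show ?thesis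
      using encode_edge[OF U(1,2) alike_mu[OF tree_isoD(5)[OF iso ab(1)]] i(1)] e by simp
  next
    assume "(\<pi> ^^ i) a' = a"
    moreover from this have "(\<pi> ^^ i) b' = b"
      using tree_isoD(6)[OF iso tree_iso_ancestor[OF iso ab(2), of i] ab(1)] by simp
    ultimately have "E b' b"
      using encode_edge[OF U(3,4) alike_mu[OF tree_isoD(5)[OF iso ab(2)]] i(1)] sym[OF e] by simp
    then show ?thesis by (rule sym)
  qed
qed

lemma tree_iso_partial_iso:
  assumes iso: "tree_iso \<Theta>"
  shows "partial_iso E l \<Theta>"
proof -
  have "l a = l b" if "(a, b) \<in> \<Theta>" for a b
    using encode_label tree_isoD(1,2)[OF iso that] alike_mu[OF tree_isoD(5)[OF iso that]] by blast
  moreover have "E a a' \<longleftrightarrow> E b b'" if "(a, b) \<in> \<Theta>" "(a', b') \<in> \<Theta>" for a b a' b'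
    using tree_iso_edge[OF iso that] tree_iso_edge[OF tree_iso_converse[OF iso], of b a b' a'] that
    by auto
  ultimately show ?thesis using tree_isoD(6)[OF iso] unfolding partial_iso_def by fast
qed

text \<open>Since \<open>f\<close> is guarded, \<open>a\<close> and \<open>f a\<close> are
  comparable, and the label of the lower one records how many levels \<open>f\<close> moves:
  \<open>encode_up\<close> or \<open>encode_down\<close>, according to the direction. Matching
  respects ancestors, so the same holds for \<open>b\<close> and \<open>c\<close>.\<close>

lemma tree_iso_function:
  assumes iso: "tree_iso \<Theta>" and ab: "(a, b) \<in> \<Theta>" and c: "(f a, c) \<in> \<Theta>" and f: "f \<in> F"
  shows "c = f b"
proof -
  have U: "a \<in> U" "b \<in> U" "f a \<in> U" "c \<in> U" using tree_isoD(1,2)[OF iso] ab c by auto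
  have m: "\<mu> a = \<mu> b" "\<mu> (f a) = \<mu> c" using alike_mu tree_isoD(5)[OF iso] ab c by blast+
  have "f a = a \<or> E a (f a)" using guarded U(1) UV f by (auto simp: guarded_def)
  then have "\<exists>i\<le>L. (\<pi> ^^ i) a = f a \<or> (\<pi> ^^ i) (f a) = a"
  proof
    assume "f a = a"
    then show ?thesis by (intro exI[of _ 0]) simp
  qed (rule comparable[OF U(1,3)])
  then obtain i where i: "i \<le> L" "(\<pi> ^^ i) a = f a \<or> (\<pi> ^^ i) (f a) = a" by blast
  from i(2) show ?thesis
  proof
    assume *: "(\<pi> ^^ i) a = f a"
    then have "(\<pi> ^^ i) b = c"
      using tree_isoD(6)[OF iso tree_iso_ancestor[OF iso ab, of i] c] by simp
    then show ?thesis using encode_up[OF U(1,2) m(1) i(1) f] * by simp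
  next
    assume *: "(\<pi> ^^ i) (f a) = a"
    then have "(\<pi> ^^ i) c = b"
      using tree_isoD(6)[OF iso tree_iso_ancestor[OF iso c, of i] ab] by simp
    then show ?thesis using encode_down[OF U(3,4) m(2) i(1) f] * by simp
  qed
qed

text \<open>Extend \<open>\<Theta>\<close> to all terms of depth at most \<open>h\<close> over the
  left tuple with \<open>z\<close>. By \<open>tree_iso_function\<close> the partner of a term is the
  same term over the right tuple, so the matching contains the whole spread. The hypothesis on
  \<open>q\<close> pays \<open>L + 1\<close> pairs for each term.\<close>

lemma tree_iso_similar_extend:
  assumes iso: "tree_iso \<Theta>" and \<theta>: "\<theta> \<subseteq> \<Theta>" and z: "z \<in> U" and F: "finite F"
    and dom: "Domain ((spread F ^^ h) (insert (z, z) \<theta>)) \<subseteq> U"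
    and card: "card \<Theta> + Suc (card F) ^ h * Suc (card \<theta>) * (L + 1) \<le> q"
  shows "\<exists>z'\<in>U. similar E F l h (insert (z, z') \<theta>)"
proof -
  let ?Y = "Domain ((spread F ^^ h) (insert (z, z) \<theta>))"
  have fin: "finite \<theta>" using iso \<theta> by (auto simp: tree_iso_def intro: finite_subset)
  have sp: "finite ((spread F ^^ h) (insert (z, z) \<theta>))"
    "card ((spread F ^^ h) (insert (z, z) \<theta>)) \<le> Suc (card F) ^ h * card (insert (z, z) \<theta>)"
    using card_spread_pow[OF F, of "insert (z, z) \<theta>" h] fin by auto
  have "card ?Y \<le> card ((spread F ^^ h) (insert (z, z) \<theta>))"
    using sp(1) by (simp add: Domain_fst card_image_le)
  also have "\<dots> \<le> Suc (card F) ^ h * Suc (card \<theta>)"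
    using fin by (intro order_trans[OF sp(2)] mult_le_mono2) (simp add: card_insert_if)
  finally have "card ?Y * (L + 1) \<le> Suc (card F) ^ h * Suc (card \<theta>) * (L + 1)"
    by (rule mult_le_mono1)
  then have cy: "card \<Theta> + card ?Y * (L + 1) \<le> q" using card by linarith
  have "finite ?Y" using sp(1) by (simp add: finite_Domain)
  then obtain \<Theta>' where \<Theta>': "\<Theta> \<subseteq> \<Theta>'" "tree_iso \<Theta>'" "?Y \<subseteq> Domain \<Theta>'"
    using tree_iso_extend_set[OF _ dom iso cy] by blast
  have "z \<in> ?Y" using spread_pow_increasing[of 0 h F "insert (z, z) \<theta>"] by auto
  then obtain z' where z': "(z, z') \<in> \<Theta>'" using \<Theta>'(3) by blast
  let ?\<theta> = "insert (z, z') \<theta>"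
  have D: "Domain ((spread F ^^ i) ?\<theta>) \<subseteq> Domain \<Theta>'" if "i \<le> h" for i
  proof -
    have "Domain ((spread F ^^ i) ?\<theta>) \<subseteq> Domain ((spread F ^^ h) ?\<theta>)"
      by (rule Domain_mono[OF spread_pow_increasing[OF that]])
    also have "\<dots> = ?Y" by (rule Domain_spread_cong) auto
    finally show ?thesis using \<Theta>'(3) by simp
  qed
  have "(spread F ^^ i) ?\<theta> \<subseteq> \<Theta>'" if "i \<le> h" for i
    using that
  proof (induction i)
    case 0
    then show ?case using z' \<theta> \<Theta>'(1) by auto
  next
    case (Suc i)
    have "(f a, f b) \<in> \<Theta>'" if "f \<in> F" "(a, b) \<in> (spread F ^^ i) ?\<theta>" for f a b
    proof -
      have ab: "(a, b) \<in> \<Theta>'" using Suc that by auto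
      have "(f a, f b) \<in> (spread F ^^ Suc i) ?\<theta>" using that by (force simp: spread_def)
      then obtain c where c: "(f a, c) \<in> \<Theta>'" using D[OF Suc.prems] by blast
      then show ?thesis using tree_iso_function[OF \<Theta>'(2) ab c that(1)] by simp
    qed
    then have "spread F ((spread F ^^ i) ?\<theta>) \<subseteq> \<Theta>'"
      using Suc.IH Suc.prems unfolding spread_def by fastforce
    then show ?case by simp
  qed
  from partial_iso_mono[OF this[OF le_refl] tree_iso_partial_iso[OF \<Theta>'(2)]]
  have "similar E F l h ?\<theta>" by (simp add: similar_def)
  then show ?thesis using tree_isoD(2)[OF \<Theta>'(2) z'] by blast
qed

end

section \<open>Back and forth\<close>

context labelled_forest begin

lemma depth_ancestor: "v \<in> U \<Longrightarrow> depth ((\<pi> ^^ i) v) = depth v - i"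
proof (induction i)
  case (Suc i)
  show ?case
  proof (cases "\<pi> ((\<pi> ^^ i) v) = (\<pi> ^^ i) v")
    case True
    then show ?thesis using Suc depth_root[OF True] by simp
  next
    case False
    then show ?thesis using Suc depth_parent[OF ancestor_in[OF Suc.prems] False] by simp
  qed
qed simp

lemma ancestor_min: "v \<in> U \<Longrightarrow> (\<pi> ^^ i) v = (\<pi> ^^ min i (depth v)) v"
  using funpow_stable[of \<pi> "depth v" v i] depth_fixed[of v] by (auto simp: min_def)

end

text \<open>Equality of \<open>T\<close> replaces \<open>alike\<close>, and the property is freed
  from the locale, because the back-and-forth argument handles many forests on one graph and keeps
  only their labels.\<close>

definition type_labelling ::
  "('a \<Rightarrow> 'a \<Rightarrow> bool) \<Rightarrow> 'a set \<Rightarrow> nat \<Rightarrow> ('a \<Rightarrow> 'a) \<Rightarrow> ('a \<Rightarrow> 'a) set \<Rightarrow> ('a \<Rightarrow> nat) \<Rightarrow> nat \<Rightarrow> nat \<Rightarrow>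
    ('a \<Rightarrow> nat) \<Rightarrow> bool" where
  "type_labelling E U L \<pi> F l h q T \<longleftrightarrow>
    (\<forall>a\<in>U. \<forall>b\<in>U. T a = T b \<longrightarrow> labelled_forest.depth \<pi> a = labelled_forest.depth \<pi> b) \<and>
    (\<forall>\<Theta> \<theta> z. finite \<Theta> \<longrightarrow> \<Theta> \<subseteq> U \<times> U \<longrightarrow>
       (\<forall>(a, b)\<in>\<Theta>. (\<pi> a, \<pi> b) \<in> \<Theta> \<and> T a = T b \<and> (\<forall>(a', b')\<in>\<Theta>. a = a' \<longleftrightarrow> b = b')) \<longrightarrow>
       \<theta> \<subseteq> \<Theta> \<longrightarrow> z \<in> U \<longrightarrow> Domain ((spread F ^^ h) (insert (z, z) \<theta>)) \<subseteq> U \<longrightarrow>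
       card \<Theta> + Suc (card F) ^ h * Suc (card \<theta>) * (L + 1) \<le> q \<longrightarrow>
       (\<exists>z'\<in>U. similar E F l h (insert (z, z') \<theta>)))"

text \<open>The argument of \<open>type_bound\<close> counts the labels \<open>\<mu>\<close>: an old
  label, the set of levels of adjacent ancestors, and two sets of pairs of a function and a number
  of levels, one for each direction. Outside, the factor and the sum account for the depth and for
  the type of the remaining height.\<close>

definition label_bound :: "nat \<Rightarrow> nat \<Rightarrow> nat \<Rightarrow> nat \<Rightarrow> nat" where
  "label_bound q L m n = Suc L *
     (\<Sum>i\<le>L. type_bound q (n * (2 ^ Suc L * (2 ^ (m * Suc L) * 2 ^ (m * Suc L)))) i)"

lemma type_labelling_exists:
  assumes U: "finite U" "U \<subseteq> V" and sym: "\<And>a b. E a b \<Longrightarrow> E b a"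
    and forest: "elimination_forest E U L \<pi>"
    and F: "guarded E V F" "finite F" "card F \<le> m" and l: "\<forall>v\<in>V. l v < n"
  shows "\<exists>T. (\<forall>v\<in>U. T v < label_bound q L m n) \<and> type_labelling E U L \<pi> F l h q T"
proof -
  let ?g = "\<lambda>v. (l v, {i\<in>{..L}. E v ((\<pi> ^^ i) v)},
    {(f, i)\<in>F \<times> {..L}. f v = (\<pi> ^^ i) v}, {(f, i)\<in>F \<times> {..L}. f ((\<pi> ^^ i) v) = v})"
  let ?A = "{..<n} \<times> Pow {..L} \<times> Pow (F \<times> {..L}) \<times> Pow (F \<times> {..L})"
  let ?n = "n * (2 ^ Suc L * (2 ^ (m * Suc L) * 2 ^ (m * Suc L)))"
  have fA: "finite ?A" using F(2) by simp
  have "card ?A = n * (2 ^ Suc L * (2 ^ (card F * Suc L) * 2 ^ (card F * Suc L)))"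
    using F(2) by (simp add: card_cartesian_product card_Pow del: power_Suc)
  also have "\<dots> \<le> ?n"
    by (intro mult_le_mono power_increasing mult_le_mono1 F(3)) auto
  finally have cA: "card ?A \<le> ?n" .
  have gA: "\<forall>v\<in>U. ?g v \<in> ?A" using l U(2) by auto
  obtain \<mu> where \<mu>: "\<forall>v\<in>U. \<mu> v < ?n" "\<forall>v\<in>U. \<forall>w\<in>U. \<mu> v = \<mu> w \<longleftrightarrow> ?g v = ?g w"
    using relabel[where V = U and g = ?g, OF fA cA gA] by (elim exE conjE)
  have \<mu>D: "l a = l b" "{i\<in>{..L}. E a ((\<pi> ^^ i) a)} = {i\<in>{..L}. E b ((\<pi> ^^ i) b)}"
    "{(f, i)\<in>F \<times> {..L}. f a = (\<pi> ^^ i) a} = {(f, i)\<in>F \<times> {..L}. f b = (\<pi> ^^ i) b}"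
    "{(f, i)\<in>F \<times> {..L}. f ((\<pi> ^^ i) a) = a} = {(f, i)\<in>F \<times> {..L}. f ((\<pi> ^^ i) b) = b}"
    if "a \<in> U" "b \<in> U" "\<mu> a = \<mu> b" for a b
  proof -
    have "?g a = ?g b" using \<mu>(2) that by blast
    then show "l a = l b" "{i\<in>{..L}. E a ((\<pi> ^^ i) a)} = {i\<in>{..L}. E b ((\<pi> ^^ i) b)}"
    "{(f, i)\<in>F \<times> {..L}. f a = (\<pi> ^^ i) a} = {(f, i)\<in>F \<times> {..L}. f b = (\<pi> ^^ i) b}"
    "{(f, i)\<in>F \<times> {..L}. f ((\<pi> ^^ i) a) = a} = {(f, i)\<in>F \<times> {..L}. f ((\<pi> ^^ i) b) = b}"
      by (simp_all only: prod.inject)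
  qed
  interpret encoding_forest E U L \<pi> \<mu> q F l V
  proof
    fix a b i assume ab: "a \<in> U" "b \<in> U" "\<mu> a = \<mu> b" and i: "i \<le> L"
    show "E a ((\<pi> ^^ i) a) \<longleftrightarrow> E b ((\<pi> ^^ i) b)"
      using \<mu>D(2)[OF ab] i by blast
    fix f assume f: "f \<in> F"
    show "f a = (\<pi> ^^ i) a \<longleftrightarrow> f b = (\<pi> ^^ i) b" using \<mu>D(3)[OF ab] f i by blast
    show "f ((\<pi> ^^ i) a) = a \<longleftrightarrow> f ((\<pi> ^^ i) b) = b" using \<mu>D(4)[OF ab] f i by blast
  qed (fact U sym forest F(1) \<mu>D(1))+
  have "\<exists>l :: 'a \<Rightarrow> nat. (\<forall>v\<in>U. l v < type_bound q ?n i) \<and> (\<forall>a\<in>U. \<forall>b\<in>U. l a = l b \<longleftrightarrow> alike i a b)" for i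
    by (rule alike_label) (use \<mu>(1) in blast)
  then obtain lab :: "nat \<Rightarrow> 'a \<Rightarrow> nat" where
    lab: "\<And>i v. v \<in> U \<Longrightarrow> lab i v < type_bound q ?n i"
      "\<And>i a b. a \<in> U \<Longrightarrow> b \<in> U \<Longrightarrow> lab i a = lab i b \<longleftrightarrow> alike i a b" by metis
  let ?t = "\<lambda>v. (depth v, lab (L - depth v) v)"
  let ?B = "{..L} \<times> {..<\<Sum>i\<le>L. type_bound q ?n i}"
  have fB: "finite ?B" and cB: "card ?B \<le> label_bound q L m n"
    unfolding label_bound_def by (simp_all only: card_cartesian_product finite_cartesian_product
        finite_atMost finite_lessThan card_atMost card_lessThan le_refl)
  have tB: "\<forall>v\<in>U. ?t v \<in> ?B"
  proof
    fix v assume v: "v \<in> U"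
    have "type_bound q ?n (L - depth v) \<le> (\<Sum>i\<le>L. type_bound q ?n i)"
      by (rule member_le_sum) auto
    then show "?t v \<in> ?B" using lab(1)[OF v, of "L - depth v"] depth_le[OF v]
      by (simp del: type_bound.simps)
  qed
  obtain T where T: "\<forall>v\<in>U. T v < label_bound q L m n" "\<forall>v\<in>U. \<forall>w\<in>U. T v = T w \<longleftrightarrow> ?t v = ?t w"
    using relabel[where V = U and g = ?t, OF fB cB tB] by (elim exE conjE)
  have "type_labelling E U L \<pi> F l h q T"
    unfolding type_labelling_def
  proof (intro conjI allI impI ballI)
    fix \<Theta> \<theta> z
    assume \<Theta>: "finite \<Theta>" "\<Theta> \<subseteq> U \<times> U"
      "\<forall>(a, b)\<in>\<Theta>. (\<pi> a, \<pi> b) \<in> \<Theta> \<and> T a = T b \<and> (\<forall>(a', b')\<in>\<Theta>. a = a' \<longleftrightarrow> b = b')"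
      and rest: "\<theta> \<subseteq> \<Theta>" "z \<in> U" "Domain ((spread F ^^ h) (insert (z, z) \<theta>)) \<subseteq> U"
       "card \<Theta> + Suc (card F) ^ h * Suc (card \<theta>) * (L + 1) \<le> q"
    have "depth a = depth b \<and> alike (L - depth a) a b" if "(a, b) \<in> \<Theta>" for a b
    proof -
      have ab: "a \<in> U" "b \<in> U" "T a = T b" using that \<Theta> by auto
      then have "?t a = ?t b" using T(2) by blast
      then have d: "depth a = depth b" and e: "lab (L - depth a) a = lab (L - depth b) b"
        unfolding prod.inject by blast+
      have "alike (L - depth a) a b"
        unfolding lab(2)[OF ab(1,2), symmetric] using e by (simp only: d)
      then show ?thesis using d by blast
    qed
    then have "tree_iso \<Theta>" using \<Theta> unfolding tree_iso_def by fast
    from tree_iso_similar_extend[OF this rest(1,2) F(2) rest(3,4)]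
    show "\<exists>z'\<in>U. similar E F l h (insert (z, z') \<theta>)" .
  next
    fix a b assume "a \<in> U" "b \<in> U" "T a = T b"
    then have "?t a = ?t b" using T(2) by blast
    then show "depth a = depth b" by simp
  qed
  then show ?thesis using T(1) by blast
qed

lemma forest_family:
  assumes G: "simple_graph G" and \<chi>: "path_coloring G p N \<chi>"
    and F: "guarded (adj G) (verts G) F" "finite F" "card F \<le> m" and l: "\<forall>v\<in>verts G. l v < n"
  shows "\<exists>\<pi> T. \<forall>I. I \<subseteq> {..<N} \<longrightarrow> card I \<le> p \<longrightarrow>
    elimination_forest (adj G) {v\<in>verts G. \<chi> v \<in> I} (2 ^ p) (\<pi> I) \<and>
    (\<forall>v. v \<notin> {v\<in>verts G. \<chi> v \<in> I} \<longrightarrow> \<pi> I v = v) \<and>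
    (\<forall>v\<in>{v\<in>verts G. \<chi> v \<in> I}. T I v < label_bound q (2 ^ p) m n) \<and>
    type_labelling (adj G) {v\<in>verts G. \<chi> v \<in> I} (2 ^ p) (\<pi> I) F l h q (T I)"
    (is "\<exists>\<pi> T. \<forall>I. I \<subseteq> {..<N} \<longrightarrow> card I \<le> p \<longrightarrow> ?P I (\<pi> I) (T I)")
proof -
  let ?U = "\<lambda>I. {v\<in>verts G. \<chi> v \<in> I}"
  have "\<exists>\<pi> T. ?P I \<pi> T" if I: "I \<subseteq> {..<N}" "card I \<le> p" for I
  proof -
    have "finite I" using I(1) finite_subset by blast
    from elimination_forest_exists[OF G \<chi> this I(2)] obtain \<pi> where
      \<pi>: "elimination_forest (adj G) (?U I) (2 ^ p) \<pi>" "\<forall>v. v \<notin> ?U I \<longrightarrow> \<pi> v = v" by (elim exE conjE)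
    have "finite (?U I)" "?U I \<subseteq> verts G" using simple_graph_finite[OF G] by auto
    then have "\<exists>T. (\<forall>v\<in>?U I. T v < label_bound q (2 ^ p) m n) \<and>
        type_labelling (adj G) (?U I) (2 ^ p) \<pi> F l h q T"
      by (rule type_labelling_exists[OF _ _ simple_graph_sym[OF G] \<pi>(1) F l])
    then show ?thesis using \<pi> by blast
  qed
  then have "\<forall>I. \<exists>\<pi> T. I \<subseteq> {..<N} \<longrightarrow> card I \<le> p \<longrightarrow> ?P I \<pi> T" by auto
  then show ?thesis by (simp only: choice_iff)
qed

text \<open>The terms over \<open>\<theta>\<close> and \<open>z\<close> have at most
  \<open>p\<close> colors, so they lie in one forest. The ancestors there of terms over
  \<open>\<theta>\<close> are terms in \<open>F'\<close> of depth at most \<open>h + 2 ^ p\<close>;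
  similarity of \<open>\<theta>\<close> thus matches them with equal types, and the types supply a
  partner for \<open>z\<close>. The summands of \<open>q\<close> bound these ancestors and the pairs
  added for terms over \<open>\<theta>\<close> and \<open>z\<close>.\<close>

lemma back_and_forth_step:
  assumes G: "simple_graph G" and \<chi>: "path_coloring G p N \<chi>"
    and F: "guarded (adj G) (verts G) F" "finite F" "card F \<le> m" and l: "\<forall>v\<in>verts G. l v < n"
    and p: "Suc m ^ h * Suc k \<le> p" and q: "q = (2 ^ p + 1) * (Suc m ^ h * k) + Suc m ^ h * Suc k * (2 ^ p + 1)"
  shows "\<exists>F' l'. finite F' \<and> card F' \<le> m + 2 ^ N \<and> guarded (adj G) (verts G) F' \<and>
    (\<forall>v\<in>verts G. l' v < N * Suc (label_bound q (2 ^ p) m n) ^ (2 ^ N)) \<and>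
    (\<forall>\<theta> z. \<theta> \<subseteq> verts G \<times> verts G \<longrightarrow> finite \<theta> \<longrightarrow> card \<theta> \<le> k \<longrightarrow> z \<in> verts G \<longrightarrow>
       similar (adj G) F' l' (h + 2 ^ p) \<theta> \<longrightarrow>
       (\<exists>z'\<in>verts G. similar (adj G) F l h (insert (z, z') \<theta>)))"
proof -
  let ?V = "verts G" and ?E = "adj G" and ?L = "2 ^ p :: nat"
  let ?U = "\<lambda>I. {v\<in>?V. \<chi> v \<in> I}" and ?b = "label_bound q ?L m n"
  obtain \<pi> T where \<pi>T: "\<forall>I. I \<subseteq> {..<N} \<longrightarrow> card I \<le> p \<longrightarrow> elimination_forest ?E (?U I) ?L (\<pi> I) \<and>
      (\<forall>v. v \<notin> ?U I \<longrightarrow> \<pi> I v = v) \<and> (\<forall>v\<in>?U I. T I v < ?b) \<and>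
      type_labelling ?E (?U I) ?L (\<pi> I) F l h q (T I)"
    using forest_family[OF G \<chi> F l, where h = h and q = q] by (elim exE)
  have ef: "elimination_forest ?E (?U I) ?L (\<pi> I)" and out: "\<forall>v. v \<notin> ?U I \<longrightarrow> \<pi> I v = v"
    and Tb: "\<forall>v\<in>?U I. T I v < ?b" and tl: "type_labelling ?E (?U I) ?L (\<pi> I) F l h q (T I)"
    if "I \<subseteq> {..<N}" "card I \<le> p" for I using \<pi>T that by simp_all
  let ?\<I> = "{I\<in>Pow {..<N}. card I \<le> p}"
  let ?F = "F \<union> \<pi> ` ?\<I>"
  have fI: "finite ?\<I>" by simp
  have "card (\<pi> ` ?\<I>) \<le> card ?\<I>" by (rule card_image_le[OF fI])
  also have "\<dots> \<le> card (Pow {..<N})" by (intro card_mono) auto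
  finally have "card (\<pi> ` ?\<I>) \<le> 2 ^ N" by (simp add: card_Pow)
  then have cF: "card ?F \<le> m + 2 ^ N" using card_Un_le[of F "\<pi> ` ?\<I>"] F(3) by linarith
  have gF: "guarded ?E ?V ?F"
    unfolding guarded_def
  proof (intro ballI)
    fix f v assume f: "f \<in> ?F" and v: "v \<in> ?V"
    from f show "f v \<in> ?V \<and> (f v = v \<or> ?E v (f v))"
    proof
      assume "f \<in> \<pi> ` ?\<I>"
      then obtain I where I: "I \<subseteq> {..<N}" "card I \<le> p" "f = \<pi> I" by auto
      show ?thesis
      proof (cases "\<chi> v \<in> I")
        case True
        then have "v \<in> ?U I" using v by simp
        then show ?thesis using ef[OF I(1,2)] I(3) unfolding elimination_forest_def by auto
      qed (use out[OF I(1,2)] I(3) v in simp)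
    qed (use F(1) v in \<open>auto simp: guarded_def\<close>)
  qed
  \<comment> \<open>The default 0 stands where \<open>v\<close> lies in no forest for
    \<open>I\<close>; \<open>Suc ?b\<close> leaves room for it even if \<open>?b\<close> is 0. The
    color is included so that both sides of a pair lie in the same classes.\<close>
  let ?g = "\<lambda>v. (\<chi> v, \<lambda>I\<in>Pow {..<N}. if card I \<le> p \<and> \<chi> v \<in> I then T I v else 0)"
  let ?A = "{..<N} \<times> (Pow {..<N} \<rightarrow>\<^sub>E {..<Suc ?b})"
  have fA: "finite ?A" by (intro finite_cartesian_product finite_PiE) auto
  have cA: "card ?A \<le> N * Suc ?b ^ (2 ^ N)"
    by (simp add: card_cartesian_product card_PiE card_Pow)
  have gA: "\<forall>v\<in>?V. ?g v \<in> ?A"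
    using \<chi> Tb by (auto simp: path_coloring_def less_Suc_eq)
  obtain l' where l': "\<forall>v\<in>?V. l' v < N * Suc ?b ^ (2 ^ N)"
    "\<forall>v\<in>?V. \<forall>w\<in>?V. l' v = l' w \<longleftrightarrow> ?g v = ?g w"
    using relabel[where V = ?V and g = ?g, OF fA cA gA] by (elim exE conjE)
  have l'\<chi>: "\<chi> a = \<chi> b" if "a \<in> ?V" "b \<in> ?V" "l' a = l' b" for a b
  proof -
    have "?g a = ?g b" using l'(2) that by blast
    then show ?thesis by (simp only: prod.inject)
  qed
  have l'T: "T I a = T I b" if ab: "a \<in> ?V" "b \<in> ?V" "l' a = l' b" and I: "I \<subseteq> {..<N}" "card I \<le> p" "\<chi> a \<in> I"
    for a b I
  proof -
    have "?g a = ?g b" using l'(2) ab by blast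
    then have "snd (?g a) I = snd (?g b) I" by (simp only:)
    then show ?thesis using I l'\<chi>[OF ab] by simp
  qed
  have "\<exists>z'\<in>?V. similar ?E F l h (insert (z, z') \<theta>)"
    if \<theta>: "\<theta> \<subseteq> ?V \<times> ?V" "finite \<theta>" "card \<theta> \<le> k" and z: "z \<in> ?V"
      and sim: "similar ?E ?F l' (h + ?L) \<theta>" for \<theta> z
  proof -
    let ?Z = "(spread F ^^ h) (insert (z, z) \<theta>)"
    define I where "I = \<chi> ` Domain ?Z"
    have ZV: "?Z \<subseteq> ?V \<times> ?V" by (rule spread_pow_subset[OF F(1)]) (use \<theta> z in auto)
    have Z: "finite ?Z" "card ?Z \<le> Suc (card F) ^ h * card (insert (z, z) \<theta>)"
      using card_spread_pow[OF F(2), of "insert (z, z) \<theta>" h] \<theta>(2) by auto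
    have IN: "I \<subseteq> {..<N}" using \<chi> ZV unfolding I_def path_coloring_def by force
    have "card I \<le> card ?Z"
      unfolding I_def Domain_fst image_image by (rule card_image_le[OF Z(1)])
    also have "\<dots> \<le> Suc (card F) ^ h * Suc (card \<theta>)"
      using \<theta>(2) by (intro order_trans[OF Z(2)] mult_le_mono2) (simp add: card_insert_if)
    also have "\<dots> \<le> Suc m ^ h * Suc k"
      using F(3) \<theta>(3) by (intro mult_le_mono power_mono) auto
    finally have Ip: "card I \<le> p" using p by simp
    let ?\<pi> = "\<pi> I"
    interpret labelled_forest ?E "?U I" ?L ?\<pi> "\<lambda>_. 0" 0
    proof
      show "finite (?U I)" using simple_graph_finite[OF G] by simp
    qed (fact simple_graph_sym[OF G] ef[OF IN Ip])+
    let ?C = "(spread F ^^ h) \<theta>"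
    \<comment> \<open>After \<open>?L\<close> steps every vertex is at its root, so stopping there
      still leaves \<open>\<Theta>\<close> closed under parents.\<close>
    define \<Theta> where "\<Theta> = (\<Union>i\<le>?L. map_prod (?\<pi> ^^ i) (?\<pi> ^^ i) ` ?C)"
    have "map_prod (?\<pi> ^^ i) (?\<pi> ^^ i) ` ?C \<subseteq> (spread ?F ^^ (i + h)) \<theta>" for i
    proof (induction i)
      case 0
      then show ?case using spread_pow_mono[of F ?F \<theta> \<theta> h] by (simp add: map_prod.id)
    next
      case (Suc i)
      have "map_prod (?\<pi> ^^ Suc i) (?\<pi> ^^ Suc i) ` ?C = map_prod ?\<pi> ?\<pi> ` map_prod (?\<pi> ^^ i) (?\<pi> ^^ i) ` ?C"
        by (simp add: image_image map_prod_def case_prod_beta)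
      also have "\<dots> \<subseteq> map_prod ?\<pi> ?\<pi> ` (spread ?F ^^ (i + h)) \<theta>" by (rule image_mono[OF Suc])
      also have "\<dots> \<subseteq> spread ?F ((spread ?F ^^ (i + h)) \<theta>)"
        using IN Ip unfolding spread_def by blast
      finally show ?case by (simp add: comp_def)
    qed
    moreover have "(spread ?F ^^ (i + h)) \<theta> \<subseteq> (spread ?F ^^ (h + ?L)) \<theta>" if "i \<le> ?L" for i
      by (rule spread_pow_increasing) (use that in simp)
    ultimately have sub: "\<Theta> \<subseteq> (spread ?F ^^ (h + ?L)) \<theta>" unfolding \<Theta>_def by blast
    have \<Theta>V: "\<Theta> \<subseteq> ?V \<times> ?V" using sub spread_pow_subset[OF gF \<theta>(1)] by blast
    have iso: "partial_iso ?E l' \<Theta>" using partial_iso_mono[OF sub] sim by (simp add: similar_def)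
    have CZ: "?C \<subseteq> ?Z" by (rule spread_pow_mono) auto
    have CU: "a \<in> ?U I" if "(a, b) \<in> ?C" for a b
      using that CZ ZV unfolding I_def by blast
    have \<Theta>1: "a \<in> ?U I" if "(a, b) \<in> \<Theta>" for a b
      using that CU ancestor_in unfolding \<Theta>_def by fast
    have \<Theta>l: "l' a = l' b" if "(a, b) \<in> \<Theta>" for a b
      using iso that unfolding partial_iso_def by fast
    have \<Theta>2: "b \<in> ?U I" if "(a, b) \<in> \<Theta>" for a b
      using \<Theta>1[OF that] \<Theta>V that l'\<chi>[OF _ _ \<Theta>l[OF that]] by auto
    have "map_prod (?\<pi> ^^ 0) (?\<pi> ^^ 0) ` ?C \<subseteq> \<Theta>" unfolding \<Theta>_def by (rule UN_upper) simp
    then have C\<Theta>: "?C \<subseteq> \<Theta>" by (simp add: map_prod.id)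
    have closed: "(?\<pi> a, ?\<pi> b) \<in> \<Theta>" if ab: "(a, b) \<in> \<Theta>" for a b
    proof -
      obtain i c d where i: "i \<le> ?L" "(c, d) \<in> ?C" "a = (?\<pi> ^^ i) c" "b = (?\<pi> ^^ i) d"
        using ab unfolding \<Theta>_def by auto
      have cd: "c \<in> ?U I" "d \<in> ?U I" using \<Theta>1[of c d] \<Theta>2[of c d] i(2) C\<Theta> by blast+
      show ?thesis
      proof (cases "i = ?L")
        case True
        then have "?\<pi> a = a" "?\<pi> b = b" using top_fixed cd i by simp_all
        then show ?thesis using ab by simp
      next
        case False
        have "((?\<pi> ^^ Suc i) c, (?\<pi> ^^ Suc i) d) \<in> \<Theta>"
          unfolding \<Theta>_def by (rule UN_I[of "Suc i"]) (use False i(1,2) in force)+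
        then show ?thesis using i(3,4) by simp
      qed
    qed
    have C: "finite ?C" "card ?C \<le> Suc (card F) ^ h * card \<theta>"
      using card_spread_pow[OF F(2) \<theta>(2), of h] by auto
    have "card \<Theta> \<le> (\<Sum>i\<le>?L. card (map_prod (?\<pi> ^^ i) (?\<pi> ^^ i) ` ?C))"
      unfolding \<Theta>_def by (rule card_UN_le) simp
    also have "\<dots> \<le> (\<Sum>i\<le>?L. card ?C)" by (rule sum_mono) (rule card_image_le[OF C(1)])
    also have "\<dots> = (?L + 1) * card ?C" by simp
    also have "\<dots> \<le> (?L + 1) * (Suc (card F) ^ h * card \<theta>)" by (rule mult_le_mono2[OF C(2)])
    also have "\<dots> \<le> (?L + 1) * (Suc m ^ h * k)"
      using F(3) \<theta>(3) by (intro mult_le_mono power_mono) auto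
    finally have c1: "card \<Theta> \<le> (?L + 1) * (Suc m ^ h * k)" .
    have "Suc (card F) ^ h * Suc (card \<theta>) * (?L + 1) \<le> Suc m ^ h * Suc k * (?L + 1)"
      using F(3) \<theta>(3) by (intro mult_le_mono power_mono) auto
    then have card: "card \<Theta> + Suc (card F) ^ h * Suc (card \<theta>) * (?L + 1) \<le> q"
      using c1 q by linarith
    have fin: "finite \<Theta>" unfolding \<Theta>_def using C(1) by simp
    have \<Theta>U: "\<Theta> \<subseteq> ?U I \<times> ?U I" using \<Theta>1 \<Theta>2 by auto
    have cond: "\<forall>(a, b)\<in>\<Theta>. (?\<pi> a, ?\<pi> b) \<in> \<Theta> \<and> T I a = T I b \<and> (\<forall>(a', b')\<in>\<Theta>. a = a' \<longleftrightarrow> b = b')"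
    proof (rule ballI)
      fix e assume e: "e \<in> \<Theta>"
      obtain a b where ab: "e = (a, b)" by (cases e)
      have ab': "(a, b) \<in> \<Theta>" using e ab by simp
      have "T I a = T I b"
        using l'T[OF _ _ \<Theta>l[OF ab'] IN Ip] \<Theta>1[OF ab'] \<Theta>2[OF ab'] by simp
      moreover have "\<forall>(a', b')\<in>\<Theta>. a = a' \<longleftrightarrow> b = b'"
        using iso ab' unfolding partial_iso_def by fast
      ultimately show "case e of (a, b) \<Rightarrow> (?\<pi> a, ?\<pi> b) \<in> \<Theta> \<and> T I a = T I b \<and>
          (\<forall>(a', b')\<in>\<Theta>. a = a' \<longleftrightarrow> b = b')"
        using closed[OF ab'] ab by simp
    qed
    have "\<theta> \<subseteq> ?C" using spread_pow_increasing[of 0 h F \<theta>] by simp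
    then have \<theta>\<Theta>: "\<theta> \<subseteq> \<Theta>" using C\<Theta> by blast
    have dom: "Domain ?Z \<subseteq> ?U I" using ZV unfolding I_def by blast
    have zU: "z \<in> ?U I" using dom spread_pow_increasing[of 0 h F "insert (z, z) \<theta>"] by auto
    have "\<exists>z'\<in>?U I. similar ?E F l h (insert (z, z') \<theta>)"
      using conjunct2[OF tl[OF IN Ip, unfolded type_labelling_def]] fin \<Theta>U cond \<theta>\<Theta> zU dom card
      by (elim allE impE)
    then show ?thesis by blast
  qed
  then show ?thesis
    using F(2) fI cF gF l'(1) by (intro exI[of _ ?F] exI[of _ l'] conjI allI impI) auto
qed

section \<open>Definable relations\<close>

text \<open>Bound variables count as well: a quantifier then overwrites one of the first
  \<open>k\<close> coordinates, and one \<open>k\<close> serves all subformulas.\<close>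

primrec var_bound :: "fo \<Rightarrow> nat" where
  "var_bound (FEq x y) = Suc (max x y)"
| "var_bound (FAdj x y) = Suc (max x y)"
| "var_bound (FPred P x) = Suc x"
| "var_bound (FNot \<phi>) = var_bound \<phi>"
| "var_bound (FAnd \<phi> \<psi>) = max (var_bound \<phi>) (var_bound \<psi>)"
| "var_bound (FEx x \<phi>) = max (Suc x) (var_bound \<phi>)"

section \<open>Quantifier elimination\<close>

definition assignment_pairs :: "nat \<Rightarrow> (nat \<Rightarrow> 'a) \<Rightarrow> (nat \<Rightarrow> 'a) \<Rightarrow> ('a \<times> 'a) set" where
  "assignment_pairs k s s' = (\<lambda>x. (s x, s' x)) ` {..<k}"

definition determines ::
  "'a graph \<Rightarrow> (nat \<Rightarrow> 'a set) \<Rightarrow> nat \<Rightarrow> fo \<Rightarrow> ('a \<Rightarrow> 'a) set \<Rightarrow> ('a \<Rightarrow> nat) \<Rightarrow> nat \<Rightarrow> bool" where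
  "determines G I k \<phi> F l h \<longleftrightarrow> (\<forall>s s'. range s \<subseteq> verts G \<longrightarrow> range s' \<subseteq> verts G \<longrightarrow>
     similar (adj G) F l h (assignment_pairs k s s') \<longrightarrow> (sat G I s \<phi> \<longleftrightarrow> sat G I s' \<phi>))"

lemma assignment_pairs_converse: "(assignment_pairs k s s')\<inverse> = assignment_pairs k s' s"
  by (auto simp: assignment_pairs_def)

lemma assignment_pairs_bounds:
  assumes "range s \<subseteq> V" "range s' \<subseteq> V"
  shows "assignment_pairs k s s' \<subseteq> V \<times> V" "finite (assignment_pairs k s s')"
    "card (assignment_pairs k s s') \<le> k"
proof -
  have "card (assignment_pairs k s s') \<le> card {..<k}"
    unfolding assignment_pairs_def by (rule card_image_le) simp
  then show "card (assignment_pairs k s s') \<le> k" by simp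
qed (use assms in \<open>auto simp: assignment_pairs_def\<close>)

lemma assignment_pairs_upd:
  "assignment_pairs k (s(x := a)) (s'(x := a')) \<subseteq> insert (a, a') (assignment_pairs k s s')"
  by (auto simp: assignment_pairs_def)

lemma similar_refine:
  assumes "similar E F' l' h' \<theta>" "F \<subseteq> F'" "h \<le> h'" "\<theta> \<subseteq> V \<times> V" "guarded E V F'"
    and "\<And>a b. a \<in> V \<Longrightarrow> b \<in> V \<Longrightarrow> l' a = l' b \<Longrightarrow> l a = l b"
  shows "similar E F l h \<theta>"
  by (rule similar_mono[OF assms(1-3) subset_refl assms(4,5)]) (rule assms(6))

lemma similar_subset: "similar E F l h \<theta> \<Longrightarrow> \<theta>' \<subseteq> \<theta> \<Longrightarrow> similar E F l h \<theta>'"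
  unfolding similar_def by (rule partial_iso_mono[OF spread_pow_mono[OF subset_refl]])

lemma similar_0: "similar E {} l 0 \<theta> \<longleftrightarrow> partial_iso E l \<theta>"
  by (simp add: similar_def)

lemma quantifier_free_determined:
  fixes \<C> :: "'a graph set"
  assumes "\<And>(G :: 'a graph) I. \<exists>l. (\<forall>v. l v < n) \<and> determines G I k \<phi> {} l 0"
  shows "\<exists>m n h. \<forall>G\<in>\<C>. \<forall>I. \<exists>F l. finite F \<and> card F \<le> m \<and> guarded (adj G) (verts G) F \<and>
    (\<forall>v\<in>verts G. l v < n) \<and> determines G I k \<phi> F l h"
proof (rule exI[of _ 0], rule exI[of _ n], rule exI[of _ 0], intro ballI allI)
  fix G :: "'a graph" and I
  obtain l where "\<forall>v. l v < n" "determines G I k \<phi> {} l 0" using assms by blast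
  then show "\<exists>F l. finite F \<and> card F \<le> 0 \<and> guarded (adj G) (verts G) F \<and>
    (\<forall>v\<in>verts G. l v < n) \<and> determines G I k \<phi> F l 0"
    by (intro exI[of _ "{}"] exI[of _ l]) (simp add: guarded_def)
qed

text \<open>The bounds are uniform: they are chosen before \<open>G\<close> and \<open>I\<close>.
  Atoms need no functions and a conjunction combines the data of its parts; sparsity enters only at
  a quantifier.\<close>

lemma formula_determined:
  fixes \<C> :: "nat graph set"
  assumes C: "graph_class \<C>" "bounded_expansion \<C>" and k: "var_bound \<phi> \<le> k"
  shows "\<exists>m n h. \<forall>G\<in>\<C>. \<forall>I. \<exists>F l. finite F \<and> card F \<le> m \<and> guarded (adj G) (verts G) F \<and>
    (\<forall>v\<in>verts G. l v < n) \<and> determines G I k \<phi> F l h"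
  using k
proof (induction \<phi>)
  case (FEq x y)
  have "determines G I k (FEq x y) {} (\<lambda>_. 0) 0" for G :: "nat graph" and I
    unfolding determines_def similar_0
  proof (intro allI impI)
    fix s s' assume "partial_iso (adj G) (\<lambda>_. 0) (assignment_pairs k s s')"
    moreover have "(s x, s' x) \<in> assignment_pairs k s s'" "(s y, s' y) \<in> assignment_pairs k s s'"
      using FEq by (auto simp: assignment_pairs_def)
    ultimately show "sat G I s (FEq x y) \<longleftrightarrow> sat G I s' (FEq x y)"
      unfolding partial_iso_def by fastforce
  qed
  then show ?case by (intro quantifier_free_determined[of 1] exI[of _ "\<lambda>_. 0"]) auto
next
  case (FAdj x y)
  have "determines G I k (FAdj x y) {} (\<lambda>_. 0) 0" for G :: "nat graph" and I
    unfolding determines_def similar_0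
  proof (intro allI impI)
    fix s s' assume "partial_iso (adj G) (\<lambda>_. 0) (assignment_pairs k s s')"
    moreover have "(s x, s' x) \<in> assignment_pairs k s s'" "(s y, s' y) \<in> assignment_pairs k s s'"
      using FAdj by (auto simp: assignment_pairs_def)
    ultimately show "sat G I s (FAdj x y) \<longleftrightarrow> sat G I s' (FAdj x y)"
      unfolding partial_iso_def by fastforce
  qed
  then show ?case by (intro quantifier_free_determined[of 1] exI[of _ "\<lambda>_. 0"]) auto
next
  case (FPred P x)
  have "determines G I k (FPred P x) {} (\<lambda>v. if v \<in> I P then 1 else 0) 0" for G :: "nat graph" and I
    unfolding determines_def similar_0
  proof (intro allI impI)
    fix s s' assume "partial_iso (adj G) (\<lambda>v. if v \<in> I P then 1 else 0) (assignment_pairs k s s')"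
    moreover have "(s x, s' x) \<in> assignment_pairs k s s'"
      using FPred by (auto simp: assignment_pairs_def)
    ultimately have "(if s x \<in> I P then 1 else 0 :: nat) = (if s' x \<in> I P then 1 else 0)"
      unfolding partial_iso_def by blast
    then show "sat G I s (FPred P x) \<longleftrightarrow> sat G I s' (FPred P x)"
      by (simp split: if_splits)
  qed
  then show ?case
    by (intro quantifier_free_determined[of 2] exI[of _ "\<lambda>v. if v \<in> I P then 1 else 0" for I]) auto
next
  case (FNot \<phi>)
  have "determines G I k (FNot \<phi>) F l h \<longleftrightarrow> determines G I k \<phi> F l h" for G :: "nat graph" and I F l h
    by (simp add: determines_def)
  then show ?case using FNot by simp
next
  case (FAnd \<phi> \<psi>)
  obtain m1 n1 h1 where 1: "\<forall>G\<in>\<C>. \<forall>I. \<exists>F l. finite F \<and> card F \<le> m1 \<and> guarded (adj G) (verts G) F \<and>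
    (\<forall>v\<in>verts G. l v < n1) \<and> determines G I k \<phi> F l h1"
    using FAnd.IH(1) FAnd.prems by auto
  obtain m2 n2 h2 where 2: "\<forall>G\<in>\<C>. \<forall>I. \<exists>F l. finite F \<and> card F \<le> m2 \<and> guarded (adj G) (verts G) F \<and>
    (\<forall>v\<in>verts G. l v < n2) \<and> determines G I k \<psi> F l h2"
    using FAnd.IH(2) FAnd.prems by auto
  show ?case
  proof (rule exI[of _ "m1 + m2"], rule exI[of _ "n1 * n2"], rule exI[of _ "max h1 h2"],
      intro ballI allI)
    fix G I assume G: "G \<in> \<C>"
    let ?V = "verts G"
    obtain F1 l1 where F1: "finite F1" "card F1 \<le> m1" "guarded (adj G) ?V F1"
      "\<forall>v\<in>?V. l1 v < n1" "determines G I k \<phi> F1 l1 h1"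
      using 1[rule_format, OF G, of I] by (elim exE conjE)
    obtain F2 l2 where F2: "finite F2" "card F2 \<le> m2" "guarded (adj G) ?V F2"
      "\<forall>v\<in>?V. l2 v < n2" "determines G I k \<psi> F2 l2 h2"
      using 2[rule_format, OF G, of I] by (elim exE conjE)
    have fA: "finite ({..<n1} \<times> {..<n2})" and cA: "card ({..<n1} \<times> {..<n2}) \<le> n1 * n2"
      and gA: "\<forall>v\<in>?V. (l1 v, l2 v) \<in> {..<n1} \<times> {..<n2}"
      using F1(4) F2(4) by (auto simp: card_cartesian_product)
    obtain l where l: "\<forall>v\<in>?V. l v < n1 * n2"
      "\<forall>v\<in>?V. \<forall>w\<in>?V. l v = l w \<longleftrightarrow> (l1 v, l2 v) = (l1 w, l2 w)"
      using relabel[where V = ?V and g = "\<lambda>v. (l1 v, l2 v)", OF fA cA gA] by (elim exE conjE)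
    have g: "guarded (adj G) ?V (F1 \<union> F2)" using F1(3) F2(3) unfolding guarded_def by blast
    have "determines G I k (FAnd \<phi> \<psi>) (F1 \<union> F2) l (max h1 h2)"
      unfolding determines_def
    proof (intro allI impI)
      fix s s' assume s: "range s \<subseteq> ?V" "range s' \<subseteq> ?V"
        and sim: "similar (adj G) (F1 \<union> F2) l (max h1 h2) (assignment_pairs k s s')"
      have "similar (adj G) F1 l1 h1 (assignment_pairs k s s')"
        by (rule similar_refine[OF sim _ _ assignment_pairs_bounds(1)[OF s] g]) (use l(2) in auto)
      moreover have "similar (adj G) F2 l2 h2 (assignment_pairs k s s')"
        by (rule similar_refine[OF sim _ _ assignment_pairs_bounds(1)[OF s] g]) (use l(2) in auto)
      ultimately show "sat G I s (FAnd \<phi> \<psi>) \<longleftrightarrow> sat G I s' (FAnd \<phi> \<psi>)"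
        using F1(5) F2(5) s unfolding determines_def by simp
    qed
    moreover have "card (F1 \<union> F2) \<le> m1 + m2" using card_Un_le[of F1 F2] F1(2) F2(2) by linarith
    ultimately show "\<exists>F l. finite F \<and> card F \<le> m1 + m2 \<and> guarded (adj G) ?V F \<and>
      (\<forall>v\<in>?V. l v < n1 * n2) \<and> determines G I k (FAnd \<phi> \<psi>) F l (max h1 h2)"
      using F1(1) F2(1) g l(1) by blast
  qed
next
  case (FEx x \<phi>)
  obtain m n h where IH: "\<forall>G\<in>\<C>. \<forall>I. \<exists>F l. finite F \<and> card F \<le> m \<and> guarded (adj G) (verts G) F \<and>
    (\<forall>v\<in>verts G. l v < n) \<and> determines G I k \<phi> F l h"
    using FEx by auto
  define p where "p = Suc m ^ h * Suc k"
  define q where "q = (2 ^ p + 1) * (Suc m ^ h * k) + Suc m ^ h * Suc k * (2 ^ p + 1)"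
  obtain N where N: "\<forall>G\<in>\<C>. \<exists>\<chi>. path_coloring G p N \<chi>"
    using bounded_expansion_path_coloring[OF C] by blast
  show ?case
  proof (rule exI[of _ "m + 2 ^ N"], rule exI[of _ "N * Suc (label_bound q (2 ^ p) m n) ^ (2 ^ N)"],
      rule exI[of _ "h + 2 ^ p"], intro ballI allI)
    fix G I assume G: "G \<in> \<C>"
    let ?V = "verts G"
    have sG: "simple_graph G" using C(1) G by (auto simp: graph_class_def)
    obtain \<chi> where \<chi>: "path_coloring G p N \<chi>" using N G by blast
    obtain F l where F: "finite F" "card F \<le> m" "guarded (adj G) ?V F"
      "\<forall>v\<in>?V. l v < n" "determines G I k \<phi> F l h"
      using IH[rule_format, OF G, of I] by (elim exE conjE)
    have "p \<ge> Suc m ^ h * Suc k" by (simp add: p_def)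
    from back_and_forth_step[OF sG \<chi> F(3,1,2,4) this q_def]
    obtain F' l' where F': "finite F'" "card F' \<le> m + 2 ^ N" "guarded (adj G) ?V F'"
      "\<forall>v\<in>?V. l' v < N * Suc (label_bound q (2 ^ p) m n) ^ (2 ^ N)"
      and step: "\<forall>\<theta> z. \<theta> \<subseteq> ?V \<times> ?V \<longrightarrow> finite \<theta> \<longrightarrow> card \<theta> \<le> k \<longrightarrow> z \<in> ?V \<longrightarrow>
        similar (adj G) F' l' (h + 2 ^ p) \<theta> \<longrightarrow>
        (\<exists>z'\<in>?V. similar (adj G) F l h (insert (z, z') \<theta>))"
      by (elim exE conjE)
    \<comment> \<open>One direction is enough, since similarity is invariant under exchanging the
      two sides.\<close>
    have half: "sat G I s' (FEx x \<phi>)"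
      if s: "range s \<subseteq> ?V" "range s' \<subseteq> ?V" and ex: "sat G I s (FEx x \<phi>)"
        and sim: "similar (adj G) F' l' (h + 2 ^ p) (assignment_pairs k s s')" for s s'
    proof -
      obtain a where a: "a \<in> ?V" "sat G I (s(x := a)) \<phi>" using ex by auto
      obtain a' where a': "a' \<in> ?V" "similar (adj G) F l h (insert (a, a') (assignment_pairs k s s'))"
        using step[rule_format, OF assignment_pairs_bounds[OF s] a(1) sim] by (elim bexE)
      have "similar (adj G) F l h (assignment_pairs k (s(x := a)) (s'(x := a')))"
        by (rule similar_subset[OF a'(2) assignment_pairs_upd])
      moreover have "range (s(x := a)) \<subseteq> ?V" "range (s'(x := a')) \<subseteq> ?V" using s a(1) a'(1) by auto
      ultimately have "sat G I (s'(x := a')) \<phi>" using F(5) a(2) unfolding determines_def by blast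
      then show ?thesis using a'(1) by auto
    qed
    have "determines G I k (FEx x \<phi>) F' l' (h + 2 ^ p)"
      unfolding determines_def
    proof (intro allI impI iffI)
      fix s s' assume s: "range s \<subseteq> ?V" "range s' \<subseteq> ?V"
        and sim: "similar (adj G) F' l' (h + 2 ^ p) (assignment_pairs k s s')"
      show "sat G I s' (FEx x \<phi>)" if "sat G I s (FEx x \<phi>)" by (rule half[OF s that sim])
      have "similar (adj G) F' l' (h + 2 ^ p) (assignment_pairs k s' s)"
        using similar_converse[OF sim] by (simp only: assignment_pairs_converse)
      then show "sat G I s (FEx x \<phi>)" if "sat G I s' (FEx x \<phi>)" using half[OF s(2,1) that] by blast
    qed
    then show "\<exists>F l. finite F \<and> card F \<le> m + 2 ^ N \<and> guarded (adj G) ?V F \<and>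
      (\<forall>v\<in>?V. l v < N * Suc (label_bound q (2 ^ p) m n) ^ (2 ^ N)) \<and>
      determines G I k (FEx x \<phi>) F l (h + 2 ^ p)"
      using F' by blast
  qed
qed

section \<open>Definable adjacency as a function of meeting levels\<close>

lemma spread_pow_Un: "(spread F ^^ h) (A \<union> B) = (spread F ^^ h) A \<union> (spread F ^^ h) B"
proof (induction h)
  case (Suc h)
  then show ?case by (simp add: spread_def image_Un UN_Un_distrib Un_ac)
qed simp

text \<open>At equal depth, ancestors can coincide only at equal level; \<open>min\<close> accounts
  for the repetition of the root. Hence all coincidences between two chains follow from those with
  equal exponents.\<close>

lemma (in labelled_forest) ancestor_eq_iff:
  assumes "x \<in> U" "y \<in> U" "depth x = depth y"
  shows "(\<pi> ^^ i) x = (\<pi> ^^ j) y \<longleftrightarrow>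
    min i (depth x) = min j (depth x) \<and> (\<pi> ^^ min i (depth x)) x = (\<pi> ^^ min i (depth x)) y"
proof
  assume eq: "(\<pi> ^^ i) x = (\<pi> ^^ j) y"
  then have "depth x - i = depth y - j"
    using depth_ancestor[OF assms(1), of i] depth_ancestor[OF assms(2), of j] by simp
  then have m: "min i (depth x) = min j (depth x)" using assms(3) by linarith
  have "(\<pi> ^^ min i (depth x)) x = (\<pi> ^^ i) x" by (rule ancestor_min[OF assms(1), symmetric])
  also have "\<dots> = (\<pi> ^^ min j (depth y)) y" unfolding eq by (rule ancestor_min[OF assms(2)])
  finally show "min i (depth x) = min j (depth x) \<and>
      (\<pi> ^^ min i (depth x)) x = (\<pi> ^^ min i (depth x)) y" using m assms(3) by simp
next
  assume "min i (depth x) = min j (depth x) \<and>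
      (\<pi> ^^ min i (depth x)) x = (\<pi> ^^ min i (depth x)) y"
  then have "(\<pi> ^^ min i (depth x)) x = (\<pi> ^^ min j (depth y)) y" using assms(3) by metis
  then show "(\<pi> ^^ i) x = (\<pi> ^^ j) y"
    using ancestor_min[OF assms(1), of i] ancestor_min[OF assms(2), of j] by simp
qed

text \<open>A class fixes the colors of the terms over a vertex and the types along its way to the
  root. So its vertices share one forest and one depth, and for two pairs meeting at the same
  levels, sending ancestors to ancestors meets the requirements of
  \<open>type_labelling\<close>.\<close>

lemma tree_partition:
  fixes \<C> :: "nat graph set"
  assumes C: "graph_class \<C>" "bounded_expansion \<C>"
  shows "\<exists>n L. \<forall>G\<in>\<C>. \<forall>P. \<exists>c :: nat \<Rightarrow> nat. (\<forall>v\<in>verts G. c v < n) \<and>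
    (\<forall>a. \<exists>\<pi> :: nat \<Rightarrow> nat. \<forall>u\<in>verts G. \<forall>v\<in>verts G. \<forall>u'\<in>verts G. \<forall>v'\<in>verts G.
       c u = a \<longrightarrow> c v = a \<longrightarrow> c u' = a \<longrightarrow> c v' = a \<longrightarrow>
       (\<forall>i\<le>L. (\<pi> ^^ i) u = (\<pi> ^^ i) v \<longleftrightarrow> (\<pi> ^^ i) u' = (\<pi> ^^ i) v') \<longrightarrow>
       (sat2 G P \<phi> u v \<longleftrightarrow> sat2 G P \<phi> u' v'))"
proof -
  define k where "k = max 2 (var_bound \<phi>)"
  obtain m n h where det: "\<forall>G\<in>\<C>. \<forall>I. \<exists>F l. finite F \<and> card F \<le> m \<and> guarded (adj G) (verts G) F \<and>
    (\<forall>v\<in>verts G. l v < n) \<and> determines G I k \<phi> F l h"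
    using formula_determined[OF C, of \<phi> k] unfolding k_def by auto
  \<comment> \<open>The terms over a single vertex suffice, because both vertices of a pair come
    from one class and have the same colors \<open>J\<close>.\<close>
  define p where "p = Suc m ^ h"
  define L :: nat where "L = 2 ^ p"
  \<comment> \<open>The first summand counts two chains of \<open>L + 1\<close> ancestors; the 3
    bounds \<open>Suc (card ?\<theta>)\<close> for the two pairs to be compared.\<close>
  define q where "q = 2 * (L + 1) + Suc m ^ h * 3 * (L + 1)"
  obtain N where N: "\<forall>G\<in>\<C>. \<exists>\<chi>. path_coloring G p N \<chi>"
    using bounded_expansion_path_coloring[OF C] by blast
  define b where "b = label_bound q L m n"
  show ?thesis
  proof (rule exI[of _ "2 ^ N * b ^ Suc L"], rule exI[of _ L], intro ballI allI)
    fix G P assume G: "G \<in> \<C>"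
    let ?V = "verts G" and ?E = "adj G"
    have sG: "simple_graph G" using C(1) G by (auto simp: graph_class_def)
    obtain \<chi> where \<chi>: "path_coloring G p N \<chi>" using N G by blast
    obtain F l where F: "finite F" "card F \<le> m" "guarded ?E ?V F"
      "\<forall>v\<in>?V. l v < n" "determines G P k \<phi> F l h"
      using det[rule_format, OF G, of P] by (elim exE conjE)
    let ?U = "\<lambda>I. {v\<in>?V. \<chi> v \<in> I}"
    obtain \<pi> T where \<pi>T: "\<forall>I. I \<subseteq> {..<N} \<longrightarrow> card I \<le> p \<longrightarrow> elimination_forest ?E (?U I) L (\<pi> I) \<and>
        (\<forall>v. v \<notin> ?U I \<longrightarrow> \<pi> I v = v) \<and> (\<forall>v\<in>?U I. T I v < b) \<and>
        type_labelling ?E (?U I) L (\<pi> I) F l h q (T I)"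
      using forest_family[OF sG \<chi> F(3,1,2,4), where h = h and q = q] unfolding L_def b_def
      by (elim exE)
    define J where "J v = \<chi> ` Domain ((spread F ^^ h) {(v, v)})" for v
    have DV: "Domain ((spread F ^^ h) {(v, v)}) \<subseteq> ?V" if "v \<in> ?V" for v
      using spread_pow_subset[OF F(3), of "{(v, v)}" h] that by auto
    have vD: "v \<in> Domain ((spread F ^^ h) {(v, v)})" for v
      using spread_pow_increasing[of 0 h F "{(v, v)}"] by auto
    have JN: "J v \<subseteq> {..<N}" if "v \<in> ?V" for v
      using DV[OF that] \<chi> unfolding J_def path_coloring_def by auto
    have Jp: "card (J v) \<le> p" for v
    proof -
      have s: "finite ((spread F ^^ h) {(v, v)})" "card ((spread F ^^ h) {(v, v)}) \<le> Suc (card F) ^ h"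
        using card_spread_pow[OF F(1), of "{(v, v)}" h] by auto
      have "card (J v) \<le> card ((spread F ^^ h) {(v, v)})"
        unfolding J_def Domain_fst image_image by (rule card_image_le[OF s(1)])
      also have "\<dots> \<le> Suc (card F) ^ h" by (rule s(2))
      also have "\<dots> \<le> p" unfolding p_def using F(2) by (intro power_mono) auto
      finally show ?thesis .
    qed
    have ef: "elimination_forest ?E (?U (J v)) L (\<pi> (J v))"
      and Tb: "\<forall>w\<in>?U (J v). T (J v) w < b"
      and tl: "type_labelling ?E (?U (J v)) L (\<pi> (J v)) F l h q (T (J v))" if "v \<in> ?V" for v
      using \<pi>T JN[OF that] Jp by simp_all
    have forest: "labelled_forest ?E (?U (J v)) L (\<pi> (J v))" if "v \<in> ?V" for v
    proof
      show "finite (?U (J v))" using simple_graph_finite[OF sG] by simp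
    qed (fact simple_graph_sym[OF sG] ef[OF that])+
    have JU: "v \<in> ?U (J v)" if "v \<in> ?V" for v using vD[of v] that by (simp add: J_def)
    let ?g = "\<lambda>v. (J v, \<lambda>i\<in>{..L}. T (J v) ((\<pi> (J v) ^^ i) v))"
    let ?A = "Pow {..<N} \<times> ({..L} \<rightarrow>\<^sub>E {..<b})"
    have fA: "finite ?A" by (intro finite_cartesian_product finite_PiE) auto
    have cA: "card ?A \<le> 2 ^ N * b ^ Suc L"
      by (simp add: card_cartesian_product card_PiE card_Pow)
    have gA: "\<forall>v\<in>?V. ?g v \<in> ?A"
    proof
      fix v assume v: "v \<in> ?V"
      interpret labelled_forest ?E "?U (J v)" L "\<pi> (J v)" "\<lambda>_. 0" 0 by (rule forest[OF v])
      have "T (J v) ((\<pi> (J v) ^^ i) v) < b" for i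
        using Tb[OF v] ancestor_in[OF JU[OF v], of i] by blast
      then show "?g v \<in> ?A" using JN[OF v] by auto
    qed
    obtain c where c: "\<forall>v\<in>?V. c v < 2 ^ N * b ^ Suc L" "\<forall>v\<in>?V. \<forall>w\<in>?V. c v = c w \<longleftrightarrow> ?g v = ?g w"
      using relabel[where V = ?V and g = ?g, OF fA cA gA] by (elim exE conjE)
    have cJ: "J v = J w" if "v \<in> ?V" "w \<in> ?V" "c v = c w" for v w
    proof -
      have "?g v = ?g w" using c(2) that by blast
      then show ?thesis by (simp only: prod.inject)
    qed
    have cT: "T (J v) ((\<pi> (J v) ^^ i) v) = T (J v) ((\<pi> (J v) ^^ i) w)"
      if vw: "v \<in> ?V" "w \<in> ?V" "c v = c w" and i: "i \<le> L" for v w i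
    proof -
      have "?g v = ?g w" using c(2) vw by blast
      then have "snd (?g v) i = snd (?g w) i" by (simp only:)
      then show ?thesis using i cJ[OF vw] by simp
    qed
    have main: "sat2 G P \<phi> u v \<longleftrightarrow> sat2 G P \<phi> u' v'"
      if V: "u \<in> ?V" "v \<in> ?V" "u' \<in> ?V" "v' \<in> ?V" and cc: "c v = c u" "c u' = c u" "c v' = c u"
        and pat: "\<forall>i\<le>L. (\<pi> (J u) ^^ i) u = (\<pi> (J u) ^^ i) v \<longleftrightarrow>
          (\<pi> (J u) ^^ i) u' = (\<pi> (J u) ^^ i) v'" for u v u' v'
    proof -
      let ?I = "J u" and ?\<pi> = "\<pi> (J u)"
      have J: "J v = ?I" "J u' = ?I" "J v' = ?I" using cJ V cc by blast+
      interpret labelled_forest ?E "?U ?I" L ?\<pi> "\<lambda>_. 0" 0 by (rule forest[OF V(1)])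
      have U: "u \<in> ?U ?I" "v \<in> ?U ?I" "u' \<in> ?U ?I" "v' \<in> ?U ?I"
        using JU[OF V(1)] JU[OF V(2)] JU[OF V(3)] JU[OF V(4)] J by simp_all
      note tl' = tl[OF V(1), unfolded type_labelling_def]
      have dep: "depth x = depth u" if x: "x \<in> ?U ?I" "c x = c u" for x
      proof -
        have "T ?I u = T ?I x" using cT[of u x 0] x V(1) by simp
        then show ?thesis using conjunct1[OF tl', rule_format, OF U(1) x(1)] by simp
      qed
      let ?d = "depth u"
      have d: "depth v = ?d" "depth u' = ?d" "depth v' = ?d" using dep U cc by blast+
      have pat': "(?\<pi> ^^ i) u = (?\<pi> ^^ j) v \<longleftrightarrow> (?\<pi> ^^ i) u' = (?\<pi> ^^ j) v'" for i j
        using ancestor_eq_iff[OF U(1,2), of i j] ancestor_eq_iff[OF U(3,4), of i j] d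
          pat[rule_format, of "min i ?d"] depth_le[OF U(1)] by auto
      have patu: "(?\<pi> ^^ i) u = (?\<pi> ^^ j) u \<longleftrightarrow> (?\<pi> ^^ i) u' = (?\<pi> ^^ j) u'" for i j
        using ancestor_eq_iff[OF U(1,1), of i j] ancestor_eq_iff[OF U(3,3), of i j] d by auto
      have patv: "(?\<pi> ^^ i) v = (?\<pi> ^^ j) v \<longleftrightarrow> (?\<pi> ^^ i) v' = (?\<pi> ^^ j) v'" for i j
        using ancestor_eq_iff[OF U(2,2), of i j] ancestor_eq_iff[OF U(4,4), of i j] d by auto
      define \<Theta> where "\<Theta> = (\<lambda>i. ((?\<pi> ^^ i) u, (?\<pi> ^^ i) u')) ` {..L} \<union>
        (\<lambda>i. ((?\<pi> ^^ i) v, (?\<pi> ^^ i) v')) ` {..L}"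
      have cases: "\<exists>i\<le>L. e = ((?\<pi> ^^ i) u, (?\<pi> ^^ i) u') \<or> e = ((?\<pi> ^^ i) v, (?\<pi> ^^ i) v')"
        if "e \<in> \<Theta>" for e using that unfolding \<Theta>_def by auto
      have in1: "((?\<pi> ^^ i) u, (?\<pi> ^^ i) u') \<in> \<Theta>" and in2: "((?\<pi> ^^ i) v, (?\<pi> ^^ i) v') \<in> \<Theta>"
        if "i \<le> L" for i using that unfolding \<Theta>_def by auto
      have \<Theta>U: "\<Theta> \<subseteq> ?U ?I \<times> ?U ?I"
        using ancestor_in[OF U(1)] ancestor_in[OF U(2)] ancestor_in[OF U(3)] ancestor_in[OF U(4)]
        unfolding \<Theta>_def by blast
      have fin: "finite \<Theta>" unfolding \<Theta>_def by simp
      have "card \<Theta> \<le> card ((\<lambda>i. ((?\<pi> ^^ i) u, (?\<pi> ^^ i) u')) ` {..L}) +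
          card ((\<lambda>i. ((?\<pi> ^^ i) v, (?\<pi> ^^ i) v')) ` {..L})" unfolding \<Theta>_def by (rule card_Un_le)
      also have "\<dots> \<le> card {..L} + card {..L}" by (intro add_mono card_image_le) auto
      finally have c1: "card \<Theta> \<le> 2 * (L + 1)" by simp
      have closed: "(?\<pi> x, ?\<pi> y) \<in> \<Theta>" if xy: "(x, y) \<in> \<Theta>" for x y
      proof -
        obtain i where i: "i \<le> L" "(x, y) = ((?\<pi> ^^ i) u, (?\<pi> ^^ i) u') \<or>
            (x, y) = ((?\<pi> ^^ i) v, (?\<pi> ^^ i) v')" using cases[OF xy] by blast
        show ?thesis
        proof (cases "i = L")
          case True
          then have "?\<pi> x = x" "?\<pi> y = y" using i(2) top_fixed U by auto
          then show ?thesis using xy by simp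
        next
          case False
          then show ?thesis using i in1[of "Suc i"] in2[of "Suc i"] by auto
        qed
      qed
      have Teq: "T ?I x = T ?I y" if xy: "(x, y) \<in> \<Theta>" for x y
      proof -
        obtain i where i: "i \<le> L" "(x, y) = ((?\<pi> ^^ i) u, (?\<pi> ^^ i) u') \<or>
            (x, y) = ((?\<pi> ^^ i) v, (?\<pi> ^^ i) v')" using cases[OF xy] by blast
        then show ?thesis
          using cT[OF V(1,3) cc(2)[symmetric] i(1)] cT[OF V(2,4), of i] cc J by auto
      qed
      have bij: "x = x' \<longleftrightarrow> y = y'" if xy: "(x, y) \<in> \<Theta>" "(x', y') \<in> \<Theta>" for x y x' y'
      proof -
        obtain i where i: "(x, y) = ((?\<pi> ^^ i) u, (?\<pi> ^^ i) u') \<or>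
            (x, y) = ((?\<pi> ^^ i) v, (?\<pi> ^^ i) v')" using cases[OF xy(1)] by blast
        obtain j where j: "(x', y') = ((?\<pi> ^^ j) u, (?\<pi> ^^ j) u') \<or>
            (x', y') = ((?\<pi> ^^ j) v, (?\<pi> ^^ j) v')" using cases[OF xy(2)] by blast
        have patvu: "(?\<pi> ^^ i) v = (?\<pi> ^^ j) u \<longleftrightarrow> (?\<pi> ^^ i) v' = (?\<pi> ^^ j) u'"
          unfolding eq_commute[of "(?\<pi> ^^ i) v"] eq_commute[of "(?\<pi> ^^ i) v'"] by (rule pat')
        show ?thesis
          using i[unfolded prod.inject] j[unfolded prod.inject]
          by (elim disjE conjE; simp only: patu pat' patvu patv)
      qed
      have cond: "\<forall>(a, b)\<in>\<Theta>. (?\<pi> a, ?\<pi> b) \<in> \<Theta> \<and> T ?I a = T ?I b \<and> (\<forall>(a', b')\<in>\<Theta>. a = a' \<longleftrightarrow> b = b')"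
      proof (rule ballI)
        fix e assume e: "e \<in> \<Theta>"
        obtain a b where ab: "e = (a, b)" by (cases e)
        have ab': "(a, b) \<in> \<Theta>" using e ab by simp
        then have "\<forall>(a', b')\<in>\<Theta>. a = a' \<longleftrightarrow> b = b'" using bij by blast
        then show "case e of (a, b) \<Rightarrow> (?\<pi> a, ?\<pi> b) \<in> \<Theta> \<and> T ?I a = T ?I b \<and>
            (\<forall>(a', b')\<in>\<Theta>. a = a' \<longleftrightarrow> b = b')"
          using closed[OF ab'] Teq[OF ab'] ab by simp
      qed
      let ?\<theta> = "{(u, u'), (v, v')}"
      have \<theta>: "?\<theta> \<subseteq> \<Theta>" using in1[of 0] in2[of 0] by simp
      have "Domain ((spread F ^^ h) (insert (u, u) ?\<theta>)) = Domain ((spread F ^^ h) ({(u, u)} \<union> {(v, v)}))"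
        by (rule Domain_spread_cong) auto
      also have "\<dots> = Domain ((spread F ^^ h) {(u, u)}) \<union> Domain ((spread F ^^ h) {(v, v)})"
        by (simp only: spread_pow_Un Domain_Un_eq)
      also have "\<dots> \<subseteq> ?U ?I" using DV[OF V(1)] DV[OF V(2)] J(1) unfolding J_def by blast
      finally have dom: "Domain ((spread F ^^ h) (insert (u, u) ?\<theta>)) \<subseteq> ?U ?I" .
      have "card ?\<theta> \<le> 2" by (simp add: card_insert_if)
      then have "Suc (card F) ^ h * Suc (card ?\<theta>) * (L + 1) \<le> Suc m ^ h * 3 * (L + 1)"
        using F(2) by (intro mult_le_mono power_mono) auto
      then have card: "card \<Theta> + Suc (card F) ^ h * Suc (card ?\<theta>) * (L + 1) \<le> q"
        using c1 unfolding q_def by linarith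
      \<comment> \<open>There is no new vertex to match. The extension property is applied to
        \<open>u\<close> once more, and only the similarity of \<open>?\<theta>\<close> is
        kept.\<close>
      have "\<exists>z'\<in>?U ?I. similar ?E F l h (insert (u, z') ?\<theta>)"
        using conjunct2[OF tl'] fin \<Theta>U cond \<theta> U(1) dom card by (elim allE impE)
      then have sim: "similar ?E F l h ?\<theta>" by (elim bexE similar_subset) blast
      let ?s = "\<lambda>n. if n = 0 then u else v" and ?s' = "\<lambda>n. if n = 0 then u' else v'"
      have "assignment_pairs k ?s ?s' \<subseteq> ?\<theta>" by (auto simp: assignment_pairs_def)
      then have "similar ?E F l h (assignment_pairs k ?s ?s')" by (rule similar_subset[OF sim])
      moreover have "range ?s \<subseteq> ?V" "range ?s' \<subseteq> ?V" using V by auto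
      ultimately show ?thesis using F(5) unfolding determines_def sat2_def by blast
    qed
    have "\<exists>\<pi> :: nat \<Rightarrow> nat. \<forall>u\<in>?V. \<forall>v\<in>?V. \<forall>u'\<in>?V. \<forall>v'\<in>?V.
       c u = a \<longrightarrow> c v = a \<longrightarrow> c u' = a \<longrightarrow> c v' = a \<longrightarrow>
       (\<forall>i\<le>L. (\<pi> ^^ i) u = (\<pi> ^^ i) v \<longleftrightarrow> (\<pi> ^^ i) u' = (\<pi> ^^ i) v') \<longrightarrow>
       (sat2 G P \<phi> u v \<longleftrightarrow> sat2 G P \<phi> u' v')" for a
    proof (cases "\<exists>w\<in>?V. c w = a")
      case True
      then obtain w where w: "w \<in> ?V" "c w = a" by blast
      show ?thesis
      proof (intro exI[of _ "\<pi> (J w)"] ballI impI)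
        fix u v u' v' assume V: "u \<in> ?V" "v \<in> ?V" "u' \<in> ?V" "v' \<in> ?V"
          and ca: "c u = a" "c v = a" "c u' = a" "c v' = a"
          and pat: "\<forall>i\<le>L. (\<pi> (J w) ^^ i) u = (\<pi> (J w) ^^ i) v \<longleftrightarrow>
            (\<pi> (J w) ^^ i) u' = (\<pi> (J w) ^^ i) v'"
        have "J w = J u" by (rule cJ) (use w V ca in auto)
        then show "sat2 G P \<phi> u v \<longleftrightarrow> sat2 G P \<phi> u' v'"
          using main[OF V] ca pat by simp
      qed
    qed auto
    then show "\<exists>c :: nat \<Rightarrow> nat. (\<forall>v\<in>?V. c v < 2 ^ N * b ^ Suc L) \<and>
      (\<forall>a. \<exists>\<pi> :: nat \<Rightarrow> nat. \<forall>u\<in>?V. \<forall>v\<in>?V. \<forall>u'\<in>?V. \<forall>v'\<in>?V.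
       c u = a \<longrightarrow> c v = a \<longrightarrow> c u' = a \<longrightarrow> c v' = a \<longrightarrow>
       (\<forall>i\<le>L. (\<pi> ^^ i) u = (\<pi> ^^ i) v \<longleftrightarrow> (\<pi> ^^ i) u' = (\<pi> ^^ i) v') \<longrightarrow>
       (sat2 G P \<phi> u v \<longleftrightarrow> sat2 G P \<phi> u' v'))"
      using c(1) by blast
  qed
qed

section \<open>Cographs of bounded height\<close>

text \<open>The classes of \<open>\<kappa> 0, \<dots>, \<kappa> n\<close> are the nodes of a tree with leaves \<open>U\<close>. In the cograph
  with this cotree, \<open>j i\<close> tells whether the nodes at level \<open>i + 1\<close> are joins or disjoint unions.\<close>

definition cotree ::
  "('a \<Rightarrow> 'a \<Rightarrow> bool) \<Rightarrow> (nat \<Rightarrow> bool) \<Rightarrow> (nat \<Rightarrow> 'a \<Rightarrow> 'b) \<Rightarrow> nat \<Rightarrow> 'a set \<Rightarrow> bool" where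
  "cotree E j \<kappa> n U \<longleftrightarrow> finite U \<and> inj_on (\<kappa> 0) U \<and> (\<forall>u\<in>U. \<forall>v\<in>U. \<kappa> n u = \<kappa> n v) \<and>
     (\<forall>u\<in>U. \<forall>v\<in>U. \<forall>i<n. \<kappa> i u \<noteq> \<kappa> i v \<longrightarrow> \<kappa> (Suc i) u = \<kappa> (Suc i) v \<longrightarrow> (E u v \<longleftrightarrow> j i))"

definition independent :: "('a \<Rightarrow> 'a \<Rightarrow> bool) \<Rightarrow> 'a set \<Rightarrow> bool" where
  "independent E S \<longleftrightarrow> (\<forall>u\<in>S. \<forall>v\<in>S. \<not> E u v)"

lemma cotree_child:
  assumes "cotree E j \<kappa> (Suc n) U"
  shows "cotree E j \<kappa> n {u\<in>U. \<kappa> n u = x}"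
  using assms unfolding cotree_def by (auto simp: inj_on_def)

lemma cotree_top:
  assumes "cotree E j \<kappa> (Suc n) U" "u \<in> U" "v \<in> U" "\<kappa> n u \<noteq> \<kappa> n v"
  shows "E u v \<longleftrightarrow> j n"
  using assms unfolding cotree_def by blast

text \<open>This is perfection of cographs: cliques are indexed by an independent set, so there are
  at most as many as the independence number. In a union the indices of the parts are collected. In
  a join they are injected into the largest index set, and cliques of equal index merge.\<close>

lemma cotree_clique_cover:
  assumes irrefl: "\<And>u. \<not> E u u"
  shows "cotree E j \<kappa> n U \<Longrightarrow> \<exists>S g. S \<subseteq> U \<and> independent E S \<and> g ` U \<subseteq> S \<and>
    (\<forall>u\<in>U. \<forall>v\<in>U. g u = g v \<longrightarrow> u \<noteq> v \<longrightarrow> E u v)"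
proof (induction n arbitrary: U)
  case 0
  then have "u = v" if "u \<in> U" "v \<in> U" for u v using that unfolding cotree_def inj_on_def by blast
  then show ?case
    by (intro exI[of _ U] exI[of _ id]) (use irrefl in \<open>auto simp: independent_def\<close>)
next
  case (Suc n)
  let ?U = "\<lambda>x. {u\<in>U. \<kappa> n u = x}"
  have "\<forall>x. \<exists>S g. S \<subseteq> ?U x \<and> independent E S \<and> g ` ?U x \<subseteq> S \<and>
    (\<forall>u\<in>?U x. \<forall>v\<in>?U x. g u = g v \<longrightarrow> u \<noteq> v \<longrightarrow> E u v)"
    by (intro allI Suc.IH cotree_child[OF Suc.prems])
  then obtain S g where S: "\<forall>x. S x \<subseteq> ?U x \<and> independent E (S x) \<and> g x ` ?U x \<subseteq> S x \<and>
    (\<forall>u\<in>?U x. \<forall>v\<in>?U x. g x u = g x v \<longrightarrow> u \<noteq> v \<longrightarrow> E u v)"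
    unfolding choice_iff by (elim exE)
  have SU: "u \<in> U" "\<kappa> n u = x" if "u \<in> S x" for u x using S that by blast+
  have gS: "g (\<kappa> n u) u \<in> S (\<kappa> n u)" if "u \<in> U" for u using S that by blast
  have same: "E u v" if "u \<in> U" "v \<in> U" "\<kappa> n u = \<kappa> n v" "g (\<kappa> n u) u = g (\<kappa> n v) v" "u \<noteq> v" for u v
    using S[rule_format, of "\<kappa> n u"] that by simp
  have finU: "finite U" using Suc.prems by (simp add: cotree_def)
  show ?case
  proof (cases "j n")
    case False
    let ?S = "\<Union>x. S x" and ?g = "\<lambda>u. g (\<kappa> n u) u"
    have "independent E ?S"
      unfolding independent_def
    proof (intro ballI)
      fix u v assume uv: "u \<in> ?S" "v \<in> ?S"
      then have U: "u \<in> U" "v \<in> U" "u \<in> S (\<kappa> n u)" "v \<in> S (\<kappa> n v)" using SU by blast+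
      show "\<not> E u v"
      proof (cases "\<kappa> n u = \<kappa> n v")
        case True
        then show ?thesis using S[rule_format, of "\<kappa> n u"] U(3,4) by (simp add: independent_def)
      next
        case F: False
        then show ?thesis using cotree_top[OF Suc.prems U(1,2) F] False by simp
      qed
    qed
    moreover have "?S \<subseteq> U" using SU by blast
    moreover have "?g ` U \<subseteq> ?S" using gS by blast
    moreover have "E u v" if "u \<in> U" "v \<in> U" "?g u = ?g v" "u \<noteq> v" for u v
    proof (rule same[OF that(1,2) _ that(3,4)])
      have "\<kappa> n u = \<kappa> n (?g u)" "\<kappa> n (?g v) = \<kappa> n v" using SU(2)[OF gS] that(1,2) by auto
      then show "\<kappa> n u = \<kappa> n v" using that(3) by simp
    qed
    ultimately show ?thesis by (intro exI[of _ ?S] exI[of _ ?g]) blast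
  next
    case True
    show ?thesis
    proof (cases "U = {}")
      case False
      let ?N = "(\<lambda>x. card (S x)) ` \<kappa> n ` U"
      have N: "finite ?N" "?N \<noteq> {}" using finU False by auto
      obtain x0 where "Max ?N = card (S x0)" using Max_in[OF N] by blast
      then have x0: "\<forall>x\<in>\<kappa> n ` U. card (S x) \<le> card (S x0)"
        using Max_ge[OF N(1)] by auto
      have finS: "finite (S x)" for x
        using S[rule_format, of x] finU by (intro finite_subset[of "S x" U]) auto
      have "\<exists>\<iota>. inj_on \<iota> (S x) \<and> \<iota> ` S x \<subseteq> S x0" if "x \<in> \<kappa> n ` U" for x
      proof -
        have "card (S x) \<le> card (S x0)" using x0 that by blast
        from card_le_inj[OF finS finS this] show ?thesis by (elim exE conjE) (intro exI conjI)
      qed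
      then have "\<forall>x\<in>\<kappa> n ` U. \<exists>\<iota>. inj_on \<iota> (S x) \<and> \<iota> ` S x \<subseteq> S x0" by (rule ballI)
      from bchoice[OF this] obtain \<iota> where
        \<iota>: "\<forall>x\<in>\<kappa> n ` U. inj_on (\<iota> x) (S x) \<and> \<iota> x ` S x \<subseteq> S x0" by (elim exE)
      let ?g = "\<lambda>u. \<iota> (\<kappa> n u) (g (\<kappa> n u) u)"
      have "?g ` U \<subseteq> S x0" using \<iota> gS by blast
      moreover have "E u v" if uv: "u \<in> U" "v \<in> U" "?g u = ?g v" "u \<noteq> v" for u v
      proof (cases "\<kappa> n u = \<kappa> n v")
        case eq: True
        have "inj_on (\<iota> (\<kappa> n u)) (S (\<kappa> n u))" using \<iota> uv(1) by blast
        then have "g (\<kappa> n u) u = g (\<kappa> n v) v"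
          using uv(3) gS[OF uv(1)] gS[OF uv(2)] eq by (simp add: inj_on_def)
        then show ?thesis by (rule same[OF uv(1,2) eq _ uv(4)])
      next
        case F: False
        then show ?thesis using cotree_top[OF Suc.prems uv(1,2) F] True by simp
      qed
      moreover have "S x0 \<subseteq> U" "independent E (S x0)" using S by blast+
      ultimately show ?thesis by (intro exI[of _ "S x0"] exI[of _ ?g]) blast
    qed (auto simp: independent_def)
  qed
qed

text \<open>In a join without induced \<open>K\<^sub>t\<^sub>,\<^sub>t\<close>, all parts but one have independence number less than
  \<open>t\<close>, so they can be covered by less than \<open>t\<close> cliques, and these cliques can be joined.\<close>

lemma cotree_subcoloring:
  assumes irrefl: "\<And>u. \<not> E u u"
  shows "cotree E j \<kappa> n U \<Longrightarrow>
    (\<And>X Y. X \<subseteq> U \<Longrightarrow> Y \<subseteq> U \<Longrightarrow> card X = t \<Longrightarrow> card Y = t \<Longrightarrow> independent E X \<Longrightarrow> independent E Y \<Longrightarrow>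
      \<exists>x\<in>X. \<exists>y\<in>Y. \<not> E x y) \<Longrightarrow>
    \<exists>c :: 'a \<Rightarrow> nat. (\<forall>u\<in>U. c u < n * t + 1) \<and>
      (\<forall>u\<in>U. \<forall>v\<in>U. \<forall>w\<in>U. c u = c v \<longrightarrow> c v = c w \<longrightarrow> E u v \<longrightarrow> E v w \<longrightarrow> u \<noteq> w \<longrightarrow> E u w)"
proof (induction n arbitrary: U)
  case 0
  then have "u = v" if "u \<in> U" "v \<in> U" for u v using that unfolding cotree_def inj_on_def by blast
  then show ?case by (intro exI[of _ "\<lambda>_. 0"]) (use irrefl in auto)
next
  case (Suc n)
  note ct = Suc.prems(1) and free = Suc.prems(2)
  let ?U = "\<lambda>x. {u\<in>U. \<kappa> n u = x}"
  have "\<exists>c :: 'a \<Rightarrow> nat. (\<forall>u\<in>?U x. c u < n * t + 1) \<and>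
      (\<forall>u\<in>?U x. \<forall>v\<in>?U x. \<forall>w\<in>?U x. c u = c v \<longrightarrow> c v = c w \<longrightarrow> E u v \<longrightarrow> E v w \<longrightarrow> u \<noteq> w \<longrightarrow> E u w)" for x
    by (rule Suc.IH[OF cotree_child[OF ct]], rule free) auto
  then have "\<forall>x. \<exists>c :: 'a \<Rightarrow> nat. (\<forall>u\<in>?U x. c u < n * t + 1) \<and>
      (\<forall>u\<in>?U x. \<forall>v\<in>?U x. \<forall>w\<in>?U x. c u = c v \<longrightarrow> c v = c w \<longrightarrow> E u v \<longrightarrow> E v w \<longrightarrow> u \<noteq> w \<longrightarrow> E u w)"
    by (rule allI)
  then obtain c :: "'b \<Rightarrow> 'a \<Rightarrow> nat" where c: "\<forall>x. (\<forall>u\<in>?U x. c x u < n * t + 1) \<and>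
      (\<forall>u\<in>?U x. \<forall>v\<in>?U x. \<forall>w\<in>?U x. c x u = c x v \<longrightarrow> c x v = c x w \<longrightarrow> E u v \<longrightarrow> E v w \<longrightarrow> u \<noteq> w \<longrightarrow> E u w)"
    unfolding choice_iff by (elim exE)
  have clt: "c (\<kappa> n u) u < n * t + 1" if "u \<in> U" for u
    using c[rule_format, of "\<kappa> n u"] that by simp
  have cE: "E u w" if "u \<in> ?U x" "v \<in> ?U x" "w \<in> ?U x" "c x u = c x v" "c x v = c x w" "E u v" "E v w" "u \<noteq> w"
    for x u v w using c that by blast
  have finU: "finite U" using ct by (simp add: cotree_def)
  show ?case
  proof (cases "j n")
    case False
    let ?c = "\<lambda>u. c (\<kappa> n u) u"
    have "E u w" if uvw: "u \<in> U" "v \<in> U" "w \<in> U" "?c u = ?c v" "?c v = ?c w" "E u v" "E v w" "u \<noteq> w" for u v w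
    proof -
      have "\<kappa> n u = \<kappa> n v" using cotree_top[OF ct uvw(1,2)] uvw(6) False by blast
      moreover have "\<kappa> n v = \<kappa> n w" using cotree_top[OF ct uvw(2,3)] uvw(7) False by blast
      ultimately show ?thesis by (intro cE[of u "\<kappa> n v" v w]) (use uvw in auto)
    qed
    moreover have "?c u < Suc n * t + 1" if "u \<in> U" for u using clt[OF that] by simp
    ultimately show ?thesis by (intro exI[of _ ?c]) blast
  next
    case True
    have "\<forall>x. \<exists>S g. S \<subseteq> ?U x \<and> independent E S \<and> g ` ?U x \<subseteq> S \<and>
      (\<forall>u\<in>?U x. \<forall>v\<in>?U x. g u = g v \<longrightarrow> u \<noteq> v \<longrightarrow> E u v)"
      by (intro allI cotree_clique_cover[OF irrefl cotree_child[OF ct]])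
    then obtain S g where S: "\<forall>x. S x \<subseteq> ?U x \<and> independent E (S x) \<and> g x ` ?U x \<subseteq> S x \<and>
      (\<forall>u\<in>?U x. \<forall>v\<in>?U x. g x u = g x v \<longrightarrow> u \<noteq> v \<longrightarrow> E u v)"
      unfolding choice_iff by (elim exE)
    have Sx: "S x \<subseteq> ?U x" "independent E (S x)" for x using S by blast+
    have finS: "finite (S x)" for x by (rule finite_subset[OF Sx(1)]) (use finU in simp)
    \<comment> \<open>Independent sets of size \<open>t\<close> in two parts of a join would form
      the forbidden biclique.\<close>
    have "x = y" if xy: "card (S x) \<ge> t" "card (S y) \<ge> t" for x y
    proof (rule ccontr)
      assume ne: "x \<noteq> y"
      obtain X where X: "X \<subseteq> S x" "card X = t" using obtain_subset_with_card_n[OF xy(1)] by blast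
      obtain Y where Y: "Y \<subseteq> S y" "card Y = t" using obtain_subset_with_card_n[OF xy(2)] by blast
      have XY: "X \<subseteq> ?U x" "Y \<subseteq> ?U y" using X(1) Y(1) Sx(1) by blast+
      have "independent E X" "independent E Y"
        using X(1) Y(1) Sx(2) unfolding independent_def by blast+
      then obtain a b where ab: "a \<in> X" "b \<in> Y" "\<not> E a b"
        using free[of X Y] XY X(2) Y(2) by blast
      have "\<kappa> n a \<noteq> \<kappa> n b" "a \<in> U" "b \<in> U" using ab XY ne by blast+
      then show False using cotree_top[OF ct, of a b] True ab(3) by blast
    qed
    then obtain x0 where x0: "\<And>x. x \<noteq> x0 \<Longrightarrow> card (S x) < t" by (metis not_less)
    have "\<exists>\<iota> :: 'a \<Rightarrow> nat. inj_on \<iota> (S x) \<and> \<iota> ` S x \<subseteq> {..<t}" if "x \<noteq> x0" for x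
    proof -
      have "card (S x) \<le> card {..<t}" using x0[OF that] by simp
      from card_le_inj[OF finS finite_lessThan this] show ?thesis
        by (elim exE conjE) (intro exI conjI)
    qed
    then have "\<forall>x\<in>- {x0}. \<exists>\<iota> :: 'a \<Rightarrow> nat. inj_on \<iota> (S x) \<and> \<iota> ` S x \<subseteq> {..<t}" by auto
    from bchoice[OF this] obtain \<iota> :: "'b \<Rightarrow> 'a \<Rightarrow> nat" where
      \<iota>: "\<forall>x\<in>- {x0}. inj_on (\<iota> x) (S x) \<and> \<iota> x ` S x \<subseteq> {..<t}" by (elim exE)
    have gS: "g (\<kappa> n u) u \<in> S (\<kappa> n u)" if "u \<in> U" for u using S that by blast
    \<comment> \<open>The exceptional part keeps its recursive coloring. All other parts share
      \<open>t\<close> new colors, so each level of the cotree costs \<open>t\<close>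
      colors.\<close>
    define d where "d u = (if \<kappa> n u = x0 then c x0 u else n * t + 1 + \<iota> (\<kappa> n u) (g (\<kappa> n u) u))" for u
    have dlt: "d u < Suc n * t + 1" if u: "u \<in> U" for u
    proof (cases "\<kappa> n u = x0")
      case True
      then show ?thesis using clt[OF u] by (simp add: d_def)
    next
      case False
      then have "\<iota> (\<kappa> n u) (g (\<kappa> n u) u) < t" using \<iota> gS[OF u] by blast
      then show ?thesis using False by (simp add: d_def)
    qed
    have in0: "\<kappa> n u = x0 \<longleftrightarrow> d u < n * t + 1" if u: "u \<in> U" for u
      using clt[OF u] by (auto simp: d_def)
    have "E u w" if uvw: "u \<in> U" "v \<in> U" "w \<in> U" "d u = d v" "d v = d w" "E u v" "E v w" "u \<noteq> w" for u v w
    proof (cases "\<kappa> n u = x0")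
      case 0: True
      then have "\<kappa> n v = x0" "\<kappa> n w = x0" using in0 uvw(1-5) by auto
      then show ?thesis using 0 uvw by (intro cE[of u x0 v w]) (auto simp: d_def)
    next
      case F: False
      then have F': "\<kappa> n w \<noteq> x0" using in0 uvw(1-5) by auto
      show ?thesis
      proof (cases "\<kappa> n u = \<kappa> n w")
        case eq: True
        have "\<iota> (\<kappa> n u) (g (\<kappa> n u) u) = \<iota> (\<kappa> n u) (g (\<kappa> n u) w)"
          using uvw(4,5) F F' eq by (simp add: d_def)
        moreover have "inj_on (\<iota> (\<kappa> n u)) (S (\<kappa> n u))" using \<iota> F by blast
        ultimately have "g (\<kappa> n u) u = g (\<kappa> n u) w"
          using gS[OF uvw(1)] gS[OF uvw(3)] eq by (simp add: inj_on_def)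
        then show ?thesis using S[rule_format, of "\<kappa> n u"] uvw(1,3,8) eq by simp
      qed (use cotree_top[OF ct uvw(1,3)] True in simp)
    qed
    then show ?thesis using dlt by (intro exI[of _ d]) blast
  qed
qed

section \<open>From cotrees to subcolorings\<close>

lemma biclique_contained:
  assumes H: "simple_graph H" and X: "X \<subseteq> verts H" "card X = t" "independent (adj H) X"
    and Y: "Y \<subseteq> verts H" "card Y = t" "independent (adj H) Y"
    and XY: "\<And>x y. x \<in> X \<Longrightarrow> y \<in> Y \<Longrightarrow> adj H x y"
  shows "contains_induced H (complete_bipartite t t)"
proof -
  have fin: "finite X" "finite Y" using X(1) Y(1) simple_graph_finite[OF H] finite_subset by blast+
  obtain f where f: "bij_betw f {..<t} X"
    using ex_bij_betw_nat_finite[OF fin(1)] X(2) by (auto simp: atLeast0LessThan)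
  obtain g where g: "bij_betw g {..<t} Y"
    using ex_bij_betw_nat_finite[OF fin(2)] Y(2) by (auto simp: atLeast0LessThan)
  have fX: "f i \<in> X" "g i \<in> Y" if "i < t" for i using f g that by (auto simp: bij_betw_def)
  have YX: "adj H y x" if "x \<in> X" "y \<in> Y" for x y using simple_graph_sym[OF H XY[OF that]] .
  have ne: "x \<noteq> y" if "x \<in> X" "y \<in> Y" for x y using XY[OF that] simple_graph_irrefl[OF H] by auto
  have XX: "\<not> adj H x x'" if "x \<in> X" "x' \<in> X" for x x' using X(3) that by (simp add: independent_def)
  have YY: "\<not> adj H y y'" if "y \<in> Y" "y' \<in> Y" for y y' using Y(3) that by (simp add: independent_def)
  let ?h = "case_sum f g" and ?K = "complete_bipartite t t"
  have "bij_betw ?h (verts ?K) (X \<union> Y)"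
    unfolding bij_betw_def
  proof
    show "inj_on ?h (verts ?K)"
    proof (rule inj_onI)
      fix a b assume "a \<in> verts ?K" "b \<in> verts ?K" and eq: "?h a = ?h b"
      then have "a \<in> {..<t} <+> {..<t}" "b \<in> {..<t} <+> {..<t}" by (simp_all add: complete_bipartite_def)
      then show "a = b"
        using eq ne[OF fX(1) fX(2)] ne[OF fX(1) fX(2), symmetric] f g
        by (auto simp: bij_betw_def inj_on_def)
    qed
    have "?h ` ({..<t} <+> {..<t}) = f ` {..<t} \<union> g ` {..<t}"
      by (simp add: Plus_def image_Un image_image)
    then show "?h ` verts ?K = X \<union> Y" using f g by (simp add: complete_bipartite_def bij_betw_def)
  qed
  moreover have "adj ?K a b \<longleftrightarrow> adj (induced H (X \<union> Y)) (?h a) (?h b)"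
    if "a \<in> verts ?K" "b \<in> verts ?K" for a b
  proof -
    have "a \<in> {..<t} <+> {..<t}" "b \<in> {..<t} <+> {..<t}"
      using that by (simp_all add: complete_bipartite_def)
    then show ?thesis
      using fX XY YX XX YY by (auto simp: complete_bipartite_def induced_def)
  qed
  ultimately have "isomorphic ?K (induced H (X \<union> Y))"
    unfolding isomorphic_def by (intro exI[of _ ?h]) (simp add: induced_def)
  then show ?thesis unfolding contains_induced_def using X(1) Y(1) by (intro exI[of _ "X \<union> Y"]) simp
qed

text \<open>Along a walk each vertex stays equal or adjacent to the start, since induced paths on
  three vertices are excluded.\<close>

lemma cluster_graphI:
  assumes "\<And>u v w. u \<in> W \<Longrightarrow> v \<in> W \<Longrightarrow> w \<in> W \<Longrightarrow> adj H u v \<Longrightarrow> adj H v w \<Longrightarrow> u \<noteq> w \<Longrightarrow> adj H u w"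
    and sym: "\<And>u v. adj H u v \<Longrightarrow> adj H v u"
  shows "cluster_graph (induced H W)"
proof -
  let ?A = "\<lambda>u v. u \<in> W \<and> v \<in> W \<and> adj H u v"
  have *: "u = v \<or> adj H u v" if "?A\<^sup>*\<^sup>* u v" "u \<in> W" for u v
    using that(1)
  proof (induction rule: rtranclp_induct)
    case (step v w)
    then show ?case using assms(1)[of u v w] that(2) by blast
  qed simp
  have "adj H u v" if x: "x \<in> W" "?A\<^sup>*\<^sup>* x u" "?A\<^sup>*\<^sup>* x v" "u \<in> W" "v \<in> W" "u \<noteq> v" for x u v
  proof -
    have "x = u \<or> adj H u x" "x = v \<or> adj H x v" using *[OF x(2,1)] *[OF x(3,1)] sym by blast+
    then show ?thesis using assms(1)[of u x v] x by blast
  qed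
  then show ?thesis
    unfolding cluster_graph_def components_def clique_def induced_def by auto
qed

lemma subchromatic_number_le:
  assumes H: "simple_graph H" and "\<And>v. v \<in> verts H \<Longrightarrow> c v < k"
    and "\<And>u v w. u \<in> verts H \<Longrightarrow> v \<in> verts H \<Longrightarrow> w \<in> verts H \<Longrightarrow> c u = c v \<Longrightarrow> c v = c w \<Longrightarrow>
      adj H u v \<Longrightarrow> adj H v w \<Longrightarrow> u \<noteq> w \<Longrightarrow> adj H u w"
  shows "subchromatic_number H \<le> k"
proof -
  have "cluster_graph (induced H {v \<in> verts H. c v = i})" for i
  proof (rule cluster_graphI[OF _ simple_graph_sym[OF H]])
    fix u v w
    assume "u \<in> {v \<in> verts H. c v = i}" "v \<in> {v \<in> verts H. c v = i}" "w \<in> {v \<in> verts H. c v = i}"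
      and e: "adj H u v" "adj H v w" "u \<noteq> w"
    then show "adj H u w" by (intro assms(3)[OF _ _ _ _ _ e]) simp_all
  qed
  then have "subcoloring H {..<k} c" using assms(2) by (auto simp: subcoloring_def)
  then show ?thesis unfolding subchromatic_number_def by (intro Least_le) blast
qed

text \<open>Chains that have met stay together. So within a class of \<open>c\<close> the
  coincidences of two chains are described by the level where they meet, adjacency depends on this
  level alone, and the levels form a cotree.\<close>

lemma transducible_subchromatic_number:
  fixes G :: "'b graph" and H :: "'a graph"
  assumes H: "simple_graph H" and free: "\<not> contains_induced H (complete_bipartite t t)"
    and ci: "contains_induced (interpreted \<phi> G P) H"
    and c: "\<forall>v\<in>verts G. (c :: 'b \<Rightarrow> nat) v < n"
    and tree: "\<forall>a. \<exists>\<pi> :: 'b \<Rightarrow> 'b. \<forall>u\<in>verts G. \<forall>v\<in>verts G. \<forall>u'\<in>verts G. \<forall>v'\<in>verts G.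
       c u = a \<longrightarrow> c v = a \<longrightarrow> c u' = a \<longrightarrow> c v' = a \<longrightarrow>
       (\<forall>i\<le>L. (\<pi> ^^ i) u = (\<pi> ^^ i) v \<longleftrightarrow> (\<pi> ^^ i) u' = (\<pi> ^^ i) v') \<longrightarrow>
       (sat2 G P \<phi> u v \<longleftrightarrow> sat2 G P \<phi> u' v')"
  shows "subchromatic_number H \<le> n * (Suc L * t + 1)"
proof -
  obtain S f where S: "S \<subseteq> verts G" and f: "bij_betw f (verts H) S"
    and fadj: "\<And>u v. u \<in> verts H \<Longrightarrow> v \<in> verts H \<Longrightarrow>
      adj H u v \<longleftrightarrow> adj (induced (interpreted \<phi> G P) S) (f u) (f v)"
    using ci unfolding contains_induced_def isomorphic_def by (auto simp: induced_def interpreted_def)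
  have fV: "f v \<in> verts G" "f v \<in> S" if "v \<in> verts H" for v
    using that f S by (auto simp: bij_betw_def)
  have finj: "inj_on f (verts H)" using f by (simp add: bij_betw_def)
  have adj: "adj H u v \<longleftrightarrow> sat2 G P \<phi> (f u) (f v)" if "u \<in> verts H" "v \<in> verts H" "u \<noteq> v" for u v
    using fadj[OF that(1,2)] fV[OF that(1)] fV[OF that(2)] inj_onD[OF finj _ that(1,2)] that(3)
    by (auto simp: induced_def interpreted_def)
  let ?W = "\<lambda>a. {v\<in>verts H. c (f v) = a}" and ?m = "Suc L * t + 1"
  have "\<exists>d :: 'a \<Rightarrow> nat. (\<forall>u\<in>?W a. d u < ?m) \<and>
    (\<forall>u\<in>?W a. \<forall>v\<in>?W a. \<forall>w\<in>?W a. d u = d v \<longrightarrow> d v = d w \<longrightarrow> adj H u v \<longrightarrow> adj H v w \<longrightarrow> u \<noteq> w \<longrightarrow> adj H u w)"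
    for a
  proof -
    obtain \<pi> :: "'b \<Rightarrow> 'b" where \<pi>: "\<forall>u\<in>verts G. \<forall>v\<in>verts G. \<forall>u'\<in>verts G. \<forall>v'\<in>verts G.
       c u = a \<longrightarrow> c v = a \<longrightarrow> c u' = a \<longrightarrow> c v' = a \<longrightarrow>
       (\<forall>i\<le>L. (\<pi> ^^ i) u = (\<pi> ^^ i) v \<longleftrightarrow> (\<pi> ^^ i) u' = (\<pi> ^^ i) v') \<longrightarrow>
       (sat2 G P \<phi> u v \<longleftrightarrow> sat2 G P \<phi> u' v')" using tree by blast
    \<comment> \<open>The value \<open>None\<close> above level \<open>L\<close> adds a common root,
      as the forest may have several trees. This makes the height \<open>Suc L\<close>.\<close>
    define \<kappa> where "\<kappa> i v = (if i \<le> L then Some ((\<pi> ^^ i) (f v)) else None)" for i v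
    \<comment> \<open>Any pair that first meets at level \<open>i + 1\<close> may decide
      \<open>j i\<close>; by the property of \<open>\<pi>\<close> all such pairs agree.\<close>
    define j where "j i \<longleftrightarrow> (\<exists>u\<in>?W a. \<exists>v\<in>?W a. \<kappa> i u \<noteq> \<kappa> i v \<and> \<kappa> (Suc i) u = \<kappa> (Suc i) v \<and> adj H u v)" for i
    have up: "\<kappa> i' u = \<kappa> i' v" if "\<kappa> i u = \<kappa> i v" "i \<le> i'" for i i' u v
    proof -
      have "(\<pi> ^^ i') x = (\<pi> ^^ (i' - i)) ((\<pi> ^^ i) x)" for x
        using that(2) by (metis comp_apply funpow_add le_add_diff_inverse2)
      then show ?thesis using that by (auto simp: \<kappa>_def split: if_splits)
    qed
    have level: "\<kappa> i' u = \<kappa> i' v \<longleftrightarrow> i < i'" if "\<kappa> i u \<noteq> \<kappa> i v" "\<kappa> (Suc i) u = \<kappa> (Suc i) v" for i i' u v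
      using up[OF that(2), of i'] up[of i' u v i] that(1) by (cases "i < i'") auto
    have "cotree (adj H) j \<kappa> (Suc L) (?W a)"
      unfolding cotree_def
    proof (intro conjI ballI allI impI)
      show "finite (?W a)" using simple_graph_finite[OF H] by simp
      show "inj_on (\<kappa> 0) (?W a)" using finj by (auto simp: \<kappa>_def inj_on_def)
      show "\<kappa> (Suc L) u = \<kappa> (Suc L) v" for u v by (simp add: \<kappa>_def)
    next
      fix u v i assume uv: "u \<in> ?W a" "v \<in> ?W a"
        and i: "\<kappa> i u \<noteq> \<kappa> i v" "\<kappa> (Suc i) u = \<kappa> (Suc i) v"
      show "adj H u v \<longleftrightarrow> j i"
      proof
        assume "adj H u v"
        then show "j i" using uv i unfolding j_def by blast
      next
        assume "j i"
        then obtain u' v' where uv': "u' \<in> ?W a" "v' \<in> ?W a" "adj H u' v'"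
          and i': "\<kappa> i u' \<noteq> \<kappa> i v'" "\<kappa> (Suc i) u' = \<kappa> (Suc i) v'" unfolding j_def by blast
        have "(\<pi> ^^ k) (f u') = (\<pi> ^^ k) (f v') \<longleftrightarrow> (\<pi> ^^ k) (f u) = (\<pi> ^^ k) (f v)" if "k \<le> L" for k
          using level[OF i, of k] level[OF i', of k] that by (simp add: \<kappa>_def)
        then have "sat2 G P \<phi> (f u') (f v') \<longleftrightarrow> sat2 G P \<phi> (f u) (f v)"
          using uv uv' fV by (intro \<pi>[rule_format]) auto
        moreover have "u \<noteq> v" "u' \<noteq> v'" using i i' by auto
        ultimately show "adj H u v" using adj uv uv' by simp
      qed
    qed
    then show ?thesis
    proof (rule cotree_subcoloring[OF simple_graph_irrefl[OF H]])
      fix X Y assume XY: "X \<subseteq> ?W a" "Y \<subseteq> ?W a" "card X = t" "card Y = t"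
        "independent (adj H) X" "independent (adj H) Y"
      show "\<exists>x\<in>X. \<exists>y\<in>Y. \<not> adj H x y"
      proof (rule ccontr)
        assume "\<not> ?thesis"
        then have "contains_induced H (complete_bipartite t t)"
          using XY by (intro biclique_contained[OF H, of X t Y]) auto
        then show False using free by contradiction
      qed
    qed
  qed
  then have "\<forall>a. \<exists>d :: 'a \<Rightarrow> nat. (\<forall>u\<in>?W a. d u < ?m) \<and>
    (\<forall>u\<in>?W a. \<forall>v\<in>?W a. \<forall>w\<in>?W a. d u = d v \<longrightarrow> d v = d w \<longrightarrow> adj H u v \<longrightarrow> adj H v w \<longrightarrow> u \<noteq> w \<longrightarrow> adj H u w)"
    by (rule allI)
  then obtain d :: "nat \<Rightarrow> 'a \<Rightarrow> nat" where d: "\<forall>a. (\<forall>u\<in>?W a. d a u < ?m) \<and>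
    (\<forall>u\<in>?W a. \<forall>v\<in>?W a. \<forall>w\<in>?W a. d a u = d a v \<longrightarrow> d a v = d a w \<longrightarrow> adj H u v \<longrightarrow> adj H v w \<longrightarrow> u \<noteq> w \<longrightarrow> adj H u w)"
    unfolding choice_iff by (elim exE)
  have dm: "d (c (f v)) v < ?m" if "v \<in> verts H" for v using d that by blast
  \<comment> \<open>The two colors become one number below \<open>n * ?m\<close>, from which
    \<open>div\<close> and \<open>mod\<close> recover them.\<close>
  let ?c = "\<lambda>v. c (f v) * ?m + d (c (f v)) v"
  have dec: "c (f v) = ?c v div ?m" "d (c (f v)) v = ?c v mod ?m" if "v \<in> verts H" for v
  proof -
    have "(a * k + b) div k = a" "(a * k + b) mod k = b" if "b < k" for a b k :: nat
      using that by simp_all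
    from this[OF dm[OF that], of "c (f v)"]
    show "c (f v) = ?c v div ?m" "d (c (f v)) v = ?c v mod ?m" by (simp_all only:)
  qed
  show ?thesis
  proof (rule subchromatic_number_le[OF H])
    fix v assume v: "v \<in> verts H"
    have "?c v < Suc (c (f v)) * ?m" using dm[OF v] by simp
    also have "\<dots> \<le> n * ?m" using c fV(1)[OF v] by (intro mult_le_mono1) (simp add: Suc_le_eq)
    finally show "?c v < n * ?m" .
  next
    fix u v w assume uvw: "u \<in> verts H" "v \<in> verts H" "w \<in> verts H" "?c u = ?c v" "?c v = ?c w"
      "adj H u v" "adj H v w" "u \<noteq> w"
    have cc: "c (f u) = c (f v)" "c (f v) = c (f w)"
      using dec(1)[OF uvw(1)] dec(1)[OF uvw(2)] dec(1)[OF uvw(3)] uvw(4,5) by metis+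
    have dd: "d (c (f u)) u = d (c (f v)) v" "d (c (f v)) v = d (c (f w)) w"
      using dec(2)[OF uvw(1)] dec(2)[OF uvw(2)] dec(2)[OF uvw(3)] uvw(4,5) by metis+
    show "adj H u w"
      using conjunct2[OF d[THEN spec, of "c (f v)"], rule_format, of u v w] uvw cc dd by simp
  qed
qed

theorem theorem3p4:
  fixes t :: nat and \<D> :: "'a graph set"
  assumes "graph_class \<D>"
    and "structurally_bounded_expansion \<D>"
    and "\<forall>G\<in>\<D>. \<not> contains_induced G (complete_bipartite t t)"
  shows "bounded_subchromatic_number \<D>"
proof -
  obtain \<C> :: "nat graph set" and T where C: "graph_class \<C>" "bounded_expansion \<C>"
    and T: "\<forall>H\<in>\<D>. \<exists>G\<in>\<C>. transducible T G H"
    using assms(2) unfolding structurally_bounded_expansion_def class_transducible_def by blast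
  obtain n L where part: "\<forall>G\<in>\<C>. \<forall>P. \<exists>c :: nat \<Rightarrow> nat. (\<forall>v\<in>verts G. c v < n) \<and>
    (\<forall>a. \<exists>\<pi> :: nat \<Rightarrow> nat. \<forall>u\<in>verts G. \<forall>v\<in>verts G. \<forall>u'\<in>verts G. \<forall>v'\<in>verts G.
       c u = a \<longrightarrow> c v = a \<longrightarrow> c u' = a \<longrightarrow> c v' = a \<longrightarrow>
       (\<forall>i\<le>L. (\<pi> ^^ i) u = (\<pi> ^^ i) v \<longleftrightarrow> (\<pi> ^^ i) u' = (\<pi> ^^ i) v') \<longrightarrow>
       (sat2 G P (formula T) u v \<longleftrightarrow> sat2 G P (formula T) u' v'))"
    using tree_partition[OF C, of "formula T"] by (elim exE)
  have "subchromatic_number H \<le> n * (Suc L * t + 1)" if H: "H \<in> \<D>" for H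
  proof -
    have sH: "simple_graph H" using assms(1) H by (simp add: graph_class_def)
    obtain G P where G: "G \<in> \<C>" and P: "contains_induced (interpreted (formula T) G P) H"
      using T H unfolding transducible_def by blast
    show ?thesis
      using part[rule_format, OF G, of P] assms(3) H
      by (elim exE conjE) (rule transducible_subchromatic_number[OF sH _ P], auto)
  qed
  then show ?thesis unfolding bounded_subchromatic_number_def by blast
qed

end
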